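(* Let $w$ and $p$ be even positive integers, $N=[\tfrac14p]$ and let $M$ be a positive integer. Then, as $a\to0+$, the functions $E_r(a;w,p)$ and $\hat E_N(a;w,p)$ can be written in the form $$E_r(a;w,p)=\frac{A}{\pi\kappa}\sum_{n=1}^\infty n^{w-1}X_n^{\vartheta}\,e^{-X_n\cos\pi\psi_r}\,\Upsilon_{n,r}\qquad(0\le r\le N-1),$$ $$\hat E_N(a;w,p)=\frac{A}{2\pi\kappa}\sum_{n=1}^\infty n^{w-1}X_n^{\vartheta}\,e^{-X_n}\,\Upsilon_{n,N},$$ where the $\Upsilon_{n,r}$ $(0\le r\le N)$ have the asymptotic expansions $$\Upsilon_{n,r}=\sum_{j=0}^{M-1}(-1)^jc_j\,X_n^{-j}\cos\bigl[X_n\sin\pi\psi_r+\pi(j-\vartheta)\psi_r\bigr]+O(X_n^{-M}),$$ with $X_n=Xn^{p/\kappa}=\kappa\,(h(2\pi n)^p/a)^{1/\kappa}$, $\psi_r=(\tfrac12p-2r-1)/\kappa$ for $0\le r\le N-1$, and $\psi_N=0$.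
   Context: $[x]$ denotes the nearest integer: $[x]=N$ when $x\in(N-\tfrac12,N+\tfrac12]$. $\zeta$ is the Riemann zeta function. Parameters: $\kappa=p-1$, $h=p^{-p}$, $\vartheta=\tfrac12-w$, $A=(2\pi)^{1/2}\kappa^{1/2-\vartheta}p^{\vartheta}$, $\chi=(2\pi)^p/a$, $X=\kappa(h\chi)^{1/\kappa}$. The coefficients $c_j=c_j(w,p)$ are the constants (with $c_0=1$) uniquely determined by the inverse factorial expansion: for every positive integer $M$, $$\frac{\Gamma(1-w+ps)}{\Gamma(1+s)}=\frac{A}{2\pi}(h\kappa^\kappa)^{-s}\Bigl\{\sum_{j=0}^{M-1}(-1)^jc_j\,\Gamma(\kappa s+\vartheta-j)+\rho_M(s)\,\Gamma(\kappa s+\vartheta-M)\Bigr\},$$ where $\rho_M(s)=O(1)$ as $|s|\to\infty$ in $|\arg s|<\pi$. The functions $E_r$ and $\hat E_N$ are the exponentially small contributions in the expansion of $S_p(a;w)=\sum_{n\ge1}n^{-w}e^{-an^p}$, defined as follows. Let $L$ be a path parallel to the imaginary axis (traversed upwards) with $\Re(s)>w/p+\delta$ for some $\delta>0$. Then $E_r(a;w,p)=J_r^++J_r^-$ for $0\le r\le N-1$ and $\hat E_N(a;w,p)=J$, where $$J_r^\pm=\frac1{2\pi i}\int_L\zeta(1-w+ps)\frac{\Gamma(1-w+ps)}{\Gamma(1+s)}\,\chi^{-s}e^{\pm\pi i(p/2-2r-1)s}\,ds,$$ $$J=\frac1{2\pi i}\int_L\zeta(1-w+ps)\frac{\Gamma(1-w+ps)}{\Gamma(1+s)}\,\chi^{-s}\,ds.$$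 *)

theory Defs
  imports "HOL-Analysis.Analysis" "HOL-Library.Landau_Symbols"
begin

text \<open>
  Nearest integer with half-integers rounded down (the library's \<open>round\<close> rounds them up).
\<close>

definition nearest_int :: "real \<Rightarrow> int" where
  "nearest_int x = \<lceil>x - 1/2\<rceil>"

lemma nearest_int_eq_iff:
  "nearest_int x = N \<longleftrightarrow> x \<in> {real_of_int N - 1/2 <.. real_of_int N + 1/2}"
  unfolding nearest_int_def ceiling_eq_iff by auto

text \<open>
  The Riemann zeta function is only ever evaluated at points of real part greater than 1
  below, so its Dirichlet series suffices; the definition is meaningful only there.
\<close>

definition zeta :: "complex \<Rightarrow> complex" where
  "zeta z = (\<Sum>n. of_nat (Suc n) powr (- z))"

definition kappa :: "nat \<Rightarrow> real" where
  "kappa p = real p - 1"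

definition h_par :: "nat \<Rightarrow> real" where
  "h_par p = real p powr (- real p)"

definition vtheta :: "nat \<Rightarrow> real" where
  "vtheta w = 1/2 - real w"

definition A_par :: "nat \<Rightarrow> nat \<Rightarrow> real" where
  "A_par w p = (2 * pi) powr (1/2) * kappa p powr (1/2 - vtheta w) * real p powr vtheta w"

definition chi :: "nat \<Rightarrow> real \<Rightarrow> real" where
  "chi p a = (2 * pi) ^ p / a"

definition X_par :: "nat \<Rightarrow> real \<Rightarrow> real" where
  "X_par p a = kappa p * (h_par p * chi p a) powr (1 / kappa p)"

definition X_seq :: "nat \<Rightarrow> real \<Rightarrow> nat \<Rightarrow> real" where
  "X_seq p a n = X_par p a * real n powr (real p / kappa p)"

lemma X_seq_eq:
  assumes "a > 0" and "n \<ge> 1"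
  shows "X_seq p a n = kappa p * (h_par p * (2 * pi * real n) ^ p / a) powr (1 / kappa p)"
proof -
  have h: "h_par p \<ge> 0" by (simp add: h_par_def)
  have "real n powr (real p / kappa p) = (real n ^ p) powr (1 / kappa p)"
    using assms(2) by (simp add: powr_realpow[symmetric] powr_powr)
  moreover have "(h_par p * (2 * pi * real n) ^ p / a) = (h_par p * chi p a) * real n ^ p"
    by (simp add: chi_def power_mult_distrib)
  moreover have "h_par p * chi p a \<ge> 0" using h assms(1) by (simp add: chi_def)
  ultimately show ?thesis
    by (simp add: X_seq_def X_par_def powr_mult)
qed

text \<open>
  The inverse factorial expansion determining the coefficients.  The order relation on
  \<open>\<rho>\<close> in the sector \<open>\<bar>arg s\<bar> < \<pi>\<close> is understood, as usual, uniformly in every closed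
  subsector \<open>\<bar>arg s\<bar> \<le> \<pi> - \<delta>\<close>; it cannot hold uniformly in the open sector because the
  poles of the left-hand side on the negative real axis are not poles of
  \<open>\<Gamma>(\<kappa>s + \<theta> - M)\<close>.  The identity is required away from the poles of the Gamma functions
  in it, where the library assigns the value 0.
\<close>

definition inverse_factorial_expansion :: "nat \<Rightarrow> nat \<Rightarrow> (nat \<Rightarrow> real) \<Rightarrow> nat \<Rightarrow> bool" where
  "inverse_factorial_expansion w p c M \<longleftrightarrow>
     (\<exists>\<rho> :: complex \<Rightarrow> complex.
        (\<forall>s. s \<noteq> 0 \<and> \<bar>Arg s\<bar> < pi \<and>
             1 - of_nat w + of_nat p * s \<notin> \<int>\<^sub>\<le>\<^sub>0 \<and>
             of_real (kappa p) * s + of_real (vtheta w) - of_nat M \<notin> \<int>\<^sub>\<le>\<^sub>0 \<longrightarrow>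
           Gamma (1 - of_nat w + of_nat p * s) / Gamma (1 + s) =
             of_real (A_par w p / (2 * pi)) *
             of_real (h_par p * kappa p powr kappa p) powr (- s) *
             ((\<Sum>j<M. (-1) ^ j * of_real (c j) *
                  Gamma (of_real (kappa p) * s + of_real (vtheta w) - of_nat j)) +
              \<rho> s * Gamma (of_real (kappa p) * s + of_real (vtheta w) - of_nat M))) \<and>
        (\<forall>\<delta>\<in>{0<..<pi}.
           \<rho> \<in> O[inf at_infinity (principal {s. \<bar>Arg s\<bar> \<le> pi - \<delta>})](\<lambda>_. 1)))"

definition c_coeff :: "nat \<Rightarrow> nat \<Rightarrow> nat \<Rightarrow> real" where
  "c_coeff w p =
     (THE c. c 0 = 1 \<and> (\<forall>M\<ge>1. inverse_factorial_expansion w p c M))"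

text \<open>
  Integral along the upward vertical line \<open>Re s = \<sigma>\<close>, parametrised by \<open>s = \<sigma> + it\<close>.
\<close>

definition vertical_integral :: "real \<Rightarrow> (complex \<Rightarrow> complex) \<Rightarrow> complex" where
  "vertical_integral \<sigma> f = \<i> * (LINT t|lborel. f (Complex \<sigma> t))"

definition J_rot :: "nat \<Rightarrow> nat \<Rightarrow> real \<Rightarrow> real \<Rightarrow> real \<Rightarrow> complex" where
  "J_rot w p \<sigma> \<tau> a =
     1 / (2 * of_real pi * \<i>) * vertical_integral \<sigma> (\<lambda>s.
       zeta (1 - of_nat w + of_nat p * s) *
       (Gamma (1 - of_nat w + of_nat p * s) / Gamma (1 + s)) *
       of_real (chi p a) powr (- s) * exp (of_real pi * \<i> * of_real \<tau> * s))"

definition E_fun :: "nat \<Rightarrow> nat \<Rightarrow> real \<Rightarrow> nat \<Rightarrow> real \<Rightarrow> complex" where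
  "E_fun w p \<sigma> r a =
     J_rot w p \<sigma> (real p / 2 - 2 * real r - 1) a +
     J_rot w p \<sigma> (- (real p / 2 - 2 * real r - 1)) a"

definition E_hat :: "nat \<Rightarrow> nat \<Rightarrow> real \<Rightarrow> real \<Rightarrow> complex" where
  "E_hat w p \<sigma> a = J_rot w p \<sigma> 0 a"

definition N_par :: "nat \<Rightarrow> nat" where
  "N_par p = nat (nearest_int (real p / 4))"

definition psi :: "nat \<Rightarrow> nat \<Rightarrow> real" where
  "psi p r = (if r < N_par p then (real p / 2 - 2 * real r - 1) / kappa p else 0)"

end

theory Submission
  imports Defs "HOL-Complex_Analysis.Complex_Analysis" "HOL-Real_Asymp.Real_Asymp"
begin

text \<open>
  Put \<open>G s = \<Gamma>(1 - w + ps) / \<Gamma>(1 + s)\<close>, \<open>q = h \<kappa>\<^sup>\<kappa>\<close> and \<open>\<theta> = \<pi>\<psi>\<^sub>r\<close>.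
  Expanding \<open>\<zeta>\<close> into its Dirichlet series writes each of the integrals \<open>J\<close> as a sum over \<open>n\<close> of
  \<open>n\<^bsup>w-1\<^esup> / (2\<pi>)\<close> times the integral along the line of \<open>G s q\<^sup>s e\<^bsup>-\<kappa>s\<zeta>\<^esup>\<close>,
  where now \<open>\<zeta> = ln X\<^sub>n \<mp> i\<theta>\<close>; this works because \<open>X\<^sub>n\<^sup>\<kappa> = q \<chi> n\<^sup>p\<close>. The two signs give conjugate
  values, so the sum of both is twice a real part, and \<open>\<Upsilon>\<close> is that real part divided by its
  expected size. Everything reduces to the asymptotics of one integral as \<open>X \<rightarrow> \<infinity>\<close>.

  The inverse factorial expansion replaces \<open>G s q\<^sup>s\<close> by multiples of \<open>\<Gamma>(\<kappa>s + \<vartheta> - j)\<close>. Each of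
  these is integrated exactly by the Cahen--Mellin formula
  \<open>1/(2\<pi>i) \<integral> \<Gamma>(u) z\<^bsup>-u\<^esup> du = e\<^bsup>-z\<^esup>\<close> with \<open>z = X e\<^bsup>-i\<theta>\<^esup>\<close>
  (\<open>Mellin_inversion_exp\<close>), whose real part is the cosine term. For the remainder the line of
  integration is moved to the saddle point, where \<open>Re(\<kappa>s)\<close> is about \<open>X cos \<theta>\<close>. There the inequality
  \<open>|\<Gamma>(u)| e\<^bsup>\<phi> Im u\<^esup> \<le> \<Gamma>(Re u) (cos \<phi>)\<^bsup>-Re u\<^esup>\<close> (\<open>norm_Gamma_rotated_le\<close>) yields
  the factor \<open>e\<^bsup>-X cos \<theta>\<^esup>\<close>. Two powers of \<open>X\<close> are sacrificed for an integrable majorant; taking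
  two more terms of the expansion recovers them (\<open>saddle_kernel_integral_expansion\<close>).

  The coefficients \<open>c\<^sub>j\<close> are defined by a description, so existence and uniqueness of the inverse
  factorial expansion have to be proved (\<open>c_coeff_expansion\<close>). Let \<open>F\<close> be \<open>G\<close> divided by the
  leading term of its expansion. The functional equation of \<open>\<Gamma>\<close> gives \<open>F(s) = R(1/s) F(s+1)\<close> with an
  explicit rational \<open>R(x) = 1 + O(x\<^sup>2)\<close>, and Stirling's formula for factorials gives \<open>F(s+n) \<rightarrow> 1\<close>. The
  coefficients are determined one by one from the requirement that the partial sums satisfy the same
  recurrence up to a high power of \<open>1/s\<close>. Iterating the recurrence along \<open>s, s+1, s+2, ...\<close> then
  turns this small defect into a bound for the error. The bound is uniform in \<open>|arg s| \<le> \<pi> - \<delta>\<close> because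
  \<open>|s + n| \<ge> c (|s| + n)\<close> there.
\<close>

section \<open>The Gamma function on rotated rays\<close>

text \<open>
  Concavity of \<open>ln \<circ> cos\<close>, whose derivative \<open>- tan\<close> decreases.
\<close>

lemma ln_cos_tangent:
  fixes \<alpha> \<phi> :: real
  assumes "\<bar>\<alpha>\<bar> < pi/2" "\<bar>\<phi>\<bar> < pi/2"
  shows "ln (cos \<phi>) \<le> ln (cos \<alpha>) - tan \<alpha> * (\<phi> - \<alpha>)"
proof -
  have pos: "cos x > 0" if "x \<in> {-pi/2<..<pi/2}" for x
    using that by (intro cos_gt_zero_pi) auto
  have "(tan \<alpha>) * (\<phi> - \<alpha>) \<le> (- ln (cos \<phi>)) - (- ln (cos \<alpha>))"
  proof (rule f''_imp_f'[where f = "\<lambda>x. - ln (cos x)" and f' = tan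
        and f'' = "\<lambda>x. inverse ((cos x)^2)" and C = "{-pi/2<..<pi/2}"])
    show "convex {-pi/2<..<pi/2}" by simp
    show "((\<lambda>x. - ln (cos x)) has_real_derivative tan x) (at x)"
      if "x \<in> {-pi/2<..<pi/2}" for x
      using pos[OF that] by (auto intro!: derivative_eq_intros simp: tan_def field_simps)
    show "(tan has_real_derivative inverse ((cos x)\<^sup>2)) (at x)"
      if "x \<in> {-pi/2<..<pi/2}" for x
      using pos[OF that] by (auto intro!: derivative_eq_intros)
  qed (use assms in \<open>auto simp: abs_less_iff\<close>)
  then show ?thesis by simp
qed

text \<open>
  This is the closed form of the integral of \<open>ln (1 + y\<^sup>2/t\<^sup>2) / 2\<close> over \<open>t \<ge> v\<close>. The Euler product gives
  \<open>- ln |\<Gamma>(x+iy) / \<Gamma>(x)|\<close> as the sum of the integrand over \<open>t = x, x+1, x+2, ...\<close>, and the integral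
  from \<open>x\<close> is a lower bound for that sum.
\<close>

definition log_tail :: "real \<Rightarrow> real \<Rightarrow> real" where
  "log_tail y v = y * arctan (y / v) - v / 2 * ln (1 + (y / v)\<^sup>2)"

lemma log_tail_deriv:
  assumes "v > 0"
  shows "(log_tail y has_real_derivative (- 1/2 * ln (1 + (y / v)\<^sup>2))) (at v)"
proof -
  have p: "1 + (y / v)\<^sup>2 > 0" by (simp add: add_pos_nonneg)
  have 2: "v * (v * (1 + (y / v)\<^sup>2)) = v^2 + y^2" using assms by (simp add: power2_eq_square field_simps)
  show ?thesis
    unfolding log_tail_def [abs_def]
    apply (rule derivative_eq_intros refl | use assms p in \<open>simp; fail\<close>)+
    using assms p
    by (simp add: divide_simps) (simp add: algebra_simps power2_eq_square)?
qed

text \<open>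
  The integrand of the tail is decreasing, so its integral over a unit interval is at most its value at the left end.
\<close>

lemma log_tail_step:
  assumes "v > 0"
  shows "log_tail y v - log_tail y (v + 1) \<le> 1/2 * ln (1 + (y / v)\<^sup>2)"
proof -
  obtain z where z: "z > v" "z < v + 1"
    and eq: "log_tail y (v + 1) - log_tail y v = (v + 1 - v) * (- 1/2 * ln (1 + (y / z)\<^sup>2))"
    using MVT2[of v "v+1" "log_tail y" "\<lambda>v. - 1/2 * ln (1 + (y / v)\<^sup>2)"] log_tail_deriv assms by auto
  have "(y / z)\<^sup>2 \<le> (y / v)\<^sup>2"
    unfolding power_divide using z assms by (intro divide_left_mono power_mono) auto
  then have "ln (1 + (y / z)\<^sup>2) \<le> ln (1 + (y / v)\<^sup>2)"
    by (smt (verit) ln_le_cancel_iff zero_le_power2)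
  with eq show ?thesis by simp
qed

lemma log_tail_tendsto_0: "((\<lambda>n. log_tail y (x + real n)) \<longlongrightarrow> 0) sequentially"
proof -
  have "filterlim (\<lambda>n. x + real n) at_top sequentially"
    by (rule filterlim_tendsto_add_at_top[OF tendsto_const filterlim_real_sequentially])
  moreover have "(log_tail y \<longlongrightarrow> 0) at_top"
  proof -
    have 1: "((\<lambda>v. y / v) \<longlongrightarrow> 0) at_top"
      by (intro tendsto_divide_0[OF tendsto_const] filterlim_at_top_imp_at_infinity filterlim_ident)
    have 2: "((\<lambda>v. y * arctan (y / v)) \<longlongrightarrow> 0) at_top"
      using tendsto_mult_left[OF tendsto_arctan[OF 1], of y] by simp
    have 3: "((\<lambda>v. v / 2 * ln (1 + (y / v)\<^sup>2)) \<longlongrightarrow> 0) at_top"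
    proof (rule tendsto_sandwich[of "\<lambda>_. 0" _ _ "\<lambda>v. y * (y / v)/2"])
      show "\<forall>\<^sub>F v in at_top. 0 \<le> v / 2 * ln (1 + (y / v)\<^sup>2)"
        using eventually_gt_at_top[of 0] by eventually_elim auto
      show "\<forall>\<^sub>F v in at_top. v / 2 * ln (1 + (y / v)\<^sup>2) \<le> y * (y / v)/2"
        using eventually_gt_at_top[of 0]
      proof eventually_elim
        case (elim v)
        have "ln (1 + (y / v)\<^sup>2) \<le> (y / v)\<^sup>2" by (rule ln_add_one_self_le_self) simp
        then have "v / 2 * ln (1 + (y / v)\<^sup>2) \<le> v / 2 * (y / v)\<^sup>2"
          using elim by (intro mult_left_mono) auto
        then show ?case using elim by (simp add: power2_eq_square field_simps)
      qed
      show "((\<lambda>v. y * (y / v) / 2) \<longlongrightarrow> 0) at_top"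
        using tendsto_mult_left[OF 1, of "y/2"] by (simp add: field_simps)
    qed simp
    show ?thesis unfolding log_tail_def using tendsto_diff[OF 2 3] by simp
  qed
  ultimately show ?thesis by (rule filterlim_compose[rotated])
qed

text \<open>
  Equality holds for \<open>tan \<phi> = y/x\<close>. Every other angle gives a smaller value by concavity of \<open>ln \<circ> cos\<close>.
\<close>

lemma log_tail_ge:
  assumes "x > 0" "\<bar>\<phi>\<bar> < pi/2"
  shows "log_tail y x \<ge> \<phi> * y + x * ln (cos \<phi>)"
proof -
  define \<alpha> where "\<alpha> = arctan (y / x)"
  have a: "\<bar>\<alpha>\<bar> < pi/2" using arctan_bounded[of "y/x"] by (auto simp: \<alpha>_def abs_less_iff)
  have ca: "cos \<alpha> > 0" using a by (intro cos_gt_zero_pi) auto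
  have t: "tan \<alpha> = y / x" by (simp add: \<alpha>_def tan_arctan)
  have "1 + (y/x)\<^sup>2 = inverse ((cos \<alpha>)\<^sup>2)"
    unfolding t[symmetric] using tan_sec[of \<alpha>] ca by (simp add: field_simps)
  then have "ln (1 + (y/x)\<^sup>2) = - 2 * ln (cos \<alpha>)"
    using ca by (simp add: ln_inverse ln_realpow)
  then have H: "log_tail y x = y * \<alpha> + x * ln (cos \<alpha>)" by (simp add: log_tail_def \<alpha>_def)
  have "x * ln (cos \<phi>) \<le> x * (ln (cos \<alpha>) - tan \<alpha> * (\<phi> - \<alpha>))"
    using ln_cos_tangent[OF a assms(2)] assms(1) by (intro mult_left_mono) auto
  also have "\<dots> = x * ln (cos \<alpha>) - y * (\<phi> - \<alpha>)" using assms(1) by (simp add: t field_simps)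
  finally show ?thesis using H by (simp add: algebra_simps)
qed

lemma norm_Gamma_le_Gamma_Re:
  assumes "Re u > 0" shows "norm (Gamma u) \<le> Gamma (Re u)"
proof -
  have I: "((\<lambda>t. of_real t powr (u - 1) / of_real (exp t)) has_integral Gamma u) {0..}"
    by (rule Gamma_integral_complex[OF assms])
  have I2: "((\<lambda>t. t powr (Re u - 1) / exp t) has_integral Gamma (Re u)) {0..}"
    by (rule Gamma_integral_real[OF assms])
  have "norm (integral {0..} (\<lambda>t. of_real t powr (u - 1) / of_real (exp t) :: complex))
        \<le> integral {0..} (\<lambda>t. t powr (Re u - 1) / exp t)"
    using I I2
    by (intro integral_norm_bound_integral) (auto simp: norm_divide norm_powr_real_powr has_integral_iff)
  then show ?thesis using I I2 by (simp add: has_integral_iff)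
qed

text \<open>
  This is the estimate that Euler's integral along the ray with argument \<open>\<phi>\<close> suggests. It is read off the Euler product:
  by the functional equation and \<open>log_tail_step\<close>, the quotient
  \<open>|\<Gamma>(u+n)| e\<^bsup>log_tail y (x+n)\<^esup> / \<Gamma>(x+n)\<close> increases with \<open>n\<close>, and its limit is at most 1. Its value at \<open>n = 0\<close> is then compared with \<open>\<phi>\<close> by \<open>log_tail_ge\<close>.
\<close>

lemma norm_Gamma_rotated_le:
  assumes "Re u > 0" "\<bar>\<phi>\<bar> < pi/2"
  shows "norm (Gamma u) * exp (\<phi> * Im u) \<le> Gamma (Re u) * cos \<phi> powr (- Re u)"
proof -
  define x y where "x = Re u" and "y = Im u"
  have x: "x > 0" using assms x_def by simp
  have nz: "u + of_nat n \<notin> \<int>\<^sub>\<le>\<^sub>0" for n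
    using assms(1) by (auto elim!: nonpos_Ints_cases simp: complex_eq_iff)
  define a where "a n = norm (Gamma (u + of_nat n)) / Gamma (x + real n) * exp (log_tail y (x + real n))" for n
  have "incseq a"
  proof (rule incseq_SucI)
    fix n
    let ?v = "x + real n"
    have v: "?v > 0" using x by simp
    have G: "Gamma (u + of_nat (Suc n)) = (u + of_nat n) * Gamma (u + of_nat n)"
      using Gamma_plus1[OF nz[of n]] by (simp add: add_ac)
    have "?v \<notin> \<int>\<^sub>\<le>\<^sub>0" using v by (auto elim!: nonpos_Ints_cases)
    then have G2: "Gamma (x + real (Suc n)) = ?v * Gamma ?v"
      using Gamma_plus1[of ?v] by (simp add: add_ac)
    have p1: "1 + (y / ?v)\<^sup>2 > 0" by (simp add: add_pos_nonneg)
    have "(norm (u + of_nat n))\<^sup>2 = ?v\<^sup>2 + y\<^sup>2" by (simp add: cmod_power2 x_def y_def)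
    also have "\<dots> = ?v\<^sup>2 * (1 + (y / ?v)\<^sup>2)" using v by (simp add: field_simps)
    also have "1 + (y / ?v)\<^sup>2 = (exp (1/2 * ln (1 + (y / ?v)\<^sup>2)))\<^sup>2"
      using p1 by (simp add: exp_double[symmetric] power2_eq_square exp_add[symmetric])
    finally have "(norm (u + of_nat n))\<^sup>2 = (?v * exp (1/2 * ln (1 + (y / ?v)\<^sup>2)))\<^sup>2"
      by (simp add: power_mult_distrib)
    then have "norm (u + of_nat n) = ?v * exp (1/2 * ln (1 + (y / ?v)\<^sup>2))"
      by (rule power2_eq_imp_eq) (use v in auto)
    then have n: "norm (u + of_nat n) \<ge> ?v * exp (log_tail y ?v - log_tail y (?v + 1))"
      using log_tail_step[OF v, of y] v by simp
    have "a n = norm (Gamma (u + of_nat n)) / Gamma ?v * (?v * exp (log_tail y ?v - log_tail y (?v + 1))) / ?v * exp (log_tail y (?v + 1))"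
      using v by (simp add: a_def exp_diff)
    also have "\<dots> \<le> norm (Gamma (u + of_nat n)) / Gamma ?v * norm (u + of_nat n) / ?v * exp (log_tail y (?v + 1))"
      using n v by (intro mult_right_mono divide_right_mono mult_left_mono) auto
    also have "\<dots> = a (Suc n)"
      by (simp only: a_def G G2) (simp add: norm_mult mult_ac add_ac)
    finally show "a n \<le> a (Suc n)" .
  qed
  then have "a 0 \<le> a n" for n by (simp add: incseqD)
  moreover have "a n \<le> exp (log_tail y (x + real n))" for n
  proof -
    have "norm (Gamma (u + of_nat n)) \<le> Gamma (x + real n)"
      using norm_Gamma_le_Gamma_Re[of "u + of_nat n"] x by (simp add: x_def)
    moreover have "Gamma (x + real n) > 0" using x by simp
    ultimately show ?thesis
      using mult_right_mono[of "norm (Gamma (u + of_nat n))" "Gamma (x + real n)" "exp (log_tail y (x + real n))"]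
      by (simp add: a_def divide_simps mult.commute)
  qed
  ultimately have "a 0 \<le> exp (log_tail y (x + real n))" for n using order_trans by blast
  moreover have "(\<lambda>n. exp (log_tail y (x + real n))) \<longlonglongrightarrow> exp 0"
    by (intro tendsto_exp log_tail_tendsto_0)
  ultimately have a0: "a 0 \<le> 1"
    by (intro LIMSEQ_le_const) auto
  have "norm (Gamma u) * exp (\<phi> * y) * cos \<phi> powr x \<le> norm (Gamma u) * exp (log_tail y x)"
  proof -
    have "cos \<phi> > 0" using assms(2) by (intro cos_gt_zero_pi) auto
    then have "exp (\<phi> * y) * cos \<phi> powr x = exp (\<phi> * y + x * ln (cos \<phi>))"
      by (simp add: powr_def exp_add)
    also have "\<dots> \<le> exp (log_tail y x)" using log_tail_ge[OF x assms(2)] by simp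
    finally show ?thesis by (simp add: mult_left_mono mult.assoc)
  qed
  also have "\<dots> \<le> Gamma x"
    using a0 Gamma_real_pos[OF x] by (simp add: a_def field_simps)
  finally have *: "norm (Gamma u) * exp (\<phi> * y) * cos \<phi> powr x \<le> Gamma x" .
  have "cos \<phi> > 0" using assms(2) by (intro cos_gt_zero_pi) auto
  then show ?thesis using * by (simp add: x_def y_def powr_minus_divide pos_le_divide_eq)
qed

section \<open>Shifting vertical lines of integration\<close>

definition line_integral :: "real \<Rightarrow> (complex \<Rightarrow> complex) \<Rightarrow> complex" where
  "line_integral x f = (LINT y|lborel. f (Complex x y))"

lemma integrable_inverse_square_bound: "integrable lborel (\<lambda>y::real. 1 / (1 + y\<^sup>2))"
proof -
  have "set_integrable lborel (einterval (-\<infinity>) \<infinity>) (\<lambda>y::real. 1 / (1 + y\<^sup>2))"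
  proof (rule interval_integral_FTC_nonneg(1)[where F = arctan and A = "-pi/2" and B = "pi/2"])
    show "((arctan \<circ> real_of_ereal) \<longlongrightarrow> - pi / 2) (at_right (- \<infinity>))"
      unfolding ereal_tendsto_simps using tendsto_arctan_at_bot by simp
    show "((arctan \<circ> real_of_ereal) \<longlongrightarrow> pi / 2) (at_left \<infinity>)"
      unfolding ereal_tendsto_simps using tendsto_arctan_at_top by simp
  qed (auto intro!: derivative_eq_intros continuous_intros simp: add_nonneg_eq_0_iff field_simps)
  then show ?thesis by (simp add: set_integrable_def)
qed

text \<open>
  The majorant \<open>1/(1+y\<^sup>2)\<close> is integrable and has no singularity at the origin, unlike \<open>1/y\<^sup>2\<close>; compactness
  absorbs the bounded part of the line into the constant.
\<close>

lemma bound_inverse_square_extend: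
  fixes f :: "real \<Rightarrow> complex"
  assumes c: "continuous_on UNIV f" and b: "\<And>y. \<bar>y\<bar> \<ge> Y \<Longrightarrow> norm (f y) \<le> C / y\<^sup>2"
  shows "\<exists>C'. \<forall>y. norm (f y) \<le> C' * (1 / (1 + y\<^sup>2))"
proof -
  define Z where "Z = max 1 \<bar>Y\<bar>"
  have "compact (f ` {-Z..Z})" using c continuous_on_subset compact_continuous_image by blast
  then obtain B where B: "\<And>y. y \<in> {-Z..Z} \<Longrightarrow> norm (f y) \<le> B"
    using compact_imp_bounded bounded_iff by (metis imageI)
  have B0: "B \<ge> 0" using B[of 0] norm_ge_zero[of "f 0"] unfolding Z_def by (smt (verit) atLeastAtMost_iff)
  define C' where "C' = B * (1 + Z\<^sup>2) + 2 * \<bar>C\<bar>"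
  have "norm (f y) \<le> C' * (1 / (1 + y\<^sup>2))" for y
  proof (cases "\<bar>y\<bar> \<le> Z")
    case True
    have p: "1 + y\<^sup>2 > 0" by (simp add: add_pos_nonneg)
    have "y\<^sup>2 \<le> Z\<^sup>2" using True by (simp add: Z_def abs_le_square_iff[symmetric])
    then have "B * (1 + y\<^sup>2) \<le> C'" unfolding C'_def using B0 by (simp add: mult_left_mono add_increasing2)
    moreover have "norm (f y) \<le> B" using True by (intro B) auto
    then have "norm (f y) * (1 + y\<^sup>2) \<le> B * (1 + y\<^sup>2)" using p by (intro mult_right_mono) auto
    ultimately show ?thesis using p by (simp add: field_simps)
  next
    case False
    then have y: "\<bar>y\<bar> \<ge> Y" "\<bar>y\<bar> \<ge> 1" unfolding Z_def by auto
    have y2: "y\<^sup>2 \<ge> 1" using y(2) abs_le_square_iff[of 1 y] by simp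
    have "norm (f y) \<le> \<bar>C\<bar> / y\<^sup>2"
      using b[OF y(1)] by (rule order_trans) (simp add: divide_right_mono)
    also have "\<dots> \<le> 2 * \<bar>C\<bar> / (1 + y\<^sup>2)"
      using y2 mult_left_mono[OF y2, of "\<bar>C\<bar>"] by (simp add: divide_simps distrib_left)
    also have "\<dots> \<le> C' / (1 + y\<^sup>2)"
      unfolding C'_def using B0 by (intro divide_right_mono) auto
    finally show ?thesis by simp
  qed
  then show ?thesis by blast
qed

lemma integrable_if_inverse_square:
  fixes f :: "real \<Rightarrow> complex"
  assumes c: "continuous_on UNIV f" and b: "\<And>y. \<bar>y\<bar> \<ge> Y \<Longrightarrow> norm (f y) \<le> C / y\<^sup>2"
  shows "integrable lborel f"
proof -
  obtain C' where C': "\<And>y. norm (f y) \<le> C' * (1 / (1 + y\<^sup>2))"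
    using bound_inverse_square_extend[OF assms] by blast
  have "norm (f y) \<le> norm (C' * (1 / (1 + y\<^sup>2)))" for y
    using C'[of y] by (rule order_trans) (simp only: real_norm_def abs_ge_self)
  then show ?thesis
    by (intro Bochner_Integration.integrable_bound[OF integrable_mult_right[OF integrable_inverse_square_bound, of C']])
       (use borel_measurable_continuous_onI[OF c] in auto)
qed

lemma integral_symmetric_limit:
  fixes f :: "real \<Rightarrow> complex"
  assumes c: "continuous_on UNIV f" and i: "integrable lborel f"
  shows "(\<lambda>n. integral {- real n..real n} f) \<longlonglongrightarrow> (LINT y|lborel. f y)"
proof -
  have "integral {- real n..real n} f = (LINT y|lborel. indicator {- real n..real n} y *\<^sub>R f y)" for n
  proof -
    have "set_integrable lborel {- real n..real n} f"
      by (rule borel_integrable_atLeastAtMost') (use c continuous_on_subset in blast)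
    from set_borel_integral_eq_integral(2)[OF this] show ?thesis
      by (simp add: set_lebesgue_integral_def)
  qed
  moreover have "(\<lambda>n. LINT y|lborel. indicator {- real n..real n} y *\<^sub>R f y) \<longlonglongrightarrow> (LINT y|lborel. f y)"
  proof (rule integral_dominated_convergence[where w = "\<lambda>y. norm (f y)"])
    show "AE y in lborel. (\<lambda>n. indicator {- real n..real n} y *\<^sub>R f y) \<longlonglongrightarrow> f y"
    proof (rule AE_I2)
      fix y :: real
      obtain N where "real N \<ge> \<bar>y\<bar>" using real_arch_simple by blast
      then have "\<forall>n\<ge>N. indicator {- real n..real n} y *\<^sub>R f y = f y"
        by (auto simp: indicator_def abs_le_iff)
      then show "(\<lambda>n. indicator {- real n..real n} y *\<^sub>R f y) \<longlonglongrightarrow> f y"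
        by (intro tendsto_eventually) (auto simp: eventually_sequentially)
    qed
  qed (use i borel_measurable_continuous_onI[OF c] in \<open>auto simp: indicator_def\<close>)
  ultimately show ?thesis by simp
qed

text \<open>
  Cauchy's integral formula on a rectangle around \<open>b\<close>, with the vertical sides parametrised by height.
\<close>

lemma rectangle_Cauchy:
  fixes f :: "complex \<Rightarrow> complex"
  assumes holo: "f holomorphic_on {s. l < Re s \<and> Re s < r}"
    and lr: "l < x1" "x1 < Re b" "Re b < x2" "x2 < r" and Y: "Y > \<bar>Im b\<bar>"
  defines "g \<equiv> \<lambda>s. f s / (s - b)"
  shows "\<i> * integral {-Y..Y} (\<lambda>y. g (Complex x2 y)) - \<i> * integral {-Y..Y} (\<lambda>y. g (Complex x1 y))
       + contour_integral (linepath (Complex x1 (-Y)) (Complex x2 (-Y))) g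
       + contour_integral (linepath (Complex x2 Y) (Complex x1 Y)) g = 2 * pi * \<i> * f b"
proof -
  let ?S = "{s. l < Re s \<and> Re s < r}"
  define A B C D where "A = Complex x1 (-Y)" and "B = Complex x2 (-Y)" and "C = Complex x2 Y" and "D = Complex x1 Y"
  have S: "?S = {s. l < Re s} \<inter> {s. Re s < r}" by auto
  have op: "open ?S" "convex ?S" unfolding S
    by (auto intro!: open_Int open_halfspace_Re_gt open_halfspace_Re_lt convex_Int convex_halfspace_Re_gt convex_halfspace_Re_lt)
  have img: "path_image (rectpath A C) \<subseteq> ?S - {b}"
    using lr Y by (subst path_image_rectpath) (auto simp: A_def C_def)
  have wn: "winding_number (rectpath A C) b = 1"
    by (rule winding_number_rectpath) (use lr Y in \<open>auto simp: A_def C_def in_box_complex_iff\<close>)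
  have main: "(g has_contour_integral (2 * pi * \<i> * winding_number (rectpath A C) b * f b)) (rectpath A C)"
    unfolding g_def
    by (rule Cauchy_integral_formula_convex_simple[OF op(2) holo _ _ img])
       (use lr op in \<open>auto simp: interior_open\<close>)
  have holog: "g holomorphic_on (?S - {b})"
    unfolding g_def by (intro holomorphic_intros holomorphic_on_subset[OF holo]) auto
  have contg: "continuous_on (?S - {b}) g" using holog by (rule holomorphic_on_imp_continuous_on)
  have pieces: "path_image (linepath A B) \<subseteq> ?S - {b}" "path_image (linepath B C) \<subseteq> ?S - {b}"
     "path_image (linepath C D) \<subseteq> ?S - {b}" "path_image (linepath D A) \<subseteq> ?S - {b}"
    using img by (auto simp: rectpath_def Let_def path_image_join A_def B_def C_def D_def)
  have ci: "g contour_integrable_on linepath A B" "g contour_integrable_on linepath B C"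
     "g contour_integrable_on linepath C D" "g contour_integrable_on linepath D A"
    using pieces by (auto intro!: contour_integrable_continuous_linepath continuous_on_subset[OF contg])
  have "contour_integral (rectpath A C) g = contour_integral (linepath A B) g
      + contour_integral (linepath B C) g + contour_integral (linepath C D) g + contour_integral (linepath D A) g"
    using ci unfolding rectpath_def Let_def
    by (simp add: A_def B_def C_def D_def contour_integrable_joinI)
  moreover have "contour_integral (rectpath A C) g = 2 * pi * \<i> * f b"
    using main wn by (simp add: contour_integral_unique)
  moreover have vert: "contour_integral (linepath (Complex x (-Y)) (Complex x Y)) g = \<i> * integral {-Y..Y} (\<lambda>y. g (Complex x y))"
    if "x = x1 \<or> x = x2" for x
  proof -
    have "g contour_integrable_on (linepath (Complex x (-Y)) (Complex x Y))"
      using ci that contour_integrable_reversepath[OF _ ci(4)]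
      by (auto simp: A_def B_def C_def D_def)
    then have "(g has_contour_integral contour_integral (linepath (Complex x (-Y)) (Complex x Y)) g) (linepath (Complex x (-Y)) (Complex x Y))"
      by (rule has_contour_integral_integral)
    then have "((\<lambda>y. g (Complex x y)) has_integral (-\<i> * contour_integral (linepath (Complex x (-Y)) (Complex x Y)) g)) {-Y..Y}"
      by (subst (asm) has_contour_integral_linepath_same_Re_iff) (use Y in auto)
    then show ?thesis by (simp add: integral_unique)
  qed
  moreover have "contour_integral (linepath D A) g = - contour_integral (linepath A D) g"
    using contour_integral_reversepath[of "linepath A D" g] by simp
  ultimately show ?thesis by (simp add: A_def B_def C_def D_def algebra_simps)
qed

text \<open>
  Moving a vertical line to the right across a simple pole adds the residue. The inverse square decay makes
  the horizontal sides of the rectangle vanish in the limit and the vertical integrals converge.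
\<close>

lemma line_integral_shift_pole:
  fixes f :: "complex \<Rightarrow> complex"
  assumes holo: "f holomorphic_on {s. l < Re s \<and> Re s < r}"
    and lr: "l < x1" "x1 < Re b" "Re b < x2" "x2 < r"
    and bd: "\<And>s. x1 \<le> Re s \<Longrightarrow> Re s \<le> x2 \<Longrightarrow> \<bar>Im s\<bar> \<ge> Y \<Longrightarrow> norm (f s / (s - b)) \<le> C / (Im s)\<^sup>2"
  shows "line_integral x2 (\<lambda>s. f s / (s - b)) - line_integral x1 (\<lambda>s. f s / (s - b)) = 2 * pi * f b"
proof -
  let ?S = "{s. l < Re s \<and> Re s < r}"
  define g where "g = (\<lambda>s. f s / (s - b))"
  have holog: "g holomorphic_on (?S - {b})"
    unfolding g_def by (intro holomorphic_intros holomorphic_on_subset[OF holo]) auto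
  have contg: "continuous_on (?S - {b}) g" using holog by (rule holomorphic_on_imp_continuous_on)
  have cont: "continuous_on UNIV (\<lambda>y. g (Complex x y))" if "x = x1 \<or> x = x2" for x
  proof -
    have "continuous_on UNIV (Complex x)" by (intro continuous_intros continuous_on_Complex)
    then show ?thesis
      by (intro continuous_on_compose2[OF contg]) (use that lr in auto)
  qed
  have lim: "(\<lambda>n. integral {- real n..real n} (\<lambda>y. g (Complex x y))) \<longlonglongrightarrow> line_integral x g"
    if "x = x1 \<or> x = x2" for x
    unfolding line_integral_def
  proof (intro integral_symmetric_limit cont that integrable_if_inverse_square[where Y = Y and C = C])
    show "norm (g (Complex x y)) \<le> C / y\<^sup>2" if "Y \<le> \<bar>y\<bar>" for y
      using bd[of "Complex x y"] lr \<open>x = x1 \<or> x = x2\<close> that by (auto simp: g_def)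
  qed
  have hor: "(\<lambda>n. contour_integral (linepath (Complex xa (e * real n)) (Complex xb (e * real n))) g) \<longlonglongrightarrow> 0"
    if e: "e = 1 \<or> e = -1" and ab: "xa \<in> {x1..x2}" "xb \<in> {x1..x2}" for e xa xb
  proof (rule Lim_null_comparison)
    show "(\<lambda>n. \<bar>C\<bar> / (real n)\<^sup>2 * \<bar>xb - xa\<bar>) \<longlonglongrightarrow> 0"
    proof -
      have "(\<lambda>n. \<bar>C\<bar> * (inverse (real n) * inverse (real n)) * \<bar>xb - xa\<bar>) \<longlonglongrightarrow> \<bar>C\<bar> * (0 * 0) * \<bar>xb - xa\<bar>"
        by (intro tendsto_intros LIMSEQ_inverse_real_of_nat tendsto_inverse_0_at_top filterlim_real_sequentially)
      then show ?thesis by (simp add: power2_eq_square divide_inverse)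
    qed
    show "\<forall>\<^sub>F n in sequentially. norm (contour_integral (linepath (Complex xa (e * real n)) (Complex xb (e * real n))) g)
           \<le> \<bar>C\<bar> / (real n)\<^sup>2 * \<bar>xb - xa\<bar>"
      using eventually_ge_at_top[of "nat \<lceil>max \<bar>Y\<bar> (\<bar>Im b\<bar> + 1)\<rceil>"]
    proof eventually_elim
      case (elim n)
      let ?a = "Complex xa (e * real n)" and ?b = "Complex xb (e * real n)"
      have n: "real n \<ge> Y" "real n > \<bar>Im b\<bar>" using elim by linarith+
      have seg: "Re s \<in> {x1..x2} \<and> Im s = e * real n" if "s \<in> closed_segment ?a ?b" for s
      proof -
        have "Re s \<in> closed_segment xa xb \<and> Im s = e * real n"
          using that closed_segment_same_Im[of ?a ?b] by auto
        then show ?thesis using ab closed_segment_subset[of xa "{x1..x2}" xb] by auto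
      qed
      have "g contour_integrable_on linepath ?a ?b"
      proof (rule contour_integrable_continuous_linepath[OF continuous_on_subset[OF contg]])
        show "closed_segment ?a ?b \<subseteq> ?S - {b}"
          using seg lr n(2) e by force
      qed
      then have "norm (contour_integral (linepath ?a ?b) g) \<le> \<bar>C\<bar> / (real n)\<^sup>2 * norm (?b - ?a)"
      proof (rule contour_integral_bound_linepath)
        fix s assume "s \<in> closed_segment ?a ?b"
        note s = seg[OF this]
        have i: "(Im s)\<^sup>2 = (real n)\<^sup>2" "\<bar>Im s\<bar> = real n" using s e by auto
        have "norm (g s) \<le> C / (Im s)\<^sup>2" unfolding g_def by (rule bd) (use s i n in auto)
        also have "\<dots> \<le> \<bar>C\<bar> / (real n)\<^sup>2" unfolding i by (intro divide_right_mono) auto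
        finally show "norm (g s) \<le> \<bar>C\<bar> / (real n)\<^sup>2" .
      qed auto
      moreover have "norm (?b - ?a) = \<bar>xb - xa\<bar>" by (simp add: norm_complex_def)
      ultimately show ?case by simp
    qed
  qed
  let ?L = "\<lambda>n. \<i> * integral {-real n..real n} (\<lambda>y. g (Complex x2 y)) - \<i> * integral {-real n..real n} (\<lambda>y. g (Complex x1 y))
       + contour_integral (linepath (Complex x1 (-real n)) (Complex x2 (-real n))) g
       + contour_integral (linepath (Complex x2 (real n)) (Complex x1 (real n))) g"
  have "?L \<longlonglongrightarrow> \<i> * line_integral x2 g - \<i> * line_integral x1 g + 0 + 0"
    using hor[of "-1" x1 x2] hor[of 1 x2 x1] lr
    by (intro tendsto_intros lim) auto
  moreover have "\<forall>\<^sub>F n in sequentially. ?L n = 2 * pi * \<i> * f b"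
    using eventually_gt_at_top[of "nat \<lceil>\<bar>Im b\<bar>\<rceil>"]
  proof eventually_elim
    case (elim n)
    have "real n > \<bar>Im b\<bar>" using elim by linarith
    then show ?case using rectangle_Cauchy[OF holo lr, of "real n"] by (simp add: g_def)
  qed
  then have "?L \<longlonglongrightarrow> 2 * pi * \<i> * f b" by (rule tendsto_eventually)
  ultimately have "\<i> * line_integral x2 g - \<i> * line_integral x1 g + 0 + 0 = 2 * pi * \<i> * f b"
    by (rule LIMSEQ_unique)
  then have "\<i> * (line_integral x2 g - line_integral x1 g) = \<i> * (2 * pi * f b)"
    by (simp add: algebra_simps)
  then show ?thesis unfolding g_def by simp
qed

text \<open>
  The case of residue 0: multiplying and dividing by \<open>s - b\<close> for some \<open>b\<close> between the lines creates an artificial pole.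
\<close>

lemma line_integral_shift:
  assumes holo: "g holomorphic_on {s. l < Re s \<and> Re s < r}"
    and lr: "l < x1" "x1 < x2" "x2 < r"
    and bd: "\<And>s. x1 \<le> Re s \<Longrightarrow> Re s \<le> x2 \<Longrightarrow> \<bar>Im s\<bar> \<ge> Y \<Longrightarrow> norm (g s) \<le> C / (Im s)\<^sup>2"
  shows "line_integral x2 g = line_integral x1 g"
proof -
  define b where "b = complex_of_real ((x1 + x2) / 2)"
  have b: "Re b = (x1 + x2) / 2" by (simp add: b_def)
  let ?f = "\<lambda>s. g s * (s - b)"
  have eq: "line_integral x (\<lambda>s. ?f s / (s - b)) = line_integral x g" if "x \<noteq> Re b" for x
  proof -
    have "Complex x y - b \<noteq> 0" for y using that by (auto simp: complex_eq_iff)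
    then show ?thesis by (simp add: line_integral_def)
  qed
  have "line_integral x2 (\<lambda>s. ?f s / (s - b)) - line_integral x1 (\<lambda>s. ?f s / (s - b)) = 2 * pi * ?f b"
  proof (rule line_integral_shift_pole[of ?f, OF _ lr(1) _ _ lr(3), where Y = "max 1 Y" and C = C])
    show "?f holomorphic_on {s. l < Re s \<and> Re s < r}" by (intro holomorphic_intros holo)
  next
    fix s assume s: "x1 \<le> Re s" "Re s \<le> x2" "max 1 Y \<le> \<bar>Im s\<bar>"
    have "s - b \<noteq> 0" using s by (auto simp: b_def complex_eq_iff)
    then show "norm (?f s / (s - b)) \<le> C / (Im s)\<^sup>2" using bd[of s] s by simp
  qed (use lr b in auto)
  then show ?thesis using lr b eq[of x1] eq[of x2] by (simp only:) simp
qed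

section \<open>The Cahen--Mellin integral\<close>

lemma Gamma_eq_Gamma_shift:
  fixes u :: complex
  assumes "u \<notin> \<int>\<^sub>\<le>\<^sub>0"
  shows "Gamma u = Gamma (u + of_nat n) / pochhammer u n"
proof -
  have p: "pochhammer u n \<noteq> 0" using assms pochhammer_eq_0_imp_nonpos_Int by blast
  have "Gamma u \<noteq> 0" using assms by (simp add: Gamma_eq_zero_iff)
  then have "Gamma u * pochhammer u n = Gamma (u + of_nat n)"
    using pochhammer_Gamma[OF assms, of n] by simp
  then show ?thesis by (simp only: nonzero_eq_divide_eq[OF p])
qed

lemma norm_pochhammer_ge_Im:
  "norm (pochhammer u n) \<ge> \<bar>Im u\<bar> ^ n"
proof -
  have "\<bar>Im u\<bar> ^ n = (\<Prod>i<n. \<bar>Im (u + of_nat i)\<bar>)" by simp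
  also have "\<dots> \<le> (\<Prod>i<n. norm (u + of_nat i))" by (intro prod_mono) (auto simp: abs_Im_le_cmod simp del: plus_complex.sel)
  also have "\<dots> = norm (pochhammer u n)" by (simp add: pochhammer_prod prod_norm atLeast0LessThan)
  finally show ?thesis .
qed

text \<open>
  The rotated bound alone gives no decay in \<open>Im u\<close>. Shifting the argument to the right by \<open>m \<ge> 2\<close> divides by a
  Pochhammer symbol, each factor of which has modulus at least \<open>|Im u|\<close>.
\<close>

lemma Gamma_rotated_decay:
  assumes "\<bar>\<phi>\<bar> < pi/2"
  shows "\<exists>C. \<forall>u. x1 \<le> Re u \<longrightarrow> Re u \<le> x2 \<longrightarrow> \<bar>Im u\<bar> \<ge> 1 \<longrightarrow> norm (Gamma u) * exp (\<phi> * Im u) \<le> C / (Im u)\<^sup>2"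
proof -
  \<comment> \<open>at least two factors for the decay, and enough to reach the right half-plane\<close>
  define m where "m = nat \<lceil>max 2 (1 - x1)\<rceil>"
  have m: "x1 + real m \<ge> 1" "m \<ge> 2" unfolding m_def by linarith+
  define h where "h = (\<lambda>x. Gamma x * cos \<phi> powr (- x))"
  have c: "cos \<phi> > 0" using assms by (intro cos_gt_zero_pi) auto
  have "continuous_on {x1 + real m..x2 + real m} h"
    unfolding h_def using m c by (intro continuous_intros) (auto elim!: nonpos_Ints_cases)
  then have "compact (h ` {x1 + real m..x2 + real m})" using compact_continuous_image by blast
  then obtain B where B: "\<And>x. x \<in> {x1 + real m..x2 + real m} \<Longrightarrow> norm (h x) \<le> B"
    using compact_imp_bounded bounded_iff by (metis imageI)
  have "norm (Gamma u) * exp (\<phi> * Im u) \<le> B / (Im u)\<^sup>2" if u: "x1 \<le> Re u" "Re u \<le> x2" "\<bar>Im u\<bar> \<ge> 1" for u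
  proof -
    have n: "u \<notin> \<int>\<^sub>\<le>\<^sub>0" using u(3) by (auto elim!: nonpos_Ints_cases)
    have "norm (Gamma (u + of_nat m)) * exp (\<phi> * Im u) \<le> h (Re u + real m)"
      using norm_Gamma_rotated_le[of "u + of_nat m" \<phi>] assms u m by (simp add: h_def)
    also have "\<dots> \<le> B" using B[of "Re u + real m"] u by simp
    finally have 1: "norm (Gamma (u + of_nat m)) * exp (\<phi> * Im u) \<le> B" .
    then have B0: "B \<ge> 0" by (rule order_trans[rotated]) simp
    have "(Im u)\<^sup>2 = \<bar>Im u\<bar> ^ 2" by simp
    also have "\<dots> \<le> \<bar>Im u\<bar> ^ m" using u m by (intro power_increasing) auto
    also have "\<dots> \<le> norm (pochhammer u m)" by (rule norm_pochhammer_ge_Im)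
    finally have 2: "(Im u)\<^sup>2 \<le> norm (pochhammer u m)" .
    have "norm (Gamma u) * exp (\<phi> * Im u) = norm (Gamma (u + of_nat m)) * exp (\<phi> * Im u) / norm (pochhammer u m)"
      by (subst Gamma_eq_Gamma_shift[OF n, of m]) (simp add: norm_divide)
    also have "\<dots> \<le> B / (Im u)\<^sup>2" using 1 2 u(3) B0 by (intro frac_le) auto
    finally show ?thesis .
  qed
  then show ?thesis by blast
qed

lemma norm_exp_minus_mult: "norm (exp (- (u * \<zeta>))) = exp (Im \<zeta> * Im u) * exp (- (Re u * Re \<zeta>))"
  by (simp add: norm_exp_eq_Re exp_add[symmetric])

lemma Gamma_exp_decay:
  fixes \<zeta> :: complex
  assumes "\<bar>Im \<zeta>\<bar> < pi/2"
  shows "\<exists>C. \<forall>u. x1 \<le> Re u \<longrightarrow> Re u \<le> x2 \<longrightarrow> \<bar>Im u\<bar> \<ge> 1 \<longrightarrow> norm (Gamma u * exp (- (u * \<zeta>))) \<le> C / (Im u)\<^sup>2"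
proof -
  obtain C where C: "\<And>u. x1 \<le> Re u \<Longrightarrow> Re u \<le> x2 \<Longrightarrow> \<bar>Im u\<bar> \<ge> 1 \<Longrightarrow> norm (Gamma u) * exp (Im \<zeta> * Im u) \<le> C / (Im u)\<^sup>2"
    using Gamma_rotated_decay[OF assms] by blast
  define D where "D = exp (max \<bar>x1\<bar> \<bar>x2\<bar> * \<bar>Re \<zeta>\<bar>)"
  have "norm (Gamma u * exp (- (u * \<zeta>))) \<le> (\<bar>C\<bar> * D) / (Im u)\<^sup>2" if u: "x1 \<le> Re u" "Re u \<le> x2" "\<bar>Im u\<bar> \<ge> 1" for u
  proof -
    have "- (Re u * Re \<zeta>) \<le> \<bar>Re u\<bar> * \<bar>Re \<zeta>\<bar>" by (metis abs_mult abs_ge_minus_self)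
    also have "\<dots> \<le> max \<bar>x1\<bar> \<bar>x2\<bar> * \<bar>Re \<zeta>\<bar>" using u by (intro mult_right_mono) auto
    finally have 1: "exp (- (Re u * Re \<zeta>)) \<le> D" by (simp add: D_def)
    have "norm (Gamma u * exp (- (u * \<zeta>))) = norm (Gamma u) * exp (Im \<zeta> * Im u) * exp (- (Re u * Re \<zeta>))"
      by (simp only: norm_mult norm_exp_minus_mult mult.assoc)
    also have "\<dots> \<le> (\<bar>C\<bar> / (Im u)\<^sup>2) * D"
      using C[OF u] 1 by (intro mult_mono order_trans[OF C[OF u]] divide_right_mono) auto
    finally show ?thesis by simp
  qed
  then show ?thesis by blast
qed

lemma continuous_on_vertical_line:
  assumes "g holomorphic_on {s. l < Re s \<and> Re s < r}" "l < x" "x < r"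
  shows "continuous_on UNIV (\<lambda>y. g (Complex x y))"
proof -
  have "continuous_on UNIV (Complex x)" by (intro continuous_intros continuous_on_Complex)
  then show ?thesis using assms
    by (intro continuous_on_compose2[OF holomorphic_on_imp_continuous_on[OF assms(1)]]) auto
qed

text \<open>
  A vertical strip avoids the poles if it lies in the right half-plane or between two consecutive poles.
\<close>

lemma Gamma_exp_holo:
  fixes \<zeta> :: complex
  assumes "l \<ge> 0 \<or> (\<exists>k::nat. l \<ge> - real k - 1 \<and> r \<le> - real k)"
  shows "(\<lambda>u. Gamma u * exp (- (u * \<zeta>))) holomorphic_on {s. l < Re s \<and> Re s < r}"
proof -
  have "u \<notin> \<int>\<^sub>\<le>\<^sub>0" if u: "u \<in> {s. l < Re s \<and> Re s < r}" for u
  proof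
    assume "u \<in> \<int>\<^sub>\<le>\<^sub>0"
    then obtain n :: nat where n: "u = - of_nat n" by (auto elim!: nonpos_Ints_cases')
    show False using assms
    proof
      assume "\<exists>k::nat. l \<ge> - real k - 1 \<and> r \<le> - real k"
      then obtain k :: nat where "l \<ge> - real k - 1" "r \<le> - real k" by blast
      then have "real k < real n" "real n < real k + 1" using u n by auto
      then have "k < n" "n < k + 1" by linarith+
      then show False by simp
    qed (use u n in auto)
  qed
  then have "{s. l < Re s \<and> Re s < r} \<inter> \<int>\<^sub>\<le>\<^sub>0 = {}" by blast
  then show ?thesis by (intro holomorphic_intros)
qed

lemma Gamma_exp_integrable:
  fixes \<zeta> :: complex
  assumes "\<bar>Im \<zeta>\<bar> < pi/2" "x > 0"
  shows "integrable lborel (\<lambda>y. Gamma (Complex x y) * exp (- (Complex x y * \<zeta>)))"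
proof -
  obtain C where C: "\<And>u. x \<le> Re u \<Longrightarrow> Re u \<le> x \<Longrightarrow> \<bar>Im u\<bar> \<ge> 1 \<Longrightarrow> norm (Gamma u * exp (- (u * \<zeta>))) \<le> C / (Im u)\<^sup>2"
    using Gamma_exp_decay[OF assms(1)] by blast
  show ?thesis
  proof (rule integrable_if_inverse_square[where Y = 1 and C = C])
    show "continuous_on UNIV (\<lambda>y. Gamma (Complex x y) * exp (- (Complex x y * \<zeta>)))"
      by (rule continuous_on_vertical_line[of _ 0 "x + 1"]) (use assms in \<open>auto intro: Gamma_exp_holo\<close>)
  qed (use C[of "Complex x _"] in simp)
qed

text \<open>
  The residue of \<open>\<Gamma>(u) z\<^bsup>-u\<^esup>\<close> at \<open>-k\<close> is the \<open>k\<close>-th term of the exponential series of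
  \<open>-z\<close>, where \<open>z = e\<^sup>\<zeta>\<close>.
\<close>

lemma Gamma_exp_shift_pole:
  fixes \<zeta> :: complex
  assumes "\<bar>Im \<zeta>\<bar> < pi/2"
  shows "line_integral (1/2 - real k) (\<lambda>u. Gamma u * exp (- (u * \<zeta>)))
       - line_integral (1/2 - real (Suc k)) (\<lambda>u. Gamma u * exp (- (u * \<zeta>))) = 2 * pi * ((- exp \<zeta>) ^ k / fact k)"
proof -
  define f where "f u = Gamma (u + of_nat (Suc k)) / pochhammer u k * exp (- (u * \<zeta>))" for u :: complex
  have strip: "u \<notin> \<int>\<^sub>\<le>\<^sub>0" if "- real k - 1 < Re u" "Re u < - real k + 1" "u \<noteq> - of_nat k" for u :: complex
  proof
    assume "u \<in> \<int>\<^sub>\<le>\<^sub>0"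
    then obtain n :: nat where n: "u = - of_nat n" by (auto elim!: nonpos_Ints_cases')
    with that have "real n < real k + 1" "real n > real k - 1" by auto
    then have "n = k" by linarith
    then show False using n that by simp
  qed
  have eq: "f u / (u - (- of_nat k)) = Gamma u * exp (- (u * \<zeta>))" if "- real k - 1 < Re u" "Re u < - real k + 1" "u \<noteq> - of_nat k" for u :: complex
    using Gamma_eq_Gamma_shift[OF strip[OF that], of "Suc k"] by (simp add: f_def pochhammer_Suc)
  obtain C where C: "\<And>u. 1/2 - real (Suc k) \<le> Re u \<Longrightarrow> Re u \<le> 1/2 - real k \<Longrightarrow> \<bar>Im u\<bar> \<ge> 1 \<Longrightarrow> norm (Gamma u * exp (- (u * \<zeta>))) \<le> C / (Im u)\<^sup>2"
    using Gamma_exp_decay[OF assms] by blast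
  have "line_integral (1/2 - real k) (\<lambda>s. f s / (s - (- of_nat k)))
       - line_integral (1/2 - real (Suc k)) (\<lambda>s. f s / (s - (- of_nat k))) = 2 * pi * f (- of_nat k)"
  proof (rule line_integral_shift_pole[where l = "- real k - 1" and r = "- real k + 1" and Y = 1 and C = C])
    have nz: "pochhammer u k \<noteq> 0" if "Re u < - real k + 1" for u
      using that by (auto simp: pochhammer_eq_0_iff)
    have "u + of_nat (Suc k) \<notin> \<int>\<^sub>\<le>\<^sub>0" if "- real k - 1 < Re u" for u
      using that by (auto elim!: nonpos_Ints_cases' simp: complex_eq_iff)
    then show "f holomorphic_on {s. - real k - 1 < Re s \<and> Re s < - real k + 1}"
      unfolding f_def pochhammer_prod using nz
      by (intro holomorphic_intros) (auto simp: pochhammer_prod)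
    fix s assume s: "1/2 - real (Suc k) \<le> Re s" "Re s \<le> 1/2 - real k" "1 \<le> \<bar>Im s\<bar>"
    then have "f s / (s - (- of_nat k)) = Gamma s * exp (- (s * \<zeta>))"
      by (intro eq) auto
    then show "norm (f s / (s - (- of_nat k))) \<le> C / (Im s)\<^sup>2" using C[of s] s by simp
  qed auto
  moreover have "line_integral x (\<lambda>s. f s / (s - (- of_nat k))) = line_integral x (\<lambda>u. Gamma u * exp (- (u * \<zeta>)))"
    if "x = 1/2 - real k \<or> x = 1/2 - real (Suc k)" for x
  proof -
    have "f (Complex x y) / (Complex x y - (- of_nat k)) = Gamma (Complex x y) * exp (- (Complex x y * \<zeta>))" for y
      using that by (intro eq) (auto simp: complex_eq_iff)
    then show ?thesis by (simp add: line_integral_def)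
  qed
  moreover have "f (- of_nat k) = (- exp \<zeta>) ^ k / fact k"
  proof -
    have "pochhammer (- of_nat k :: complex) k = (- 1) ^ k * fact k" by (simp add: pochhammer_same)
    then show ?thesis by (simp add: f_def exp_of_nat_mult[symmetric] power_minus[of "exp \<zeta>"] field_simps)
  qed
  ultimately show ?thesis by simp
qed

text \<open>
  On the line \<open>Re u = 1/2 - k\<close> the functional equation compares \<open>\<Gamma>(u)\<close> with its values on \<open>Re u = 1/2\<close>: the
  quotient is a product of \<open>k\<close> factors whose moduli are at least half the numbers \<open>1, ..., k\<close>.
\<close>

lemma Gamma_exp_far_left:
  fixes \<zeta> :: complex
  assumes "\<bar>Im \<zeta>\<bar> < pi/2"
  shows "(\<lambda>k. line_integral (1/2 - real k) (\<lambda>u. Gamma u * exp (- (u * \<zeta>)))) \<longlonglongrightarrow> 0"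
proof -
  let ?g = "\<lambda>y. norm (Gamma (Complex (1/2) y) * exp (- (Complex (1/2) y * \<zeta>)))"
  define W where "W = (LINT y|lborel. ?g y)"
  define R where "R = 2 * exp (Re \<zeta>)"
  have int: "integrable lborel ?g" using Gamma_exp_integrable[OF assms, of "1/2"] by simp
  have bd: "norm (line_integral (1/2 - real k) (\<lambda>u. Gamma u * exp (- (u * \<zeta>)))) \<le> W * (R ^ k / fact k)" for k
  proof -
    have pt: "norm (Gamma (Complex (1/2 - real k) y) * exp (- (Complex (1/2 - real k) y * \<zeta>))) \<le> ?g y * (R ^ k / fact k)" for y
    proof -
      define u where "u = Complex (1/2 - real k) y"
      have sh: "u + of_nat k = Complex (1/2) y" by (simp add: u_def complex_eq_iff)
      have nu: "u \<notin> \<int>\<^sub>\<le>\<^sub>0"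
      proof
        assume "u \<in> \<int>\<^sub>\<le>\<^sub>0"
        then obtain n :: nat where "u = - of_nat n" by (auto elim!: nonpos_Ints_cases')
        then have "1 + 2 * real n = 2 * real k" by (auto simp: u_def complex_eq_iff field_simps)
        then have "1 + 2 * n = 2 * k" by linarith
        then show False by presburger
      qed
      have "fact k / 2 ^ k = (\<Prod>i<k. (real k - real i) / 2)"
        by (simp add: prod_dividef fact_prod_rev of_nat_prod atLeast0LessThan of_nat_diff)
      also have "\<dots> \<le> (\<Prod>i<k. norm (u + of_nat i))"
      proof (rule prod_mono, safe)
        fix i assume i: "i < k"
        have "(real k - real i) / 2 \<le> \<bar>Re (u + of_nat i)\<bar>" using i by (simp add: u_def)
        then show "(real k - real i) / 2 \<le> norm (u + of_nat i)" by (rule order_trans[OF _ abs_Re_le_cmod])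
      qed simp
      also have "\<dots> = norm (pochhammer u k)" by (simp add: pochhammer_prod prod_norm atLeast0LessThan)
      finally have p: "fact k / 2 ^ k \<le> norm (pochhammer u k)" .
      have "exp (- (u * \<zeta>)) = exp (- (Complex (1/2) y * \<zeta>)) * exp (of_nat k * \<zeta>)"
        unfolding sh[symmetric] by (simp add: exp_add[symmetric] algebra_simps)
      then have "norm (Gamma u * exp (- (u * \<zeta>))) = ?g y * exp (Re \<zeta>) ^ k / norm (pochhammer u k)"
        by (simp add: Gamma_eq_Gamma_shift[OF nu, of k] sh norm_mult norm_divide exp_of_nat_mult norm_power)
      also have "\<dots> \<le> ?g y * exp (Re \<zeta>) ^ k / (fact k / 2 ^ k)"
      proof (rule divide_left_mono[OF p])
        have "0 < fact k / (2 ^ k :: real)" by simp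
        with p show "0 < norm (pochhammer u k) * (fact k / 2 ^ k)" by (intro mult_pos_pos) linarith+
      qed (intro mult_nonneg_nonneg zero_le_power norm_ge_zero exp_ge_zero)
      also have "\<dots> = ?g y * (R ^ k / fact k)" by (simp add: R_def power_mult_distrib)
      finally show ?thesis by (simp add: u_def)
    qed
    have "norm (line_integral (1/2 - real k) (\<lambda>u. Gamma u * exp (- (u * \<zeta>)))) \<le> (LINT y|lborel. ?g y * (R ^ k / fact k))"
      unfolding line_integral_def
    proof (rule order_trans[OF integral_norm_bound])
      have i2: "integrable lborel (\<lambda>y. ?g y * (R ^ k / fact k))"
        using int by (intro integrable_mult_left)
      have "R ^ k / fact k \<ge> 0" unfolding R_def by (intro divide_nonneg_nonneg zero_le_power mult_nonneg_nonneg) auto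
      then have n2: "0 \<le> ?g y * (R ^ k / fact k)" for y by (intro mult_nonneg_nonneg norm_ge_zero)
      show "(LINT y|lborel. norm (Gamma (Complex (1/2 - real k) y) * exp (- (Complex (1/2 - real k) y * \<zeta>))))
           \<le> (LINT y|lborel. ?g y * (R ^ k / fact k))"
        by (rule integral_mono'[OF i2 pt n2])
    qed
    then show ?thesis by (simp add: W_def)
  qed
  have "(\<lambda>k. W * (R ^ k / fact k)) \<longlonglongrightarrow> 0"
  proof (rule tendsto_mult_right_zero)
    show "(\<lambda>k. R ^ k / fact k) \<longlonglongrightarrow> 0"
      using summable_LIMSEQ_zero[OF summable_exp[of R]] by (simp add: divide_inverse mult.commute)
  qed
  then show ?thesis
    by (rule Lim_null_comparison[OF always_eventually, rotated]) (intro allI bd)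
qed

text \<open>
  Moving the line to the left through all poles collects the exponential series. In terms of \<open>z = e\<^sup>\<zeta>\<close> the
  hypothesis on \<open>\<zeta>\<close> says that \<open>Re z > 0\<close>; the logarithm is used as parameter so that \<open>z\<^bsup>-u\<^esup>\<close> involves
  no choice of branch.
\<close>

theorem Mellin_inversion_exp:
  fixes \<zeta> :: complex
  assumes "\<bar>Im \<zeta>\<bar> < pi/2" "x > 0"
  shows "line_integral x (\<lambda>u. Gamma u * exp (- (u * \<zeta>))) = 2 * pi * exp (- exp \<zeta>)"
proof -
  let ?k = "\<lambda>u :: complex. Gamma u * exp (- (u * \<zeta>))"
  have tele: "line_integral (1/2) ?k = 2 * pi * (\<Sum>k<n. (- exp \<zeta>) ^ k / fact k) + line_integral (1/2 - real n) ?k" for n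
  proof (induction n)
    case (Suc n)
    then show ?case using Gamma_exp_shift_pole[OF assms(1), of n] by (simp add: algebra_simps)
  qed simp
  have "(\<lambda>n. 2 * pi * (\<Sum>k<n. (- exp \<zeta>) ^ k / fact k) + line_integral (1/2 - real n) ?k) \<longlonglongrightarrow> 2 * pi * exp (- exp \<zeta>) + 0"
  proof (intro tendsto_add tendsto_mult tendsto_const Gamma_exp_far_left assms)
    show "(\<lambda>n. \<Sum>k<n. (- exp \<zeta>) ^ k / fact k) \<longlonglongrightarrow> exp (- exp \<zeta>)"
      using exp_converges[of "- exp \<zeta>"] by (simp add: sums_def scaleR_conv_of_real field_simps)
  qed
  then have half: "line_integral (1/2) ?k = 2 * pi * exp (- exp \<zeta>)"
    unfolding tele[symmetric] by (simp add: LIMSEQ_const_iff)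
  have shift: "line_integral b ?k = line_integral a ?k" if ab: "0 < a" "a < b" for a b
  proof -
    obtain C where "\<And>u. a \<le> Re u \<Longrightarrow> Re u \<le> b \<Longrightarrow> \<bar>Im u\<bar> \<ge> 1 \<Longrightarrow> norm (?k u) \<le> C / (Im u)\<^sup>2"
      using Gamma_exp_decay[OF assms(1)] by blast
    then show ?thesis
      by (intro line_integral_shift[of _ 0 "b + 1" _ _ 1 C] Gamma_exp_holo) (use ab in auto)
  qed
  show ?thesis
  proof (rule linorder_cases[of x "1/2"])
    assume "x = 1/2"
    then show ?thesis using half by (simp only:)
  next
    assume "x < 1/2"
    from shift[OF assms(2) this] half show ?thesis by (simp only:)
  next
    assume x: "x > 1/2"
    have "line_integral x ?k = line_integral (1/2) ?k" by (rule shift) (use x in auto)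
    with half show ?thesis by (simp only:)
  qed
qed

text \<open>
  The quotient of both sides decreases in \<open>m\<close>, because \<open>(1 + 1/m)\<^bsup>m+1\<^esup> \<ge> e\<close>.
\<close>

lemma Gamma_of_nat_le:
  assumes "m \<ge> 1"
  shows "Gamma (real m) \<le> exp 1 * (real m ^ m * exp (- real m))"
  using assms
proof (induction m rule: dec_induct)
  case base
  then show ?case by (simp add: exp_minus)
next
  case (step m)
  have m: "real m > 0" using step by simp
  have "Gamma (real (Suc m)) = real m * Gamma (real m)"
  proof -
    have "real m \<notin> \<int>\<^sub>\<le>\<^sub>0" using m by (auto elim!: nonpos_Ints_cases)
    from Gamma_plus1[OF this] show ?thesis by (simp add: add.commute)
  qed
  also have "\<dots> \<le> real m * (exp 1 * (real m ^ m * exp (- real m)))" using step.IH m by (intro mult_left_mono) auto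
  also have "\<dots> = exp 1 * (real m ^ Suc m * exp 1) * exp (- real (Suc m))"
    by (simp add: exp_diff exp_minus field_simps)
  also have "\<dots> \<le> exp 1 * (real (Suc m) ^ Suc m) * exp (- real (Suc m))"
  proof (intro mult_right_mono mult_left_mono)
    have p: "1 + 1 / real m > 0" using m by (simp add: add_pos_pos)
    then have "ln (1 / (1 + 1 / real m)) \<le> 1 / (1 + 1 / real m) - 1" by (intro ln_le_minus_one) simp
    then have "ln (1 + 1 / real m) \<ge> 1 / real (Suc m)"
      using m p by (simp add: ln_div) (simp add: field_simps)
    then have "1 \<le> real (Suc m) * ln (1 + 1 / real m)" using m by (simp add: field_simps)
    then have "exp 1 \<le> exp (real (Suc m) * ln (1 + 1 / real m))" by simp
    also have "\<dots> = (1 + 1 / real m) ^ Suc m" using m by (simp only: exp_of_nat_mult) (simp add: add_pos_pos)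
    finally have "real m ^ Suc m * exp 1 \<le> real m ^ Suc m * (1 + 1 / real m) ^ Suc m" by (intro mult_left_mono) auto
    also have "\<dots> = (real m * (1 + 1 / real m)) ^ Suc m" by (simp only: power_mult_distrib)
    also have "real m * (1 + 1 / real m) = real (Suc m)" using m by (simp add: field_simps)
    finally show "real m ^ Suc m * exp 1 \<le> real (Suc m) ^ Suc m" .
  qed auto
  finally show ?case by (simp add: mult.assoc)
qed

text \<open>
  Rounding \<open>Y\<close> up to an integer costs only a constant factor and makes the elementary bound for factorials applicable.
\<close>

lemma Gamma_saddle_bound:
  assumes "Y > 0" "m = nat \<lceil>Y\<rceil>" "Y \<ge> 1"
  shows "Gamma (real m) * Y powr (- real m) \<le> exp 3 * exp (- Y)"
proof -
  have m: "real m \<ge> Y" "real m \<le> Y + 1" "m \<ge> 1" using assms by linarith+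
  have "Gamma (real m) * Y powr (- real m) \<le> exp 1 * (real m ^ m * exp (- real m)) * Y powr (- real m)"
    by (intro mult_right_mono Gamma_of_nat_le m) auto
  also have "\<dots> = exp 1 * (real m / Y) ^ m * exp (- real m)"
    using assms(1) by (simp add: powr_minus powr_realpow power_divide field_simps)
  also have "\<dots> \<le> exp 1 * exp 2 * exp (- Y)"
  proof (intro mult_mono)
    have "ln (real m / Y) \<le> real m / Y - 1" using m assms by (intro ln_le_minus_one) auto
    also have "\<dots> \<le> 1 / Y"
      using divide_right_mono[OF m(2), of Y] assms(1) by (simp add: add_divide_distrib)
    finally have "real m * ln (real m / Y) \<le> (Y + 1) * (1 / Y)"
      using m assms by (intro mult_mono) (auto simp: zero_le_divide_iff)
    also have "\<dots> \<le> 2" using assms by (simp add: field_simps)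
    finally have "exp (real m * ln (real m / Y)) \<le> exp 2" by simp
    moreover have "real m / Y > 0" using m assms(1) by simp
    ultimately show "(real m / Y) ^ m \<le> exp 2" by (simp only: exp_of_nat_mult exp_ln)
  qed (use m assms in auto)
  also have "\<dots> = exp 3 * exp (- Y)" by (simp add: exp_add[symmetric])
  finally show ?thesis .
qed

text \<open>
  With \<open>z = X e\<^bsup>-i\<theta>\<^esup>\<close> the modulus of \<open>\<Gamma>(u) z\<^bsup>-u\<^esup>\<close> has its saddle point at
  \<open>u = z\<close>, so the vertical line to use is the one with real part \<open>X cos \<theta>\<close>, up to rounding.
\<close>

lemma Gamma_saddle_line:
  assumes th: "\<bar>\<theta>\<bar> < pi/2" and X: "X > 0" "X * cos \<theta> \<ge> 1" and v: "Re v = real (nat \<lceil>X * cos \<theta>\<rceil>)"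
  shows "norm (Gamma v * exp (- (v * Complex (ln X) (- \<theta>)))) \<le> exp 3 * exp (- (X * cos \<theta>))"
proof -
  have c: "cos \<theta> > 0" using th by (intro cos_gt_zero_pi) auto
  have m: "Re v \<ge> 1" using v X by linarith
  have "norm (Gamma v * exp (- (v * Complex (ln X) (- \<theta>)))) = norm (Gamma v) * exp ((- \<theta>) * Im v) * exp (- (Re v * ln X))"
    by (simp only: norm_mult norm_exp_minus_mult complex.sel mult.assoc)
  also have "\<dots> \<le> Gamma (Re v) * cos (- \<theta>) powr (- Re v) * exp (- (Re v * ln X))"
    using norm_Gamma_rotated_le[of v "- \<theta>"] m th by (intro mult_right_mono) auto
  also have "\<dots> = Gamma (Re v) * (X * cos \<theta>) powr (- Re v)"
    using X c by (simp add: powr_def ln_mult exp_add[symmetric] algebra_simps)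
  also have "\<dots> \<le> exp 3 * exp (- (X * cos \<theta>))"
    unfolding v by (rule Gamma_saddle_bound) (use X in auto)
  finally show ?thesis .
qed

lemma Mellin_inversion_affine:
  fixes \<zeta> :: complex
  assumes "\<bar>Im \<zeta>\<bar> < pi/2" "k > 0" "k * x + t > 0"
  shows "integrable lborel (\<lambda>y. Gamma (of_real k * Complex x y + of_real t) * exp (- (of_real k * Complex x y * \<zeta>)))"
    and "line_integral x (\<lambda>s. Gamma (of_real k * s + of_real t) * exp (- (of_real k * s * \<zeta>))) = 2 * pi / k * (exp (of_real t * \<zeta>) * exp (- exp \<zeta>))"
proof -
  define f where "f y = Gamma (Complex (k * x + t) y) * exp (- (Complex (k * x + t) y * \<zeta>))" for y
  have int: "integrable lborel f" unfolding f_def by (rule Gamma_exp_integrable[OF assms(1,3)])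
  have eq: "Gamma (of_real k * Complex x y + of_real t) * exp (- (of_real k * Complex x y * \<zeta>)) = exp (of_real t * \<zeta>) * f (0 + k * y)" for y
  proof -
    have h1: "of_real k * Complex x y + of_real t = Complex (k * x + t) (k * y)" by (simp add: complex_eq_iff)
    have h2: "of_real k * Complex x y = Complex (k * x + t) (k * y) - of_real t" by (simp add: complex_eq_iff)
    have e: "exp (- ((z - of_real t) * \<zeta>)) = exp (of_real t * \<zeta>) * exp (- (z * \<zeta>))" for z
      by (simp add: exp_add[symmetric] algebra_simps)
    show ?thesis unfolding h1 unfolding h2 e by (simp add: f_def)
  qed
  have i2: "integrable lborel (\<lambda>y. f (0 + k * y))" using lborel_integrable_real_affine[OF int, of k 0] assms by simp
  then show "integrable lborel (\<lambda>y. Gamma (of_real k * Complex x y + of_real t) * exp (- (of_real k * Complex x y * \<zeta>)))"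
    unfolding eq by (intro integrable_mult_right)
  have "(LINT y|lborel. f y) = \<bar>k\<bar> *\<^sub>R (LINT y|lborel. f (0 + k * y))"
    by (rule lborel_integral_real_affine) (use assms in auto)
  moreover have "(LINT y|lborel. f y) = 2 * pi * exp (- exp \<zeta>)"
    using Mellin_inversion_exp[OF assms(1,3)] by (simp add: line_integral_def f_def)
  ultimately have "(LINT y|lborel. f (0 + k * y)) = 2 * pi / k * exp (- exp \<zeta>)"
    using assms(2) by (simp add: scaleR_conv_of_real field_simps)
  then show "line_integral x (\<lambda>s. Gamma (of_real k * s + of_real t) * exp (- (of_real k * s * \<zeta>))) = 2 * pi / k * (exp (of_real t * \<zeta>) * exp (- exp \<zeta>))"
    unfolding line_integral_def eq by (simp add: mult_ac)
qed

section \<open>Stirling's formula and shifts of the Gamma function\<close>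

definition stirling_error :: "nat \<Rightarrow> real" where
  "stirling_error n = ln (fact n) - ((real n + 1/2) * ln (real n) - real n)"

text \<open>
  Consecutive errors differ by \<open>O(1/n\<^sup>2)\<close>, which is summable.
\<close>

lemma stirling_error_convergent: "convergent stirling_error"
proof -
  let ?d = "\<lambda>n. stirling_error (Suc n) - stirling_error n"
  have eq: "?d n = 1 - (real n + 1/2) * ln (1 + 1 / real n)" if "n \<ge> 1" for n
  proof -
    have n: "real n > 0" using that by simp
    have "1 + 1 / real n = real (Suc n) / real n" using n by (simp add: field_simps)
    then have L1: "ln (real (Suc n)) = ln (real n) + ln (1 + 1 / real n)"
      using n by (simp only:) (simp add: ln_div)
    have L2: "ln (fact (Suc n)) = ln (real n) + ln (1 + 1 / real n) + ln (fact n)"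
      unfolding L1[symmetric] by (simp add: ln_mult del: of_nat_Suc)
    show ?thesis unfolding stirling_error_def L1 L2 by (simp add: algebra_simps add_divide_distrib)
  qed
  have "summable ?d"
  proof (rule summable_comparison_test_bigo)
    show "summable (\<lambda>n. norm (1 / real n ^ 2))"
      using inverse_power_summable[of 2, where ?'a = real] by (simp add: field_simps)
    have "(\<lambda>n. 1 - (real n + 1/2) * ln (1 + 1 / real n)) \<in> O(\<lambda>n. 1 / real n ^ 2)"
      by real_asymp
    moreover have "\<forall>\<^sub>F n in sequentially. ?d n = 1 - (real n + 1/2) * ln (1 + 1 / real n)"
      using eventually_ge_at_top[of 1] by eventually_elim (rule eq)
    ultimately show "?d \<in> O(\<lambda>n. 1 / real n ^ 2)"
      by (subst landau_o.big.in_cong)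
  qed
  then have "convergent (\<lambda>n. stirling_error n - stirling_error 0)"
    unfolding summable_iff_convergent by (simp add: sum_lessThan_telescope)
  then show ?thesis by (simp add: convergent_diff_const_right_iff)
qed

lemma wallis_product_closed_form:
  "(\<Prod>k=1..n. (4 * real k ^ 2) / (4 * real k ^ 2 - 1)) = (2 ^ n * fact n) ^ 4 / (fact (2 * n) ^ 2 * (2 * real n + 1))"
proof (induction n)
  case (Suc n)
  have 1: "4 * (1 + real n) ^ 2 - 1 = (2 * real n + 1) * (2 * real n + 3)" by (simp add: power2_eq_square algebra_simps)
  have 2: "fact (2 * Suc n) = (2 * real n + 2) * (2 * real n + 1) * fact (2 * n)"
    by (simp add: algebra_simps)
  have 3: "(2 ^ Suc n * fact (Suc n) :: real) = (2 * (1 + real n)) * (2 ^ n * fact n)"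
    by simp
  have nz: "2 * real n + 1 \<noteq> 0" "2 * real n + 3 \<noteq> 0" "2 * real n + 2 \<noteq> 0" "(fact (2*n) :: real) \<noteq> 0" by auto
  have 4: "2 * (1 + real n) + 1 = 2 * real n + 3" "real (Suc n) = 1 + real n" by simp_all
  define P Q where "P = (2 ^ n * fact n :: real)" and "Q = (fact (2 * n) :: real)"
  have "(\<Prod>k=1..Suc n. (4 * real k ^ 2) / (4 * real k ^ 2 - 1)) = P ^ 4 / (Q ^ 2 * (2 * real n + 1)) * (4 * (1 + real n) ^ 2 / ((2 * real n + 1) * (2 * real n + 3)))"
  proof -
    have "(\<Prod>k=1..Suc n. (4 * real k ^ 2) / (4 * real k ^ 2 - 1)) =
      (\<Prod>k=1..n. (4 * real k ^ 2) / (4 * real k ^ 2 - 1)) * (4 * (1 + real n) ^ 2 / (4 * (1 + real n) ^ 2 - 1))"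
      by (simp add: add.commute)
    then show ?thesis unfolding Suc.IH 1 P_def Q_def .
  qed
  also have "\<dots> = (2 * (1 + real n) * P) ^ 4 / (((2 * real n + 2) * (2 * real n + 1) * Q) ^ 2 * (2 * real n + 3))"
    using nz by (simp add: Q_def[symmetric] power_mult_distrib divide_simps) algebra
  finally show ?case unfolding 2 3 P_def[symmetric] Q_def[symmetric] 4(2) 4(1) .
qed simp

text \<open>
  The limit exists already; Wallis' product, written with factorials, is a combination of the errors at \<open>n\<close> and
  \<open>2n\<close> and identifies it.
\<close>

theorem stirling_error_LIMSEQ: "stirling_error \<longlonglongrightarrow> ln (2 * pi) / 2"
proof -
  obtain l where l: "stirling_error \<longlonglongrightarrow> l" using stirling_error_convergent by (auto simp: convergent_def)
  have l2: "(\<lambda>n. stirling_error (2 * n)) \<longlonglongrightarrow> l"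
    by (rule LIMSEQ_subseq_LIMSEQ[OF l, unfolded o_def]) (auto simp: strict_mono_def)
  let ?W = "\<lambda>n. \<Prod>k=1..n. (4 * real k ^ 2) / (4 * real k ^ 2 - 1)"
  have "(\<lambda>n. ln (?W n)) \<longlonglongrightarrow> ln (pi / 2)" by (intro tendsto_ln wallis) auto
  moreover have "\<forall>\<^sub>F n in sequentially. ln (?W n) = 4 * stirling_error n - 2 * stirling_error (2 * n) + (ln (real n) - ln 2 - ln (2 * real n + 1))"
    using eventually_gt_at_top[of 0]
  proof eventually_elim
    case (elim n)
    then have n: "real n > 0" by simp
    have "ln (?W n) = 4 * (real n * ln 2 + ln (fact n)) - (2 * ln (fact (2 * n)) + ln (2 * real n + 1))"
      unfolding wallis_product_closed_form using n by (simp add: ln_div ln_mult ln_realpow add_pos_pos)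
    then show ?case using n by (simp add: stirling_error_def ln_mult algebra_simps)
  qed
  ultimately have "(\<lambda>n. 4 * stirling_error n - 2 * stirling_error (2 * n) + (ln (real n) - ln 2 - ln (2 * real n + 1))) \<longlonglongrightarrow> ln (pi / 2)"
    by (rule Lim_transform_eventually)
  moreover have "(\<lambda>n. 4 * stirling_error n - 2 * stirling_error (2 * n) + (ln (real n) - ln 2 - ln (2 * real n + 1))) \<longlonglongrightarrow> 4 * l - 2 * l + (- 2 * ln 2)"
  proof (intro tendsto_intros l l2)
    have "(\<lambda>n. ln (real n) - ln 2 - ln (2 * real n + 1)) \<longlonglongrightarrow> - ln 2 - ln 2" by real_asymp
    then show "(\<lambda>n. ln (real n) - ln 2 - ln (2 * real n + 1)) \<longlonglongrightarrow> - 2 * ln 2" by simp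
  qed
  ultimately have "ln (pi / 2) = 4 * l - 2 * l + (- 2 * ln 2)" by (rule LIMSEQ_unique)
  then have "l = ln (2 * pi) / 2" by (simp add: ln_div ln_mult)
  with l show ?thesis by (simp only:)
qed

text \<open>
  This is Euler's limit formula for \<open>\<Gamma>(z)\<close>, solved for the Pochhammer symbol.
\<close>

lemma Gamma_shift_asymptotics:
  fixes z :: complex
  assumes "z \<notin> \<int>\<^sub>\<le>\<^sub>0"
  shows "(\<lambda>n. Gamma (z + of_nat n) / (fact (n - 1) * exp (z * of_real (ln (real n))))) \<longlonglongrightarrow> 1"
proof -
  have G: "Gamma z \<noteq> 0" using assms by (simp add: Gamma_eq_zero_iff)
  have "(\<lambda>n. Gamma z / Gamma_series' z n) \<longlonglongrightarrow> Gamma z / Gamma z"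
    by (intro tendsto_divide tendsto_const Gamma_series'_LIMSEQ G)
  moreover have "Gamma z / Gamma_series' z n = Gamma (z + of_nat n) / (fact (n - 1) * exp (z * of_real (ln (real n))))" for n
    using pochhammer_Gamma[OF assms, of n] G by (simp add: Gamma_series'_def)
  ultimately show ?thesis using G by simp
qed

lemma fact_pred: "n > 0 \<Longrightarrow> fact (n - 1) = (fact n / of_nat n :: 'a :: field_char_0)"
  by (simp add: fact_reduce[of n])

section \<open>Germs at the origin and approximate recurrences\<close>

lemma analytic_zero_factor:
  fixes f :: "complex \<Rightarrow> complex"
  assumes "f analytic_on {0}" "f 0 = 0" "(f has_field_derivative d) (at 0)"
  obtains g where "g analytic_on {0}" "g 0 = d" "\<And>x. f x = x * g x"
proof -
  obtain r where r: "r > 0" "f holomorphic_on ball 0 r" using assms(1) by (auto simp: analytic_on_def)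
  define g where "g = (\<lambda>z. if z = 0 then deriv f 0 else (f z - f 0) / (z - 0))"
  have "g holomorphic_on ball 0 r" unfolding g_def by (rule pole_lemma[OF r(2)]) (use r in auto)
  then have "g analytic_on {0}" using r(1) unfolding analytic_on_def by auto
  moreover have "g 0 = d" using assms(3) by (simp add: g_def DERIV_imp_deriv)
  moreover have "f x = x * g x" for x using assms(2) by (simp add: g_def)
  ultimately show ?thesis by (rule that)
qed

lemma analytic_germ_bounded:
  assumes "f analytic_on {0 :: complex}"
  obtains K e where "K > 0" "e > 0" "\<And>x. norm x < e \<Longrightarrow> norm (f x) \<le> K"
proof -
  have "isCont f 0" using assms analytic_at_imp_isCont by blast
  then have "(f \<longlongrightarrow> f 0) (nhds 0)" by (simp add: isCont_def tendsto_at_iff_tendsto_nhds)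
  then have "eventually (\<lambda>x. dist (f x) (f 0) < 1) (nhds 0)" by (rule tendstoD) simp
  then obtain e where e: "e > 0" "\<And>x. dist x 0 < e \<Longrightarrow> dist (f x) (f 0) < 1"
    unfolding eventually_nhds_metric by blast
  show ?thesis
  proof (rule that[of "norm (f 0) + 1" e])
    fix x :: complex assume "norm x < e"
    then have "norm (f x - f 0) < 1" using e(2)[of x] by (simp add: dist_norm)
    then show "norm (f x) \<le> norm (f 0) + 1" using norm_triangle_ineq2[of "f x" "f 0"] by linarith
  qed (use e(1) in \<open>auto intro: add_nonneg_pos\<close>)
qed

lemma analytic_germ_real_at_0:
  assumes "f analytic_on {0 :: complex}" "\<forall>\<^sub>F x in at_right (0 :: real). f (of_real x) \<in> \<real>"
  shows "f 0 \<in> \<real>"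
proof (rule Lim_in_closed_set[OF closed_complex_Reals assms(2)])
  have "isCont f 0" using assms analytic_at_imp_isCont by blast
  then have *: "(f \<longlongrightarrow> f 0) (nhds 0)" by (simp add: isCont_def tendsto_at_iff_tendsto_nhds)
  have "filterlim (\<lambda>x::real. complex_of_real x) (nhds (of_real 0)) (at_right 0)"
    by (intro tendsto_intros)
  then show "((\<lambda>x. f (complex_of_real x)) \<longlongrightarrow> f 0) (at_right 0)"
    using filterlim_compose[OF *, of "\<lambda>x. complex_of_real x" "at_right 0"] by simp
qed simp

text \<open>
  Unrolling the recurrence \<open>n\<close> times bounds \<open>d 0\<close> by the accumulated defects and the starting value \<open>d n\<close>. The
  products of the multipliers \<open>1 + a k\<close> stay below \<open>exp \<alpha>\<close>, and the starting value disappears as \<open>n \<rightarrow> \<infinity>\<close>.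
\<close>

lemma recurrence_defect_iterate:
  fixes d r e :: "nat \<Rightarrow> complex"
  assumes rec: "\<And>n. d n = r n * d (Suc n) + e n"
    and r: "\<And>n. norm (r n) \<le> 1 + a n" and a0: "\<And>n. a n \<ge> 0" and a: "\<And>n. (\<Sum>k<n. a k) \<le> \<alpha>"
    and e: "\<And>n. norm (e n) \<le> \<epsilon> n" and eps: "\<And>n. (\<Sum>k<n. \<epsilon> k) \<le> \<beta>"
    and lim: "d \<longlonglongrightarrow> 0"
  shows "norm (d 0) \<le> exp \<alpha> * \<beta>"
proof -
  have prodb: "(\<Prod>k<n. 1 + a k) \<le> exp \<alpha>" for n
  proof -
    have "(\<Prod>k<n. 1 + a k) \<le> (\<Prod>k<n. exp (a k))" using a0 by (intro prod_mono) (auto simp: add_nonneg_nonneg)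
    also have "\<dots> = exp (\<Sum>k<n. a k)" by (simp add: exp_sum)
    also have "\<dots> \<le> exp \<alpha>" using a by simp
    finally show ?thesis .
  qed
  have e0: "\<epsilon> n \<ge> 0" for n using e[of n] norm_ge_zero order_trans by blast
  have "norm (d 0) \<le> (\<Prod>k<n. 1 + a k) * norm (d n) + exp \<alpha> * (\<Sum>k<n. \<epsilon> k)" for n
  proof (induction n)
    case (Suc n)
    have "norm (d n) \<le> norm (r n) * norm (d (Suc n)) + norm (e n)"
      by (subst rec) (metis norm_mult norm_triangle_ineq)
    also have "\<dots> \<le> (1 + a n) * norm (d (Suc n)) + \<epsilon> n" using r e by (intro add_mono mult_right_mono) auto
    finally have 1: "norm (d n) \<le> (1 + a n) * norm (d (Suc n)) + \<epsilon> n" .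
    have P0: "(\<Prod>k<n. 1 + a k) \<ge> 0" using a0 by (intro prod_nonneg) (auto simp: add_nonneg_nonneg)
    have "(\<Prod>k<n. 1 + a k) * norm (d n) \<le> (\<Prod>k<n. 1 + a k) * ((1 + a n) * norm (d (Suc n)) + \<epsilon> n)"
      using 1 P0 by (rule mult_left_mono)
    also have "\<dots> \<le> (\<Prod>k<Suc n. 1 + a k) * norm (d (Suc n)) + exp \<alpha> * \<epsilon> n"
      using mult_right_mono[OF prodb[of n] e0[of n]] by (simp add: algebra_simps)
    finally show ?case using Suc.IH by (simp add: algebra_simps)
  qed simp
  then have "norm (d 0) \<le> exp \<alpha> * norm (d n) + exp \<alpha> * \<beta>" for n
  proof (rule order_trans)
    show "(\<Prod>k<n. 1 + a k) * norm (d n) + exp \<alpha> * (\<Sum>k<n. \<epsilon> k) \<le> exp \<alpha> * norm (d n) + exp \<alpha> * \<beta>"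
      by (intro add_mono mult_right_mono mult_left_mono prodb eps) auto
  qed
  moreover have "(\<lambda>n. exp \<alpha> * norm (d n) + exp \<alpha> * \<beta>) \<longlonglongrightarrow> exp \<alpha> * 0 + exp \<alpha> * \<beta>"
    by (intro tendsto_intros tendsto_norm_zero lim)
  ultimately show ?thesis
    using LIMSEQ_le_const[of "\<lambda>n. exp \<alpha> * norm (d n) + exp \<alpha> * \<beta>" "exp \<alpha> * \<beta>" "norm (d 0)"] by auto
qed

text \<open>
  Comparison with the telescoping series of \<open>1 / ((r + k) (r + k - 1))\<close>.
\<close>

lemma sum_inverse_squares_shifted:
  fixes r :: real assumes "r \<ge> 2"
  shows "(\<Sum>k<n. 1 / (r + real k)\<^sup>2) \<le> 2 / r"
proof -
  have "(\<Sum>k<n. 1 / (r + real k)\<^sup>2) \<le> 1 / (r - 1) - 1 / (r - 1 + real n)"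
  proof (induction n)
    case (Suc n)
    have p: "r + real n > 1" using assms by simp
    have "1 / (r + real n)\<^sup>2 \<le> 1 / ((r + real n) * (r + real n - 1))"
      unfolding power2_eq_square using p by (intro divide_left_mono mult_left_mono mult_pos_pos) auto
    also have "\<dots> = 1 / (r - 1 + real n) - 1 / (r - 1 + real (Suc n))"
      using p by (simp add: divide_simps)
    finally show ?case using Suc.IH by simp
  qed simp
  also have "\<dots> \<le> 1 / (r - 1)" using assms by simp
  also have "\<dots> \<le> 2 / r" using assms by (simp add: divide_simps)
  finally show ?thesis .
qed

text \<open>
  Adding positive numbers to \<open>s\<close> can bring it near the origin only if \<open>s\<close> is close to the negative real axis. The
  constant comes from the identity
  \<open>r\<^sup>2 + n\<^sup>2 - 2rn cos \<delta> = (1 - cos \<delta>)/2 (r + n)\<^sup>2 + (1 + cos \<delta>)/2 (r - n)\<^sup>2\<close>.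
\<close>

lemma norm_add_of_nat_sector:
  fixes s :: complex
  assumes "s \<noteq> 0" "\<bar>Arg s\<bar> \<le> pi - \<delta>" "0 < \<delta>" "\<delta> < pi"
  shows "norm (s + of_nat n) \<ge> sqrt ((1 - cos \<delta>) / 2) * (norm s + real n)"
proof -
  define r where "r = norm s"
  have s: "Re s = r * cos (Arg s)"
    using arg_cong[OF Arg_eq[OF assms(1)], of Re] by (simp add: r_def exp_eq_polar)
  have "cos (Arg s) \<ge> - cos \<delta>"
  proof -
    have "cos (pi - \<delta>) \<le> cos \<bar>Arg s\<bar>" using assms by (intro cos_monotone_0_pi_le) auto
    then show ?thesis by simp
  qed
  then have re: "Re s \<ge> - r * cos \<delta>" unfolding s using mult_left_mono[of "- cos \<delta>" "cos (Arg s)" r] by (simp add: r_def)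
  have "(norm (s + of_nat n))\<^sup>2 = r\<^sup>2 + (real n)\<^sup>2 + 2 * real n * Re s"
    unfolding r_def cmod_power2 by (simp add: power2_eq_square algebra_simps)
  also have "\<dots> \<ge> r\<^sup>2 + (real n)\<^sup>2 - 2 * real n * (r * cos \<delta>)"
    using mult_left_mono[OF re, of "2 * real n"] by simp
  also have "r\<^sup>2 + (real n)\<^sup>2 - 2 * real n * (r * cos \<delta>) = (1 - cos \<delta>) / 2 * (r + real n)\<^sup>2 + (1 + cos \<delta>) / 2 * (r - real n)\<^sup>2"
    by (simp add: power2_eq_square field_simps)
  finally have "(1 - cos \<delta>) / 2 * (r + real n)\<^sup>2 + (1 + cos \<delta>) / 2 * (r - real n)\<^sup>2 \<le> (norm (s + of_nat n))\<^sup>2" .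
  moreover have "(1 + cos \<delta>) / 2 * (r - real n)\<^sup>2 \<ge> 0"
    using cos_ge_minus_one[of \<delta>] by (intro mult_nonneg_nonneg divide_nonneg_nonneg) (linarith | simp)+
  ultimately have "(1 - cos \<delta>) / 2 * (r + real n)\<^sup>2 \<le> (norm (s + of_nat n))\<^sup>2" by simp
  then have "sqrt ((1 - cos \<delta>) / 2 * (r + real n)\<^sup>2) \<le> norm (s + of_nat n)"
    by (intro real_le_lsqrt) auto
  then have "sqrt ((1 - cos \<delta>) / 2) * \<bar>r + real n\<bar> \<le> norm (s + of_nat n)"
    by (simp only: real_sqrt_mult real_sqrt_abs)
  moreover have "\<bar>r + real n\<bar> = norm s + real n" by (simp add: r_def)
  ultimately show ?thesis by (simp only:)
qed

section \<open>The quotient of Gamma functions and its recurrence\<close>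

locale gamma_quotient =
  fixes w p :: nat
  assumes w1: "w \<ge> 1" and p2: "p \<ge> 2"
begin

definition "growth_base = h_par p * kappa p powr kappa p"

definition "gamma_arg s = of_real (kappa p) * s + of_real (vtheta w)" for s :: complex

definition "gamma_ratio s = Gamma (1 - of_nat w + of_nat p * s) / Gamma (1 + s)" for s :: complex

text \<open>
  Together with \<open>Gamma (gamma_arg s)\<close> this is the leading term of the inverse factorial expansion.
\<close>

definition "normaliser s = of_real (A_par w p / (2 * pi)) * of_real growth_base powr (- s)" for s :: complex

definition "scaled_ratio s = gamma_ratio s / (normaliser s * Gamma (gamma_arg s))" for s :: complex

lemma kappa_eq: "kappa p = real (p - 1)" using p2 by (simp add: kappa_def of_nat_diff)

lemma kappa_ge: "kappa p \<ge> 1" using p2 by (simp add: kappa_def)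

lemma growth_base_pos: "growth_base > 0"
  using p2 kappa_ge by (simp add: growth_base_def h_par_def)

lemma A_par_pos: "A_par w p > 0" using p2 kappa_ge by (simp add: A_par_def)

lemma ln_growth_base: "ln growth_base = kappa p * ln (kappa p) - real p * ln (real p)"
  using p2 kappa_ge by (simp add: growth_base_def h_par_def ln_mult ln_powr)

lemma normaliser_exp: "normaliser s = of_real (A_par w p / (2 * pi)) * exp (- s * of_real (ln growth_base))"
  using growth_base_pos by (simp add: normaliser_def powr_def Ln_of_real mult.commute)

lemma normaliser_nonzero: "normaliser s \<noteq> 0"
  using A_par_pos by (simp add: normaliser_exp)

text \<open>
  At these points the Gamma functions in \<open>gamma_ratio\<close> and in the leading term are finite: if \<open>s\<close> is real, it is so
  large that all their arguments are positive.
\<close>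

definition "regular_point s \<longleftrightarrow> s \<notin> \<real>\<^sub>\<le>\<^sub>0 \<and> real w + 1 < norm s" for s :: complex

lemma gamma_arg_minus_nonpole:
  assumes "regular_point s" "norm s > real w + real j"
  shows "gamma_arg s - of_nat j \<notin> \<int>\<^sub>\<le>\<^sub>0"
proof
  assume "gamma_arg s - of_nat j \<in> \<int>\<^sub>\<le>\<^sub>0"
  then have i: "kappa p * Im s = 0" and r: "kappa p * Re s + vtheta w \<le> real j"
    by (auto elim!: nonpos_Ints_cases simp: complex_eq_iff gamma_arg_def)
  have i: "Im s = 0" using i kappa_ge by simp
  then have "Re s > 0" using assms by (auto simp: regular_point_def complex_nonpos_Reals_iff)
  then have "Re s > real w + real j" using assms(2) i by (simp add: norm_complex_def)
  then have "kappa p * Re s \<ge> 1 * (real w + real j)" using kappa_ge by (intro mult_mono) auto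
  then show False using r by (simp add: vtheta_def)
qed

lemma regular_pointD:
  assumes "regular_point s"
  shows "s \<noteq> 0" "1 - of_nat w + of_nat p * s \<notin> \<int>\<^sub>\<le>\<^sub>0" "gamma_arg s \<notin> \<int>\<^sub>\<le>\<^sub>0" "1 + s \<notin> \<int>\<^sub>\<le>\<^sub>0"
proof -
  have re: "Re s > real w + 1" if "Im s = 0"
  proof -
    have "Re s > 0" using that assms by (auto simp: regular_point_def complex_nonpos_Reals_iff)
    then show ?thesis using that assms by (simp add: regular_point_def norm_complex_def)
  qed
  show "s \<noteq> 0" using assms by (auto simp: regular_point_def)
  show "1 - of_nat w + of_nat p * s \<notin> \<int>\<^sub>\<le>\<^sub>0"
  proof
    assume "1 - of_nat w + of_nat p * s \<in> \<int>\<^sub>\<le>\<^sub>0"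
    then have i: "real p * Im s = 0" and r: "1 - real w + real p * Re s \<le> 0"
      by (auto elim!: nonpos_Ints_cases simp: complex_eq_iff)
    have "Im s = 0" using i p2 by simp
    from re[OF this] have "real p * Re s \<ge> 1 * (real w + 1)" using p2 by (intro mult_mono) auto
    then show False using r by simp
  qed
  show "gamma_arg s \<notin> \<int>\<^sub>\<le>\<^sub>0"
    using gamma_arg_minus_nonpole[OF assms, of 0] assms by (simp add: regular_point_def)
  show "1 + s \<notin> \<int>\<^sub>\<le>\<^sub>0"
  proof
    assume "1 + s \<in> \<int>\<^sub>\<le>\<^sub>0"
    then have i: "Im s = 0" and r: "1 + Re s \<le> 0"
      by (auto elim!: nonpos_Ints_cases simp: complex_eq_iff)
    from re[OF i] r show False by simp
  qed
qed

text \<open>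
  Stirling's formula for the three factorials; \<open>growth_base\<close> is exactly the exponential rate of
  \<open>n! (\<kappa>n)! / (pn)!\<close>.
\<close>

lemma factorial_quotient_limit:
  "(\<lambda>n. ln (fact (p * n)) - ln (fact n) - ln (fact ((p - 1) * n)) + real n * ln growth_base + ln (real n) / 2)
     \<longlonglongrightarrow> (ln (real p) - ln (kappa p) - ln (2 * pi)) / 2"
proof -
  let ?e = stirling_error
  have sub: "(\<lambda>n. ?e (m * n)) \<longlonglongrightarrow> ln (2 * pi) / 2" if "m \<ge> 1" for m
    by (rule LIMSEQ_subseq_LIMSEQ[OF stirling_error_LIMSEQ, unfolded o_def]) (use that in \<open>auto simp: strict_mono_def\<close>)
  have "(\<lambda>n. ?e (p * n) - ?e n - ?e ((p - 1) * n) + (ln (real p) - ln (kappa p)) / 2)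
     \<longlonglongrightarrow> ln (2 * pi) / 2 - ln (2 * pi) / 2 - ln (2 * pi) / 2 + (ln (real p) - ln (kappa p)) / 2"
    by (intro tendsto_intros sub stirling_error_LIMSEQ) (use p2 in auto)
  then have "(\<lambda>n. ?e (p * n) - ?e n - ?e ((p - 1) * n) + (ln (real p) - ln (kappa p)) / 2)
     \<longlonglongrightarrow> (ln (real p) - ln (kappa p) - ln (2 * pi)) / 2" by (simp add: diff_divide_distrib)
  moreover have "\<forall>\<^sub>F n in sequentially. ?e (p * n) - ?e n - ?e ((p - 1) * n) + (ln (real p) - ln (kappa p)) / 2
     = ln (fact (p * n)) - ln (fact n) - ln (fact ((p - 1) * n)) + real n * ln growth_base + ln (real n) / 2"
    using eventually_gt_at_top[of 0]
  proof eventually_elim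
    case (elim n)
    have k: "real p = kappa p + 1" by (simp add: kappa_def)
    have r: "real (p * n) = real p * real n" "real ((p - 1) * n) = kappa p * real n" by (auto simp: kappa_eq)
    have l: "ln (real p * real n) = ln (real p) + ln (real n)" "ln (kappa p * real n) = ln (kappa p) + ln (real n)"
      using elim p2 kappa_ge by (auto simp: ln_mult)
    define lp where "lp = ln (real p)"
    show ?case unfolding stirling_error_def r l ln_growth_base lp_def[symmetric] unfolding k
      by (simp add: algebra_simps diff_divide_distrib add_divide_distrib)
  qed
  ultimately show ?thesis by (rule Lim_transform_eventually)
qed

lemma ln_A_par: "ln (A_par w p) = ln (2 * pi) / 2 + real w * ln (kappa p) + (1/2 - real w) * ln (real p)"
  using kappa_ge p2 by (simp add: A_par_def ln_mult ln_powr vtheta_def)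

text \<open>
  Each Gamma function is reduced to a factorial by Euler's limit formula, and the quotient of factorials to its
  limit. The constant \<open>A\<close> is what makes the product of all constants equal to 1.
\<close>

lemma scaled_ratio_tendsto_1:
  assumes "regular_point s"
  shows "(\<lambda>n. scaled_ratio (s + of_nat n)) \<longlonglongrightarrow> 1"
proof -
  define v where "v = 1 - of_nat w + of_nat p * s"
  define L where "L z n = Gamma (z + of_nat n) / (fact (n - 1) * exp (z * of_real (ln (real n))))" for z :: complex and n
  note reg = regular_pointD[OF assms]
  have sub: "(\<lambda>n. L z (m * n)) \<longlonglongrightarrow> 1" if "m \<ge> 1" "z \<notin> \<int>\<^sub>\<le>\<^sub>0" for m z
    using LIMSEQ_subseq_LIMSEQ[OF Gamma_shift_asymptotics[OF that(2)], of "\<lambda>n. m * n"] that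
    by (auto simp: strict_mono_def L_def o_def)
  define B where "B n = exp (complex_of_real (ln (fact (p * n)) - ln (fact n) - ln (fact ((p - 1) * n)) + real n * ln growth_base + ln (real n) / 2))" for n
  define c where "c = exp (complex_of_real (ln (kappa p) - ln (real p) + (1 - real w) * ln (real p) - vtheta w * ln (kappa p))) * (2 * of_real pi / of_real (A_par w p))"
  have "B \<longlonglongrightarrow> exp (complex_of_real ((ln (real p) - ln (kappa p) - ln (2 * pi)) / 2))"
    unfolding B_def by (intro tendsto_exp tendsto_of_real factorial_quotient_limit)
  moreover have "(\<lambda>n. L v (p * n) / (L (1 + s) (1 * n) * L (gamma_arg s) ((p - 1) * n))) \<longlonglongrightarrow> 1 / (1 * 1)"
    by (intro tendsto_intros sub) (use reg p2 in \<open>auto simp: v_def\<close>)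
  ultimately have lim: "(\<lambda>n. L v (p * n) / (L (1 + s) (1 * n) * L (gamma_arg s) ((p - 1) * n)) * B n * c)
    \<longlonglongrightarrow> 1 / (1 * 1) * exp (complex_of_real ((ln (real p) - ln (kappa p) - ln (2 * pi)) / 2)) * c"
    by (intro tendsto_mult tendsto_const)
  have one: "1 / (1 * 1) * exp (complex_of_real ((ln (real p) - ln (kappa p) - ln (2 * pi)) / 2)) * c = 1"
  proof -
    have c2: "2 * of_real pi / of_real (A_par w p) = exp (complex_of_real (ln (2 * pi) - ln (A_par w p)))"
      using A_par_pos by (simp add: exp_of_real exp_diff ln_mult exp_add)
    have sum0: "(ln (real p) - ln (kappa p) - ln (2 * pi)) / 2 + (ln (kappa p) - ln (real p) + (1 - real w) * ln (real p) - vtheta w * ln (kappa p))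
       + (ln (2 * pi) - ln (A_par w p)) = 0"
      by (simp add: ln_A_par vtheta_def field_simps)
    have comb: "exp (complex_of_real a) * (exp (complex_of_real b) * exp (complex_of_real d)) = exp (complex_of_real (a + b + d))" for a b d
      by (simp add: exp_add mult_ac)
    show ?thesis unfolding c_def c2
      by (simp only: div_by_1 mult_1_left comb sum0 of_real_0 exp_zero)
  qed
  have ev: "\<forall>\<^sub>F n in sequentially. L v (p * n) / (L (1 + s) (1 * n) * L (gamma_arg s) ((p - 1) * n)) * B n * c = scaled_ratio (s + of_nat n)"
    using eventually_gt_at_top[of 0]
  proof eventually_elim
    case (elim n)
    define P where "P m z = (fact m :: complex) / of_nat m * exp (z * of_real (ln (real m)))" for m :: nat and z :: complex
    have Pnz: "P m z \<noteq> 0" if "m > 0" for m z using that by (simp add: P_def)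
    have Pe: "P m z = exp (of_real (ln (fact m) - ln (real m)) + z * of_real (ln (real m)))" if "m > 0" for m z
    proof -
      have "exp (complex_of_real (ln (fact m) - ln (real m))) = complex_of_real (fact m / real m)"
        unfolding exp_of_real exp_diff using that by simp
      then show ?thesis by (simp add: P_def exp_add)
    qed
    have m: "p * n > 0" "1 * n > 0" "(p - 1) * n > 0" using elim p2 by auto
    have LP: "L z k = Gamma (z + of_nat k) / P k z" if "k > 0" for z k
      unfolding L_def P_def fact_pred[OF that] ..
    have g: "v + of_nat (p * n) = 1 - of_nat w + of_nat p * (s + of_nat n)"
      "1 + s + of_nat (1 * n) = 1 + (s + of_nat n)" "gamma_arg s + of_nat ((p - 1) * n) = gamma_arg (s + of_nat n)"
      using p2 by (simp_all add: v_def gamma_arg_def kappa_def of_nat_diff algebra_simps)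
    have eqP: "P (1 * n) (1 + s) * P ((p - 1) * n) (gamma_arg s) / P (p * n) v * B n * c = 1 / normaliser (s + of_nat n)"
    proof -
      define a where "a = complex_of_real (ln (fact n))"
      define b where "b = complex_of_real (ln (fact ((p - 1) * n)))"
      define d where "d = complex_of_real (ln (fact (p * n)))"
      define l where "l = complex_of_real (ln (real n))"
      define lk where "lk = complex_of_real (ln (kappa p))"
      define lp where "lp = complex_of_real (ln (real p))"
      have lr: "complex_of_real (ln (real (p * n))) = lp + l" "complex_of_real (ln (real ((p - 1) * n))) = lk + l"
        using elim p2 kappa_ge by (auto simp: ln_mult l_def lk_def lp_def kappa_eq)
      have lq: "complex_of_real (ln growth_base) = of_real (kappa p) * lk - (of_real (kappa p) + 1) * lp"
        unfolding ln_growth_base lk_def lp_def by (simp add: kappa_def)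
      have e1: "P (1 * n) (1 + s) = exp (a - l + (1 + s) * l)" using Pe[OF m(2)] by (simp add: a_def l_def)
      have e2: "P ((p - 1) * n) (gamma_arg s) = exp (b - (lk + l) + gamma_arg s * (lk + l))"
        unfolding Pe[OF m(3)] lr[symmetric] of_real_diff b_def ..
      have e3: "P (p * n) v = exp (d - (lp + l) + v * (lp + l))"
        unfolding Pe[OF m(1)] lr[symmetric] of_real_diff d_def ..
      have e4: "B n = exp (d - a - b + of_nat n * of_real (ln growth_base) + l / 2)"
        by (simp add: B_def a_def b_def d_def l_def)
      have e5: "c = exp (lk - lp + (1 - of_nat w) * lp - of_real (vtheta w) * lk) * (2 * of_real pi / of_real (A_par w p))"
        by (simp add: c_def lk_def lp_def)
      have e6: "1 / normaliser (s + of_nat n) = exp ((s + of_nat n) * of_real (ln growth_base)) * (2 * of_real pi / of_real (A_par w p))"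
        by (simp add: normaliser_exp exp_minus exp_diff exp_add ring_distribs field_simps)
      have comb: "exp A1 * exp A2 / exp A3 * exp A4 * (exp A5 * y) = exp (A1 + A2 - A3 + A4 + A5) * y" for A1 A2 A3 A4 A5 y :: complex
        by (simp add: exp_add exp_diff field_simps)
      have pk: "of_nat p = complex_of_real (kappa p) + 1" by (simp add: kappa_def)
      have "(a - l + (1 + s) * l) + (b - (lk + l) + gamma_arg s * (lk + l)) - (d - (lp + l) + v * (lp + l))
         + (d - a - b + of_nat n * of_real (ln growth_base) + l / 2) + (lk - lp + (1 - of_nat w) * lp - of_real (vtheta w) * lk)
         = (s + of_nat n) * of_real (ln growth_base)"
        unfolding lq v_def gamma_arg_def pk vtheta_def by (simp add: algebra_simps)
      then show ?thesis unfolding e1 e2 e3 e4 e5 e6 comb by simp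
    qed
    have gen: "x / P1 / (y / P2 * (z / P3)) * b * c = x / y / z * (P2 * P3 / P1 * b * c)" for x y z P1 P2 P3 b :: complex
      by (simp add: mult_ac)
    show ?case unfolding LP[OF m(1)] LP[OF m(2)] LP[OF m(3)] gen eqP unfolding g scaled_ratio_def gamma_ratio_def
      by simp
  qed
  show ?thesis using Lim_transform_eventually[OF lim ev] unfolding one .
qed

text \<open>
  The quotient \<open>scaled_ratio s / scaled_ratio (s + 1)\<close> as a rational function of \<open>x = 1/s\<close>.
\<close>

definition "step_factor x = (1 + x) * (\<Prod>i<p-1. 1 + of_real ((vtheta w + real i) / kappa p) * x)
     / (\<Prod>i<p. 1 + of_real ((1 - real w + real i) / real p) * x)" for x :: complex

text \<open>
  For \<open>x = 1/s\<close> and \<open>u = \<kappa>s + \<vartheta>\<close> this is \<open>\<Gamma>(u - j) / \<Gamma>(u) = 1 / ((u - 1) \<dots> (u - j))\<close>. In terms of \<open>x\<close> it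
  is analytic at the origin with a zero of order \<open>j\<close>.
\<close>

definition "inv_factorial j x = x ^ j / (\<Prod>i<j. of_real (kappa p) + of_real (vtheta w - real (Suc i)) * x)" for x :: complex

text \<open>
  The translation \<open>s \<mapsto> s + 1\<close> becomes \<open>x \<mapsto> x / (1 + x)\<close> for \<open>x = 1/s\<close>. A function of \<open>x\<close> whose defect
  vanishes satisfies the same recurrence as \<open>scaled_ratio\<close>.
\<close>

definition "step_defect g x = step_factor x * g (x / (1 + x)) - g x" for x :: complex and g :: "complex \<Rightarrow> complex"

lemma prod_linear_derivative:
  fixes a :: "nat \<Rightarrow> real" and n :: nat
  shows
  "((\<lambda>x :: complex. \<Prod>i<n. 1 + of_real (a i) * x) has_field_derivative of_real (\<Sum>i<n. a i)) (at 0)"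
proof (induction n)
  case (Suc n)
  have d: "((\<lambda>x :: complex. 1 + of_real (a n) * x) has_field_derivative of_real (a n)) (at 0)"
    by (auto intro!: derivative_eq_intros)
  show ?case using DERIV_mult[OF Suc.IH d] by simp
qed simp

text \<open>
  The sums of the linear coefficients in numerator and denominator agree; this is where the value
  \<open>\<vartheta> = 1/2 - w\<close> enters.
\<close>

lemma step_factor_at_0:
  "step_factor analytic_on {0}" "step_factor 0 = 1" "(step_factor has_field_derivative 0) (at 0)"
proof -
  show "step_factor analytic_on {0}" unfolding step_factor_def [abs_def]
    by (intro analytic_intros) auto
  show "step_factor 0 = 1" by (simp add: step_factor_def)
  have k: "kappa p \<ge> 1" "real (p - 1) = kappa p" "real p = kappa p + 1" using p2 by (auto simp: kappa_def of_nat_diff)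
  have g: "(\<Sum>i<n. c + real i) = real n * c + real n * (real n - 1) / 2" for n c
    by (induction n) (auto simp: field_simps)
  have s1: "(\<Sum>i<p-1. (vtheta w + real i) / kappa p) = vtheta w + (kappa p - 1) / 2"
    unfolding sum_divide_distrib[symmetric] g using k by (simp add: field_simps)
  have s2: "(\<Sum>i<p. (1 - real w + real i) / real p) = 1 - real w + kappa p / 2"
    unfolding sum_divide_distrib[symmetric] g using k(1,3) by (simp add: field_simps)
  have a: "((\<lambda>x :: complex. \<Prod>i<p-1. 1 + of_real ((vtheta w + real i) / kappa p) * x) has_field_derivative
      of_real (vtheta w + (kappa p - 1) / 2)) (at 0)"
    unfolding s1[symmetric] by (rule prod_linear_derivative)
  have b: "((\<lambda>x :: complex. \<Prod>i<p. 1 + of_real ((1 - real w + real i) / real p) * x) has_field_derivative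
      of_real (1 - real w + kappa p / 2)) (at 0)"
    unfolding s2[symmetric] by (rule prod_linear_derivative)
  have c: "((\<lambda>x. 1 + x) has_field_derivative 1) (at (0::complex))" by (auto intro!: derivative_eq_intros)
  show "(step_factor has_field_derivative 0) (at 0)"
    unfolding step_factor_def [abs_def]
    by (rule DERIV_cong[OF DERIV_divide[OF DERIV_mult[OF c a] b]]) (simp_all add: vtheta_def field_simps)
qed

lemma step_factor_quadratic:
  obtains k where "k analytic_on {0}" "\<And>x. step_factor x = 1 + x\<^sup>2 * k x"
proof -
  have a: "(\<lambda>x. step_factor x - 1) analytic_on {0}" by (intro analytic_intros step_factor_at_0)
  have d: "((\<lambda>x. step_factor x - 1) has_field_derivative 0) (at 0)"
    using DERIV_diff[OF step_factor_at_0(3) DERIV_const[of 1]] by simp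
  obtain g where g: "g analytic_on {0}" "g 0 = 0" "\<And>x. step_factor x - 1 = x * g x"
    using analytic_zero_factor[OF a _ d] step_factor_at_0(2) by auto
  obtain d where "(g has_field_derivative d) (at 0)"
    using analytic_on_imp_differentiable_at[OF g(1) singletonI] by (auto simp: field_differentiable_def)
  with g obtain h where h: "h analytic_on {0}" "\<And>x. g x = x * h x"
    using analytic_zero_factor by metis
  show ?thesis
  proof (rule that[OF h(1)])
    show "step_factor x = 1 + x\<^sup>2 * h x" for x
      using g(3)[of x] h(2)[of x] by (simp add: power2_eq_square algebra_simps)
  qed
qed

lemma scaled_ratio_step:
  assumes "regular_point s" "regular_point (s + 1)"
  shows "scaled_ratio s = step_factor (1 / s) * scaled_ratio (s + 1)"
proof -
  note r = regular_pointD[OF assms(1)]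
  define v where "v = 1 - of_nat w + of_nat p * s"
  define u where "u = gamma_arg s"
  have k: "kappa p \<ge> 1" "real (p - 1) = kappa p" using p2 by (auto simp: kappa_def of_nat_diff)
  have kn: "of_real (kappa p) \<noteq> (0::complex)" using k by simp
  have pv: "Gamma (v + of_nat p) = pochhammer v p * Gamma v"
    using pochhammer_Gamma[OF r(2), of p] r(2) by (simp add: v_def Gamma_eq_zero_iff)
  have pu: "Gamma (u + of_nat (p - 1)) = pochhammer u (p - 1) * Gamma u"
    using pochhammer_Gamma[OF r(3), of "p-1"] r(3) by (simp add: u_def Gamma_eq_zero_iff)
  have v': "1 - of_nat w + of_nat p * (s + 1) = v + of_nat p" by (simp add: v_def algebra_simps)
  have u': "gamma_arg (s + 1) = u + of_nat (p - 1)"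
    using p2 by (simp add: u_def gamma_arg_def kappa_def of_nat_diff algebra_simps)
  have G1: "Gamma (1 + (s + 1)) = (1 + s) * Gamma (1 + s)" using Gamma_plus1[OF r(4)] by (simp add: add_ac)
  have N: "normaliser (s + 1) = normaliser s / of_real (growth_base)"
    using growth_base_pos
    by (simp add: normaliser_exp exp_add exp_diff exp_minus ring_distribs exp_of_real field_simps)
  have pv2: "pochhammer v p = (of_nat p * s) ^ p * (\<Prod>i<p. 1 + of_real ((1 - real w + real i) / real p) * (1 / s))"
  proof -
    have "pochhammer v p = (\<Prod>i<p. (of_nat p * s) * (1 + of_real ((1 - real w + real i) / real p) * (1 / s)))"
      unfolding pochhammer_prod atLeast0LessThan v_def using r(1) p2 by (intro prod.cong) (auto simp: field_simps)
    then show ?thesis by (simp only: prod.distrib prod_constant card_lessThan power_mult_distrib)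
  qed
  have pu2: "pochhammer u (p - 1) = (of_real (kappa p) * s) ^ (p - 1) * (\<Prod>i<p-1. 1 + of_real ((vtheta w + real i) / kappa p) * (1 / s))"
  proof -
    have "pochhammer u (p - 1) = (\<Prod>i<p-1. (of_real (kappa p) * s) * (1 + of_real ((vtheta w + real i) / kappa p) * (1 / s)))"
      unfolding pochhammer_prod atLeast0LessThan u_def gamma_arg_def using r(1) kn by (intro prod.cong) (auto simp: field_simps)
    then show ?thesis by (simp only: prod.distrib prod_constant card_lessThan power_mult_distrib)
  qed
  have gb: "growth_base = kappa p ^ (p - 1) / real p ^ p"
  proof -
    have "real p powr (- real p) = 1 / real p ^ p" using p2 by (simp add: powr_minus_divide powr_realpow)
    moreover have "kappa p powr kappa p = kappa p ^ (p - 1)"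
      using powr_realpow[of "kappa p" "p - 1", unfolded k(2)] k(1) by simp
    ultimately show ?thesis by (simp add: growth_base_def h_par_def)
  qed
  have poch0: "pochhammer v p \<noteq> 0"
    using r(2) pochhammer_eq_0_imp_nonpos_Int[of v p] unfolding v_def by blast
  define D1 where "D1 = (\<Prod>i<p. 1 + of_real ((1 - real w + real i) / real p) * (1 / s))"
  define D2 where "D2 = (\<Prod>i<p-1. 1 + of_real ((vtheta w + real i) / kappa p) * (1 / s))"
  have D1: "D1 \<noteq> 0" using poch0 pv2 unfolding D1_def[symmetric] by (metis mult_zero_right)
  have "step_factor (1 / s) = (1 + 1 / s) * D2 / D1" by (simp add: step_factor_def D1_def D2_def)
  moreover have "pochhammer u (p - 1) * of_nat p ^ p * (1 + s) / of_real (kappa p) ^ (p - 1) / pochhammer v p = (1 + 1 / s) * D2 / D1"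
  proof -
    have "s ^ p = s * s ^ (p - 1)" using p2 by (simp add: power_eq_if)
    then show ?thesis unfolding pv2 pu2 D1_def[symmetric] D2_def[symmetric]
      using r(1) kn p2 D1 by (simp add: power_mult_distrib field_simps)
  qed
  ultimately have sf: "step_factor (1 / s) = pochhammer u (p - 1) * (1 + s) / (of_real (growth_base) * pochhammer v p)"
    using kn p2 by (simp add: gb field_simps)
  have nz: "Gamma u \<noteq> 0" "Gamma v \<noteq> 0" "Gamma (1 + s) \<noteq> 0" "pochhammer u (p - 1) \<noteq> 0" "1 + s \<noteq> 0"
    using r pochhammer_eq_0_imp_nonpos_Int[of u] by (auto simp: Gamma_eq_zero_iff u_def v_def)
  have "x / y / (n * g) = q * t / (c * r) * (r * x / (t * y) / (n / c * (q * g)))"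
    if "t \<noteq> 0" "c \<noteq> 0" "r \<noteq> 0" "q \<noteq> 0" for x y n g q t c r :: complex
    using that by (simp add: divide_simps)
  note gen = this[OF nz(5) _ poch0 nz(4)]
  show ?thesis
    unfolding scaled_ratio_def gamma_ratio_def v' u' G1 pv pu N sf v_def[symmetric] u_def[symmetric]
    by (rule gen) (use growth_base_pos in simp)
qed

lemma inv_factorial_eq:
  assumes "regular_point s" "norm s > real w + real j"
  shows "Gamma (gamma_arg s - of_nat j) = inv_factorial j (1 / s) * Gamma (gamma_arg s)"
  using assms(2)
proof (induction j)
  case (Suc j)
  note r = regular_pointD[OF assms(1)]
  let ?u = "gamma_arg s"
  have np: "?u - of_nat (Suc j) \<notin> \<int>\<^sub>\<le>\<^sub>0" by (rule gamma_arg_minus_nonpole[OF assms(1) Suc.prems])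
  then have nz: "?u - of_nat (Suc j) \<noteq> 0" by auto
  have "Gamma (?u - of_nat j) = (?u - of_nat (Suc j)) * Gamma (?u - of_nat (Suc j))"
    using Gamma_plus1[OF np] by simp
  then have "Gamma (?u - of_nat (Suc j)) = inv_factorial j (1 / s) * Gamma ?u / (?u - of_nat (Suc j))"
    using Suc nz by (simp add: field_simps)
  moreover have "inv_factorial (Suc j) (1 / s) = inv_factorial j (1 / s) / (?u - of_nat (Suc j))"
  proof -
    have "of_real (kappa p) + of_real (vtheta w - real (Suc j)) * (1 / s) = (?u - of_nat (Suc j)) / s"
      using r(1) by (simp add: gamma_arg_def field_simps)
    then show ?thesis unfolding inv_factorial_def prod.lessThan_Suc power_Suc using r(1) nz
      by (simp only:) simp
  qed
  ultimately show ?case by simp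
qed (simp add: inv_factorial_def)

lemma inv_factorial_analytic: "inv_factorial j analytic_on {0}"
  unfolding inv_factorial_def [abs_def] using p2 by (intro analytic_intros) (auto simp: kappa_def)

text \<open>
  The first term \<open>x\<^sup>M\<close> of the defect cancels, and the next one comes from \<open>(1 + x)\<^bsup>-M\<^esup> = 1 - Mx + \<dots>\<close>.
  Its coefficient is a nonzero real number, so a multiple of \<open>inv_factorial M\<close> can cancel any real term of order
  \<open>M + 1\<close> in the defect of the earlier terms.
\<close>

lemma inv_factorial_step:
  assumes "M \<ge> 1"
  obtains \<xi> where "\<xi> analytic_on {0}" "\<xi> 0 \<noteq> 0" "\<xi> 0 \<in> \<real>"
     "\<forall>\<^sub>F x in nhds 0. step_defect (inv_factorial M) x = x ^ (M + 1) * \<xi> x"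
proof -
  define \<eta> where "\<eta> x = 1 / (\<Prod>i<M. of_real (kappa p) + of_real (vtheta w - real (Suc i)) * x)" for x :: complex
  have k0: "kappa p \<noteq> 0" using p2 by (auto simp: kappa_def)
  have inv: "inv_factorial M x = x ^ M * \<eta> x" for x by (simp add: inv_factorial_def \<eta>_def)
  have ea: "\<eta> analytic_on {0}" unfolding \<eta>_def [abs_def] using k0 by (intro analytic_intros) auto
  have e0: "\<eta> 0 = 1 / of_real (kappa p) ^ M" by (simp add: \<eta>_def)
  have "\<eta> field_differentiable (at 0)" using ea analytic_on_imp_differentiable_at by blast
  then obtain e' where e': "(\<eta> has_field_derivative e') (at 0)" by (auto simp: field_differentiable_def)
  define \<phi> where "\<phi> x = step_factor x * ((1 / (1 + x)) ^ M * \<eta> (x / (1 + x))) - \<eta> x" for x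
  have pa: "\<phi> analytic_on {0}" unfolding \<phi>_def [abs_def]
  proof (intro analytic_intros)
    show "step_factor analytic_on {0}" by (rule step_factor_at_0)
    show "\<eta> analytic_on {0}" by (rule ea)
    have "(\<eta> \<circ> (\<lambda>x. x / (1 + x))) analytic_on {0}"
      by (rule analytic_on_compose) (auto intro!: analytic_intros simp: ea)
    then show "(\<lambda>x. \<eta> (x / (1 + x))) analytic_on {0}" by (simp add: o_def)
  qed auto
  have p0: "\<phi> 0 = 0" by (simp add: \<phi>_def step_factor_at_0)
  have "((\<lambda>x. x / (1 + x)) has_field_derivative 1) (at (0 :: complex))"
    by (auto intro!: derivative_eq_intros)
  from DERIV_chain2[OF _ this, of \<eta> e'] e' have c: "((\<lambda>x. \<eta> (x / (1 + x))) has_field_derivative e') (at 0)" by simp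
  have b: "((\<lambda>x. (1 / (1 + x)) ^ M) has_field_derivative - of_nat M) (at (0::complex))"
    by (auto intro!: derivative_eq_intros)
  have dp: "(\<phi> has_field_derivative - of_nat M * \<eta> 0) (at 0)"
    unfolding \<phi>_def [abs_def]
    using DERIV_diff[OF DERIV_mult[OF step_factor_at_0(3) DERIV_mult[OF b c]] e']
    by (simp add: step_factor_at_0)
  obtain \<xi> where xi: "\<xi> analytic_on {0}" "\<xi> 0 = - of_nat M * \<eta> 0" "\<And>x. \<phi> x = x * \<xi> x"
    using analytic_zero_factor[OF pa p0 dp] by blast
  show ?thesis
  proof (rule that[OF xi(1)])
    show "\<xi> 0 \<noteq> 0" using assms k0 by (simp add: xi e0)
    show "\<xi> 0 \<in> \<real>" unfolding xi e0 by (intro Reals_mult Reals_minus Reals_divide Reals_power) auto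
    have "step_defect (inv_factorial M) x = x ^ (M + 1) * \<xi> x" for x
    proof -
      have "step_defect (inv_factorial M) x = x ^ M * \<phi> x"
        by (simp add: step_defect_def inv \<phi>_def power_divide algebra_simps)
      then show ?thesis by (simp add: xi(3))
    qed
    then show "\<forall>\<^sub>F x in nhds 0. step_defect (inv_factorial M) x = x ^ (M + 1) * \<xi> x" by simp
  qed
qed

definition "expansion_upto b M x = (\<Sum>j<M. of_real (b j) * inv_factorial j x)" for b :: "nat \<Rightarrow> real" and x :: complex

lemma step_defect_real: "x \<in> \<real> \<Longrightarrow> step_defect (expansion_upto b M) x \<in> \<real>"
proof -
  have i: "inv_factorial j x \<in> \<real>" if "x \<in> \<real>" for x j
    unfolding inv_factorial_def using that by (intro Reals_divide Reals_power prod_in_Reals Reals_add Reals_mult) auto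
  have e: "expansion_upto b M x \<in> \<real>" if "x \<in> \<real>" for x
    unfolding expansion_upto_def using that by (intro sum_in_Reals Reals_mult i) auto
  assume x: "x \<in> \<real>"
  then have "x / (1 + x) \<in> \<real>" by (intro Reals_divide Reals_add) auto
  moreover have "step_factor x \<in> \<real>" unfolding step_factor_def using x
    by (intro Reals_divide Reals_mult prod_in_Reals Reals_add) auto
  ultimately show ?thesis unfolding step_defect_def using x e by (intro Reals_diff Reals_mult)
qed

text \<open>
  The order \<open>n + 2\<close> is one more than the \<open>n + 1\<close> terms of the sum would suggest. The surplus is needed because
  summing the defects along \<open>s, s + 1, ...\<close> loses one power of \<open>s\<close>.
\<close>

definition "good_coeffs b n \<longleftrightarrow> b 0 = 1 \<and> (\<exists>h. h analytic_on {0} \<and> (\<forall>\<^sub>F x in nhds 0. step_defect (expansion_upto b (Suc n)) x = x ^ (n + 2) * h x))"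
  for b :: "nat \<Rightarrow> real" and n

lemma good_coeffs_extend:
  assumes "good_coeffs b n"
  shows "\<exists>b'. good_coeffs b' (Suc n) \<and> (\<forall>j\<le>n. b' j = b j)"
proof -
  obtain h where h: "h analytic_on {0}" "\<forall>\<^sub>F x in nhds 0. step_defect (expansion_upto b (Suc n)) x = x ^ (n + 2) * h x"
    using assms by (auto simp: good_coeffs_def)
  obtain \<xi> where xi: "\<xi> analytic_on {0}" "\<xi> 0 \<noteq> 0" "\<xi> 0 \<in> \<real>"
     "\<forall>\<^sub>F x in nhds 0. step_defect (inv_factorial (Suc n)) x = x ^ (Suc n + 1) * \<xi> x"
    using inv_factorial_step[of "Suc n"] by auto
  have "h 0 \<in> \<real>"
  proof (rule analytic_germ_real_at_0[OF h(1)])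
    have "filterlim (\<lambda>x::real. complex_of_real x) (nhds (of_real 0)) (at_right 0)"
      by (intro tendsto_intros)
    then have "\<forall>\<^sub>F x in at_right (0::real). step_defect (expansion_upto b (Suc n)) (of_real x) = of_real x ^ (n + 2) * h (of_real x)"
      using h(2) by (auto dest: eventually_compose_filterlim)
    then show "\<forall>\<^sub>F x in at_right (0::real). h (of_real x) \<in> \<real>"
      using eventually_at_right_less[of 0]
    proof eventually_elim
      case (elim x)
      have "h (of_real x) = step_defect (expansion_upto b (Suc n)) (of_real x) / of_real x ^ (n + 2)"
        using elim by simp
      also have "\<dots> \<in> \<real>" by (intro Reals_divide step_defect_real Reals_power) auto
      finally show ?case .
    qed
  qed
  then have "- h 0 / \<xi> 0 \<in> \<real>" using xi(3) by (intro Reals_divide Reals_minus)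
  \<comment> \<open>the coefficient for which the terms of order \<open>n + 2\<close> of the two defects cancel\<close>
  then obtain \<beta> where beta: "- h 0 / \<xi> 0 = of_real \<beta>" by (auto elim: Reals_cases)
  define b' where "b' = b(Suc n := \<beta>)"
  define \<phi> where "\<phi> x = h x + of_real \<beta> * \<xi> x" for x
  have "\<phi> analytic_on {0}" unfolding \<phi>_def [abs_def] using h xi by (intro analytic_intros)
  moreover have "\<phi> 0 = 0" using xi(2) by (simp add: \<phi>_def beta[symmetric])
  moreover obtain d where "(\<phi> has_field_derivative d) (at 0)"
    using analytic_on_imp_differentiable_at[OF calculation(1) singletonI] by (auto simp: field_differentiable_def)
  ultimately obtain h' where h': "h' analytic_on {0}" "\<And>x. \<phi> x = x * h' x"
    using analytic_zero_factor by metis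
  have "\<forall>\<^sub>F x in nhds 0. step_defect (expansion_upto b' (Suc (Suc n))) x = x ^ (Suc n + 2) * h' x"
    using h(2) xi(4)
  proof eventually_elim
    case (elim x)
    have e: "expansion_upto b' (Suc (Suc n)) y = expansion_upto b (Suc n) y + of_real \<beta> * inv_factorial (Suc n) y" for y
      by (simp add: expansion_upto_def b'_def)
    have "step_defect (expansion_upto b' (Suc (Suc n))) x = step_defect (expansion_upto b (Suc n)) x + of_real \<beta> * step_defect (inv_factorial (Suc n)) x"
      by (simp add: step_defect_def e algebra_simps)
    also have "\<dots> = x ^ (n + 2) * \<phi> x" unfolding elim by (simp add: \<phi>_def algebra_simps)
    finally show ?case by (simp add: h')
  qed
  moreover have "b' 0 = 1" using assms by (simp add: good_coeffs_def b'_def)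
  ultimately have "good_coeffs b' (Suc n)" using h'(1) unfolding good_coeffs_def by blast
  then show ?thesis by (intro exI[of _ b']) (auto simp: b'_def)
qed

lemma good_coeffs_cong: "(\<And>j. j \<le> n \<Longrightarrow> b j = b' j) \<Longrightarrow> good_coeffs b n \<Longrightarrow> good_coeffs b' n"
proof -
  assume a: "\<And>j. j \<le> n \<Longrightarrow> b j = b' j"
  have "expansion_upto b (Suc n) = expansion_upto b' (Suc n)"
    unfolding expansion_upto_def by (intro ext sum.cong) (auto simp: a)
  moreover have "b 0 = b' 0" using a by simp
  moreover assume "good_coeffs b n"
  ultimately show ?thesis by (simp add: good_coeffs_def)
qed

text \<open>
  The recursion never changes a coefficient once it is chosen, so the diagonal of the chosen sequences works for every order.
\<close>

lemma good_coeffs_exist: "\<exists>b. \<forall>n. good_coeffs b n"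
proof -
  have base: "good_coeffs (\<lambda>_. 1) 0"
  proof -
    obtain k where k: "k analytic_on {0}" "\<And>x. step_factor x = 1 + x\<^sup>2 * k x" using step_factor_quadratic by blast
    have "step_defect (expansion_upto (\<lambda>_. 1) (Suc 0)) x = x ^ (0 + 2) * k x" for x
      by (simp add: k(2) step_defect_def expansion_upto_def inv_factorial_def power2_eq_square)
    then show ?thesis unfolding good_coeffs_def using k(1) by auto
  qed
  obtain f where f: "\<And>n. good_coeffs (f n) n" "\<And>n. \<forall>j\<le>n. f (Suc n) j = f n j"
    using dependent_nat_choice[of "\<lambda>n b. good_coeffs b n" "\<lambda>n b b'. \<forall>j\<le>n. b' j = b j"] base good_coeffs_extend by metis
  have st: "f n j = f j j" if "j \<le> n" for n j
    using that by (induction n rule: dec_induct) (use f(2) in auto)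
  have "good_coeffs (\<lambda>j. f j j) n" for n
    by (rule good_coeffs_cong[OF _ f(1)[of n]]) (rule st)
  then show ?thesis by (intro exI[of _ "\<lambda>j. f j j"]) simp
qed

section \<open>The inverse factorial expansion\<close>

lemma inv_factorial_0: "inv_factorial j 0 = (if j = 0 then 1 else 0)"
  by (simp add: inv_factorial_def)

lemma expansion_upto_analytic: "expansion_upto b M analytic_on {0}"
  unfolding expansion_upto_def [abs_def] by (intro analytic_intros inv_factorial_analytic)

text \<open>
  The error satisfies the recurrence of \<open>scaled_ratio\<close> up to the defect of the partial sum, so it is bounded by
  iteration along \<open>s + m\<close>. The error tends to 0 there because both functions tend to 1.
\<close>

lemma scaled_ratio_expansion:
  assumes b: "good_coeffs b n" and \<delta>: "0 < \<delta>" "\<delta> < pi"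
  obtains C S where "\<And>s. \<bar>Arg s\<bar> \<le> pi - \<delta> \<Longrightarrow> norm s \<ge> S \<Longrightarrow>
     norm (scaled_ratio s - expansion_upto b (Suc n) (1 / s)) \<le> C / norm s ^ Suc n"
proof -
  obtain h where h: "h analytic_on {0}" "\<forall>\<^sub>F x in nhds 0. step_defect (expansion_upto b (Suc n)) x = x ^ (n + 2) * h x" and b0: "b 0 = 1"
    using b by (auto simp: good_coeffs_def)
  obtain e1 where e1: "e1 > 0" "\<And>x. norm x < e1 \<Longrightarrow> step_defect (expansion_upto b (Suc n)) x = x ^ (n + 2) * h x"
    using h(2) unfolding eventually_nhds_metric by (auto simp: dist_norm)
  obtain K1 e2 where K1: "K1 > 0" "e2 > 0" "\<And>x. norm x < e2 \<Longrightarrow> norm (h x) \<le> K1"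
    using analytic_germ_bounded[OF h(1)] by blast
  obtain k where k: "k analytic_on {0}" "\<And>x. step_factor x = 1 + x\<^sup>2 * k x" using step_factor_quadratic by blast
  obtain K2 e3 where K2: "K2 > 0" "e3 > 0" "\<And>x. norm x < e3 \<Longrightarrow> norm (k x) \<le> K2"
    using analytic_germ_bounded[OF k(1)] by blast
  define e where "e = min e1 (min e2 e3)"
  have e: "e > 0" using e1 K1 K2 by (simp add: e_def)
  define c where "c = sqrt ((1 - cos \<delta>) / 2)"
  have "cos \<delta> < 1" using \<delta> cos_monotone_0_pi[of 0 \<delta>] by simp
  then have c: "c > 0" by (simp add: c_def)
  \<comment> \<open>for \<open>|s| \<ge> S\<close> every \<open>s + m\<close> is a regular point and \<open>1 / (s + m)\<close> lies in the disc where the germs are controlled\<close>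
  define S where "S = max 2 ((real w + 2 + 1 / e) / c)"
  define C where "C = exp (K2 / c\<^sup>2) * (2 * K1 / c ^ (n + 2))"
  have main: "norm (scaled_ratio s - expansion_upto b (Suc n) (1 / s)) \<le> C / norm s ^ Suc n"
    if s: "\<bar>Arg s\<bar> \<le> pi - \<delta>" "norm s \<ge> S" for s
  proof -
    define r where "r = norm s"
    have r2: "r \<ge> 2" using s(2) by (simp add: S_def r_def)
    have s0: "s \<noteq> 0" using r2 by (auto simp: r_def)
    have "(real w + 2 + 1 / e) / c \<le> r" using s(2) by (simp add: S_def r_def)
    then have cr: "real w + 2 + 1 / e \<le> c * r" using c by (simp add: field_simps)
    have low: "norm (s + of_nat m) \<ge> c * (r + real m)" for m
      unfolding c_def r_def by (rule norm_add_of_nat_sector[OF s0 s(1) \<delta>])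
    have low2: "norm (s + of_nat m) \<ge> real w + 2 + 1 / e" for m
    proof -
      have "c * r \<le> c * (r + real m)" using c by (intro mult_left_mono) auto
      then show ?thesis using low[of m] cr by linarith
    qed
    have nr: "s \<notin> \<real>\<^sub>\<le>\<^sub>0"
    proof
      assume "s \<in> \<real>\<^sub>\<le>\<^sub>0"
      then have "Arg s = pi" using s0 by (auto simp: complex_nonpos_Reals_iff complex_eq_iff Arg_eq_pi)
      then show False using s(1) \<delta> by simp
    qed
    have reg: "regular_point (s + of_nat m)" for m
    proof -
      have "1 / e > 0" using e by simp
      then have "norm (s + of_nat m) > real w + 1" using low2[of m] by linarith
      moreover have "s + of_nat m \<notin> \<real>\<^sub>\<le>\<^sub>0" using nr by (auto simp: complex_nonpos_Reals_iff)
      ultimately show ?thesis by (simp add: regular_point_def)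
    qed
    have inve: "norm (1 / (s + of_nat m)) < e" for m
    proof -
      have "1 / e < norm (s + of_nat m)" using low2[of m] by (smt (verit) of_nat_0_le_iff)
      moreover have "0 < norm (s + of_nat m)" using low2[of m] e by (smt (verit) of_nat_0_le_iff divide_pos_pos)
      ultimately show ?thesis using e by (simp add: norm_divide field_simps)
    qed
    have inv: "norm (1 / (s + of_nat m)) \<le> 1 / (c * (r + real m))" for m
    proof -
      have "c * (r + real m) > 0" using c r2 by (intro mult_pos_pos) auto
      then show ?thesis using low[of m] by (simp add: norm_divide frac_le)
    qed
    define d where "d m = scaled_ratio (s + of_nat m) - expansion_upto b (Suc n) (1 / (s + of_nat m))" for m
    have "norm (d 0) \<le> exp (K2 / c\<^sup>2) * (2 * K1 / c ^ (n + 2) / r ^ Suc n)"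
    proof (rule recurrence_defect_iterate[where r = "\<lambda>m. step_factor (1 / (s + of_nat m))"
         and e = "\<lambda>m. step_defect (expansion_upto b (Suc n)) (1 / (s + of_nat m))"
         and a = "\<lambda>m. K2 / c\<^sup>2 * (1 / (r + real m)\<^sup>2)" and \<epsilon> = "\<lambda>m. K1 / c ^ (n + 2) / r ^ n * (1 / (r + real m)\<^sup>2)"])
      fix m
      let ?x = "1 / (s + of_nat m)"
      have nz: "s + of_nat m \<noteq> 0" using regular_pointD(1)[OF reg] .
      have nz1: "s + of_nat m + 1 \<noteq> 0" using regular_pointD(1)[OF reg[of "Suc m"]] by (simp add: add_ac)
      have sh: "?x / (1 + ?x) = 1 / (s + of_nat (Suc m))" using nz nz1 by (simp add: field_simps)
      have "scaled_ratio (s + of_nat m) = step_factor ?x * scaled_ratio (s + of_nat (Suc m))"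
        using scaled_ratio_step[OF reg[of m]] reg[of "Suc m"] by (simp add: add_ac)
      then show "d m = step_factor ?x * d (Suc m) + step_defect (expansion_upto b (Suc n)) ?x"
        unfolding d_def step_defect_def sh by (simp add: algebra_simps)
      have x3: "norm ?x < e1" "norm ?x < e2" "norm ?x < e3" using inve[of m] by (auto simp: e_def)
      have pw: "norm ?x ^ q \<le> 1 / (c ^ q * (r + real m) ^ q)" for q
        using power_mono[OF inv[of m], of q] by (simp add: power_divide power_mult_distrib)
      have "norm (step_factor ?x) \<le> 1 + norm ?x ^ 2 * norm (k ?x)"
        unfolding k(2) using norm_triangle_ineq[of 1 "?x\<^sup>2 * k ?x"] by (simp add: norm_mult norm_power)
      also have "\<dots> \<le> 1 + 1 / (c ^ 2 * (r + real m) ^ 2) * K2"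
        using K2(3)[OF x3(3)] pw[of 2] by (intro add_left_mono mult_mono) auto
      finally show "norm (step_factor ?x) \<le> 1 + K2 / c\<^sup>2 * (1 / (r + real m)\<^sup>2)" by (simp add: field_simps)
      show "0 \<le> K2 / c\<^sup>2 * (1 / (r + real m)\<^sup>2)" using K2(1) by simp
      have "norm (step_defect (expansion_upto b (Suc n)) ?x) = norm ?x ^ (n + 2) * norm (h ?x)"
        by (simp only: e1(2)[OF x3(1)] norm_mult norm_power)
      also have "\<dots> \<le> 1 / (c ^ (n + 2) * (r + real m) ^ (n + 2)) * K1"
        using K1(3)[OF x3(2)] pw[of "n + 2"] c r2 by (intro mult_mono divide_nonneg_nonneg mult_nonneg_nonneg zero_le_power) auto
      also have "\<dots> = K1 / c ^ (n + 2) / (r + real m) ^ n * (1 / (r + real m)\<^sup>2)"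
        by (simp add: power_add power2_eq_square)
      also have "\<dots> \<le> K1 / c ^ (n + 2) / r ^ n * (1 / (r + real m)\<^sup>2)"
        using K1(1) c r2 by (intro mult_right_mono divide_left_mono power_mono mult_pos_pos zero_less_power) auto
      finally show "norm (step_defect (expansion_upto b (Suc n)) ?x) \<le> K1 / c ^ (n + 2) / r ^ n * (1 / (r + real m)\<^sup>2)" .
      have S: "(\<Sum>m'<m. 1 / (r + real m')\<^sup>2) \<le> 2 / r" by (rule sum_inverse_squares_shifted[OF r2])
      have "(\<Sum>m'<m. K2 / c\<^sup>2 * (1 / (r + real m')\<^sup>2)) \<le> K2 / c\<^sup>2 * (2 / r)"
        unfolding sum_distrib_left[symmetric] using S K2(1) by (intro mult_left_mono) auto
      also have "\<dots> \<le> K2 / c\<^sup>2 * 1" using K2(1) r2 by (intro mult_left_mono) auto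
      finally show "(\<Sum>m'<m. K2 / c\<^sup>2 * (1 / (r + real m')\<^sup>2)) \<le> K2 / c\<^sup>2" by simp
      have "(\<Sum>m'<m. K1 / c ^ (n + 2) / r ^ n * (1 / (r + real m')\<^sup>2)) \<le> K1 / c ^ (n + 2) / r ^ n * (2 / r)"
        unfolding sum_distrib_left[symmetric] using S K1(1) c r2 by (intro mult_left_mono) auto
      then show "(\<Sum>m'<m. K1 / c ^ (n + 2) / r ^ n * (1 / (r + real m')\<^sup>2)) \<le> 2 * K1 / c ^ (n + 2) / r ^ Suc n"
        by (simp add: mult.commute)
    next
      have inf: "filterlim (\<lambda>m. s + of_nat m :: complex) at_infinity sequentially"
        by (intro tendsto_add_filterlim_at_infinity[OF tendsto_const] tendsto_of_nat)
      have "(\<lambda>m. 1 / (s + of_nat m)) \<longlonglongrightarrow> 0" by (rule tendsto_divide_0[OF tendsto_const inf])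
      moreover have "isCont (expansion_upto b (Suc n)) 0"
        using expansion_upto_analytic analytic_at_imp_isCont by blast
      ultimately have "(\<lambda>m. expansion_upto b (Suc n) (1 / (s + of_nat m))) \<longlonglongrightarrow> expansion_upto b (Suc n) 0"
        by (intro isCont_tendsto_compose[where g = "expansion_upto b (Suc n)"])
      moreover have "expansion_upto b (Suc n) 0 = 1"
        using b0 by (simp add: expansion_upto_def inv_factorial_0 sum.delta' if_distrib[of "\<lambda>x. _ * x"] cong: if_cong)
      moreover have "(\<lambda>m. scaled_ratio (s + of_nat m)) \<longlonglongrightarrow> 1"
        using scaled_ratio_tendsto_1[of s] reg[of 0] by simp
      ultimately show "d \<longlonglongrightarrow> 0" unfolding d_def [abs_def]
        using tendsto_diff[of "\<lambda>m. scaled_ratio (s + of_nat m)" 1 sequentially "\<lambda>m. expansion_upto b (Suc n) (1 / (s + of_nat m))" 1] by simp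
    qed
    then show ?thesis by (simp add: d_def C_def r_def)
  qed
  show ?thesis by (rule that[OF main])
qed

abbreviation gamma_sum :: "(nat \<Rightarrow> real) \<Rightarrow> nat \<Rightarrow> complex \<Rightarrow> complex" where
  "gamma_sum c M s \<equiv> (\<Sum>j<M. (-1) ^ j * of_real (c j) * Gamma (gamma_arg s - of_nat j))"

text \<open>
  The remainder is obtained by solving the required identity, which is possible because \<open>\<Gamma>\<close> has no zeros. Its
  boundedness is the previous estimate divided by \<open>inv_factorial M (1/s)\<close>.
\<close>

lemma inverse_factorial_expansion_good_coeffs:
  assumes b: "good_coeffs b n"
  shows "inverse_factorial_expansion w p (\<lambda>j. (-1) ^ j * b j) (Suc n)"
proof -
  let ?M = "Suc n"
  define c where "c j = (-1) ^ j * b j" for j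
  have cb: "(-1) ^ j * complex_of_real (c j) = of_real (b j)" for j
    by (simp add: c_def mult.assoc[symmetric] flip: power_mult_distrib)
  define \<rho> where "\<rho> s = (gamma_ratio s / normaliser s - gamma_sum c ?M s)
     / Gamma (gamma_arg s - of_nat ?M)" for s
  have 1: "gamma_ratio s = normaliser s * (gamma_sum c ?M s + \<rho> s * Gamma (gamma_arg s - of_nat ?M))"
    if "gamma_arg s - of_nat ?M \<notin> \<int>\<^sub>\<le>\<^sub>0" for s
  proof -
    have "Gamma (gamma_arg s - of_nat ?M) \<noteq> 0" using that by (simp only: Gamma_eq_zero_iff not_False_eq_True)
    then have "\<rho> s * Gamma (gamma_arg s - of_nat ?M) = gamma_ratio s / normaliser s - gamma_sum c ?M s"
      by (simp only: \<rho>_def times_divide_eq_left nonzero_mult_div_cancel_right not_False_eq_True)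
    then show ?thesis using normaliser_nonzero[of s] by simp
  qed
  have 2: "\<rho> \<in> O[inf at_infinity (principal {s. \<bar>Arg s\<bar> \<le> pi - \<delta>})](\<lambda>_. 1)" if d: "\<delta> \<in> {0<..<pi}" for \<delta>
  proof -
    have dd: "0 < \<delta>" "\<delta> < pi" using d by auto
    obtain C S where CS: "\<And>s. \<bar>Arg s\<bar> \<le> pi - \<delta> \<Longrightarrow> norm s \<ge> S \<Longrightarrow>
       norm (scaled_ratio s - expansion_upto b ?M (1 / s)) \<le> C / norm s ^ ?M"
      using scaled_ratio_expansion[OF b dd] by blast
    define P where "P = (\<Prod>i<?M. kappa p + \<bar>vtheta w - real (Suc i)\<bar>)"
    have P0: "P \<ge> 0" unfolding P_def using kappa_ge by (intro prod_nonneg) auto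
    have bd: "norm (\<rho> s) \<le> (\<bar>C\<bar> * P) * norm (1 :: complex)" if s: "\<bar>Arg s\<bar> \<le> pi - \<delta>" "norm s \<ge> max S (real w + real ?M + 2)" for s
    proof -
      have sn: "norm s > real w + real ?M" "norm s \<ge> 1" "norm s > real w + 1" using s(2) by linarith+
      then have s0: "s \<noteq> 0" by auto
      have nr: "s \<notin> \<real>\<^sub>\<le>\<^sub>0"
      proof
        assume "s \<in> \<real>\<^sub>\<le>\<^sub>0"
        then have "Arg s = pi" using s0 by (auto simp: complex_nonpos_Reals_iff complex_eq_iff Arg_eq_pi)
        then show False using s(1) d by simp
      qed
      have reg: "regular_point s" using nr sn by (simp add: regular_point_def)
      have G: "Gamma (gamma_arg s) \<noteq> 0" using regular_pointD(3)[OF reg] by (simp add: Gamma_eq_zero_iff)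
      have "gamma_ratio s / normaliser s = scaled_ratio s * Gamma (gamma_arg s)"
        using G by (simp add: scaled_ratio_def)
      moreover have "gamma_sum c ?M s = expansion_upto b ?M (1 / s) * Gamma (gamma_arg s)"
        unfolding expansion_upto_def sum_distrib_right cb
        by (intro sum.cong refl) (use sn in \<open>subst inv_factorial_eq[OF reg]; simp\<close>)
      moreover have "Gamma (gamma_arg s - of_nat ?M) = inv_factorial ?M (1 / s) * Gamma (gamma_arg s)"
        by (rule inv_factorial_eq[OF reg sn(1)])
      ultimately have rho: "\<rho> s = (scaled_ratio s - expansion_upto b ?M (1 / s)) / inv_factorial ?M (1 / s)"
        unfolding \<rho>_def using G by (simp only: left_diff_distrib[symmetric]) (rule nonzero_mult_divide_mult_cancel_right)
      have "norm (1 / inv_factorial ?M (1 / s)) = norm s ^ ?M * (\<Prod>i<?M. norm (of_real (kappa p) + of_real (vtheta w - real (Suc i)) * (1 / s)))"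
        unfolding inv_factorial_def by (simp only: norm_divide prod_norm norm_power norm_mult norm_one power_one_over) (simp add: field_simps)
      also have "\<dots> \<le> norm s ^ ?M * P"
      proof (intro mult_left_mono)
        show "(\<Prod>i<?M. norm (of_real (kappa p) + of_real (vtheta w - real (Suc i)) * (1 / s))) \<le> P"
          unfolding P_def
        proof (rule prod_mono, intro conjI)
          fix i
          have "norm (of_real (kappa p) + of_real (vtheta w - real (Suc i)) * (1 / s)) \<le> norm (complex_of_real (kappa p)) + norm (of_real (vtheta w - real (Suc i)) * (1 / s))"
            by (rule norm_triangle_ineq)
          also have "norm (of_real (vtheta w - real (Suc i)) * (1 / s)) = \<bar>vtheta w - real (Suc i)\<bar> / norm s"
            by (simp only: norm_mult norm_of_real norm_divide norm_one) simp
          also have "\<dots> \<le> \<bar>vtheta w - real (Suc i)\<bar> / 1" using sn by (intro divide_left_mono) auto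
          finally show "norm (of_real (kappa p) + of_real (vtheta w - real (Suc i)) * (1 / s)) \<le> kappa p + \<bar>vtheta w - real (Suc i)\<bar>"
            using kappa_ge by simp
        qed simp
      qed simp
      finally have I: "norm (1 / inv_factorial ?M (1 / s)) \<le> norm s ^ ?M * P" .
      have "norm (\<rho> s) = norm (scaled_ratio s - expansion_upto b ?M (1 / s)) * norm (1 / inv_factorial ?M (1 / s))"
        unfolding rho by (simp only: norm_divide norm_one) simp
      also have "\<dots> \<le> (\<bar>C\<bar> / norm s ^ ?M) * (norm s ^ ?M * P)"
      proof (intro mult_mono I)
        have "norm (scaled_ratio s - expansion_upto b ?M (1 / s)) \<le> C / norm s ^ ?M" using s by (intro CS) auto
        also have "\<dots> \<le> \<bar>C\<bar> / norm s ^ ?M" by (intro divide_right_mono) auto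
        finally show "norm (scaled_ratio s - expansion_upto b ?M (1 / s)) \<le> \<bar>C\<bar> / norm s ^ ?M" .
      qed auto
      also have "\<dots> = \<bar>C\<bar> * P" using s0 by simp
      finally show ?thesis by simp
    qed
    show ?thesis
      by (rule bigoI[where c = "\<bar>C\<bar> * P"])
         (use bd in \<open>auto simp: eventually_inf_principal eventually_at_infinity intro!: exI[of _ "max S (real w + real ?M + 2)"]\<close>)
  qed
  show ?thesis
    unfolding inverse_factorial_expansion_def c_def[symmetric]
    using 1 2 unfolding gamma_ratio_def normaliser_def growth_base_def gamma_arg_def
    by (intro exI[of _ \<rho>] conjI) auto
qed

lemma Arg_half_plane: "Re s > 0 \<Longrightarrow> \<bar>Arg s\<bar> \<le> pi - pi / 2"
  using Arg_Re_pos[of s] by simp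

text \<open>
  The right half-plane is the case \<open>\<delta> = \<pi>/2\<close>; it contains all the lines of integration.
\<close>

lemma inverse_factorial_expansion_half_plane:
  assumes "inverse_factorial_expansion w p c M"
  obtains B S where "\<And>s. Re s > 0 \<Longrightarrow> norm s \<ge> S \<Longrightarrow>
     \<exists>q. norm q \<le> B \<and> gamma_ratio s = normaliser s * (gamma_sum c M s + q * Gamma (gamma_arg s - of_nat M))"
proof -
  obtain \<rho> where eq: "\<And>s. s \<noteq> 0 \<and> \<bar>Arg s\<bar> < pi \<and> 1 - of_nat w + of_nat p * s \<notin> \<int>\<^sub>\<le>\<^sub>0 \<and> gamma_arg s - of_nat M \<notin> \<int>\<^sub>\<le>\<^sub>0 \<Longrightarrow>
       gamma_ratio s = normaliser s * (gamma_sum c M s + \<rho> s * Gamma (gamma_arg s - of_nat M))"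
     and O: "\<And>\<delta>. \<delta>\<in>{0<..<pi} \<Longrightarrow> \<rho> \<in> O[inf at_infinity (principal {s. \<bar>Arg s\<bar> \<le> pi - \<delta>})](\<lambda>_. 1)"
    using assms unfolding inverse_factorial_expansion_def gamma_ratio_def normaliser_def growth_base_def gamma_arg_def by blast
  have "\<rho> \<in> O[inf at_infinity (principal {s. \<bar>Arg s\<bar> \<le> pi - pi / 2})](\<lambda>_. 1)" by (rule O) auto
  then obtain B where "\<forall>\<^sub>F s in inf at_infinity (principal {s. \<bar>Arg s\<bar> \<le> pi - pi / 2}). norm (\<rho> s) \<le> B * norm (1 :: complex)"
    by (rule landau_o.bigE)
  then obtain S where S: "\<And>s. norm s \<ge> S \<Longrightarrow> \<bar>Arg s\<bar> \<le> pi - pi / 2 \<Longrightarrow> norm (\<rho> s) \<le> B"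
    unfolding eventually_inf_principal eventually_at_infinity by auto
  show ?thesis
  proof (rule that)
    fix s assume s: "Re s > 0" "norm s \<ge> max S (real w + real M + 2)"
    have sn: "norm s > real w + real M" "norm s > real w + 1" using s(2) by linarith+
    have reg: "regular_point s" using s(1) sn by (auto simp: regular_point_def complex_nonpos_Reals_iff)
    have "\<bar>Arg s\<bar> < pi" using Arg_half_plane[OF s(1)] pi_gt_zero by linarith
    then show "\<exists>q. norm q \<le> B \<and> gamma_ratio s = normaliser s * (gamma_sum c M s + q * Gamma (gamma_arg s - of_nat M))"
      using eq[of s] regular_pointD[OF reg] gamma_arg_minus_nonpole[OF reg sn(1)] S[of s] s Arg_half_plane[OF s(1)]
      by (intro exI[of _ "\<rho> s"]) simp
  qed
qed

text \<open>
  If two expansions first differ at \<open>j\<close>, their difference bounds \<open>(c j - c' j) (\<kappa>n + \<vartheta> - j - 1)\<close> for large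
  positive integers \<open>n\<close>, which forces \<open>c j = c' j\<close>.
\<close>

lemma inverse_factorial_coeffs_unique:
  assumes c: "\<And>M. M \<ge> 1 \<Longrightarrow> inverse_factorial_expansion w p c M"
    and c': "\<And>M. M \<ge> 1 \<Longrightarrow> inverse_factorial_expansion w p c' M"
  shows "c j = c' j"
proof (induction j rule: less_induct)
  case (less j)
  have Sj: "Suc j \<ge> 1" by simp
  obtain B S where 1: "\<And>s. Re s > 0 \<Longrightarrow> norm s \<ge> S \<Longrightarrow>
     \<exists>q. norm q \<le> B \<and> gamma_ratio s = normaliser s * (gamma_sum c (Suc j) s + q * Gamma (gamma_arg s - of_nat (Suc j)))"
    using inverse_factorial_expansion_half_plane[OF c[OF Sj]] by blast
  obtain B' S' where 2: "\<And>s. Re s > 0 \<Longrightarrow> norm s \<ge> S' \<Longrightarrow>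
     \<exists>q. norm q \<le> B' \<and> gamma_ratio s = normaliser s * (gamma_sum c' (Suc j) s + q * Gamma (gamma_arg s - of_nat (Suc j)))"
    using inverse_factorial_expansion_half_plane[OF c'[OF Sj]] by blast
  have bd: "\<bar>c j - c' j\<bar> * (real n - real w - real j - 1) \<le> B + B'" if n: "real n \<ge> max (max S S') (real w + real j + 3)" for n
  proof -
    let ?s = "of_nat n :: complex" and ?u = "gamma_arg (of_nat n) - of_nat (Suc j)"
    have sn: "norm ?s > real w + real (Suc j)" "norm ?s > real w + 1" "Re ?s > 0" using n by auto
    have reg: "regular_point ?s" using sn(2,3) by (auto simp: regular_point_def complex_nonpos_Reals_iff)
    have np: "?u \<notin> \<int>\<^sub>\<le>\<^sub>0" by (rule gamma_arg_minus_nonpole[OF reg sn(1)])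
    then have Gn: "Gamma ?u \<noteq> 0" by (simp only: Gamma_eq_zero_iff not_False_eq_True)
    obtain q where q: "norm q \<le> B" "gamma_ratio ?s = normaliser ?s * (gamma_sum c (Suc j) ?s + q * Gamma ?u)"
      using 1[OF sn(3)] n by auto
    obtain q' where q': "norm q' \<le> B'" "gamma_ratio ?s = normaliser ?s * (gamma_sum c' (Suc j) ?s + q' * Gamma ?u)"
      using 2[OF sn(3)] n by auto
    have "Gamma (gamma_arg ?s - of_nat j) = ?u * Gamma ?u" using Gamma_plus1[OF np] by simp
    moreover have "(\<Sum>i<j. (-1) ^ i * of_real (c i) * Gamma (gamma_arg ?s - of_nat i)) = (\<Sum>i<j. (-1) ^ i * of_real (c' i) * Gamma (gamma_arg ?s - of_nat i))"
      by (intro sum.cong refl) (use less in auto)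
    ultimately have "(-1) ^ j * of_real (c j) * (?u * Gamma ?u) + q * Gamma ?u = (-1) ^ j * of_real (c' j) * (?u * Gamma ?u) + q' * Gamma ?u"
      using q(2) q'(2) normaliser_nonzero[of ?s] by (simp only: sum.lessThan_Suc mult_cancel_left) (simp only: add.assoc add_left_cancel simp_thms)
    then have "((-1) ^ j * of_real (c j - c' j) * ?u - (q' - q)) * Gamma ?u = 0"
      by (simp only: of_real_diff ring_distribs left_diff_distrib right_diff_distrib) (simp add: algebra_simps del: of_nat_Suc)
    then have "(-1) ^ j * of_real (c j - c' j) * ?u = q' - q" using Gn by (simp only: mult_eq_0_iff simp_thms right_minus_eq)
    then have "norm ((-1) ^ j * of_real (c j - c' j) * ?u) = norm (q' - q)" by (simp only:)
    then have "\<bar>c j - c' j\<bar> * norm ?u = norm (q' - q)" by (simp only: norm_mult norm_power norm_minus_cancel norm_one power_one mult_1_left norm_of_real)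
    also have "\<dots> \<le> B + B'" using norm_triangle_ineq4[of q' q] q(1) q'(1) by linarith
    finally have 3: "\<bar>c j - c' j\<bar> * norm ?u \<le> B + B'" .
    have "real n - real w - real j - 1 \<le> norm ?u"
    proof -
      have "1 * real n \<le> kappa p * real n" using kappa_ge by (intro mult_right_mono) auto
      then have "real n - real w - real j - 1 \<le> Re ?u" by (simp add: gamma_arg_def vtheta_def)
      then show ?thesis using complex_Re_le_cmod order_trans by blast
    qed
    then have "\<bar>c j - c' j\<bar> * (real n - real w - real j - 1) \<le> \<bar>c j - c' j\<bar> * norm ?u" by (intro mult_left_mono) auto
    with 3 show ?thesis by linarith
  qed
  show ?case
  proof (rule ccontr)
    assume "c j \<noteq> c' j"
    then have pos: "\<bar>c j - c' j\<bar> > 0" by simp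
    obtain n where "real n \<ge> max (max (max S S') (real w + real j + 3)) ((B + B') / \<bar>c j - c' j\<bar> + real w + real j + 2)"
      using real_arch_simple by blast
    then have n: "real n \<ge> max (max S S') (real w + real j + 3)" "real n \<ge> (B + B') / \<bar>c j - c' j\<bar> + real w + real j + 2"
      by auto
    have "(B + B') / \<bar>c j - c' j\<bar> < real n - real w - real j - 1" using n(2) by linarith
    then have "B + B' < \<bar>c j - c' j\<bar> * (real n - real w - real j - 1)" using pos by (simp add: pos_divide_less_eq mult.commute)
    then show False using bd[OF n(1)] by linarith
  qed
qed

theorem c_coeff_expansion:
  assumes "M \<ge> 1" shows "inverse_factorial_expansion w p (c_coeff w p) M"
proof -
  obtain b where b: "\<And>n. good_coeffs b n" using good_coeffs_exist by blast
  define c where "c = (\<lambda>j. (-1) ^ j * b j)"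
  have ex: "inverse_factorial_expansion w p c M" if "M \<ge> 1" for M
    using inverse_factorial_expansion_good_coeffs[OF b[of "M - 1"]] that by (simp add: c_def)
  have "c_coeff w p = c" unfolding c_coeff_def
  proof (rule the_equality)
    show "c 0 = 1 \<and> (\<forall>M\<ge>1. inverse_factorial_expansion w p c M)"
      using b[of 0] ex by (simp add: c_def good_coeffs_def)
    show "c' = c" if "c' 0 = 1 \<and> (\<forall>M\<ge>1. inverse_factorial_expansion w p c' M)" for c'
      using inverse_factorial_coeffs_unique[of c' c] that ex by (intro ext) auto
  qed
  then show ?thesis using ex assms by simp
qed

section \<open>Integrals of the Gamma quotient near the saddle point\<close>

text \<open>
  For \<open>\<zeta> = ln X\<^sub>n - i\<theta>\<close> this is the factor of the \<open>n\<close>-th term of the integrand that depends on \<open>s\<close>. It is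
  parametrised by \<open>\<zeta>\<close> alone so that the estimates are uniform in \<open>a\<close> and \<open>n\<close>.
\<close>

definition "saddle_kernel \<zeta> s = gamma_ratio s * exp (s * (of_real (ln growth_base) - of_real (kappa p) * \<zeta>))" for \<zeta> s :: complex

lemma normaliser_times_exp:
  "normaliser s * exp (s * (of_real (ln growth_base) - of_real (kappa p) * \<zeta>)) = of_real (A_par w p / (2 * pi)) * exp (- (of_real (kappa p) * s * \<zeta>))"
  by (simp add: normaliser_exp exp_add[symmetric] algebra_simps mult.assoc)

lemma saddle_kernel_holomorphic: "saddle_kernel \<zeta> holomorphic_on {s. real w / real p < Re s \<and> Re s < r}"
proof -
  have a: "1 - of_nat w + of_nat p * s \<notin> \<int>\<^sub>\<le>\<^sub>0" if "real w / real p < Re s" for s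
  proof
    assume "1 - of_nat w + of_nat p * s \<in> \<int>\<^sub>\<le>\<^sub>0"
    then have "1 - real w + real p * Re s \<le> 0" by (auto elim!: nonpos_Ints_cases simp: complex_eq_iff)
    moreover have "real w < real p * Re s" using that p2 by (simp add: field_simps)
    ultimately show False by simp
  qed
  have b: "1 + s \<notin> \<int>\<^sub>\<le>\<^sub>0" if "real w / real p < Re s" for s
  proof
    assume "1 + s \<in> \<int>\<^sub>\<le>\<^sub>0"
    then have "1 + Re s \<le> 0" by (auto elim!: nonpos_Ints_cases simp: complex_eq_iff)
    moreover have "real w / real p \<ge> 0" by simp
    ultimately show False using that by linarith
  qed
  show ?thesis unfolding saddle_kernel_def [abs_def] gamma_ratio_def
    by (intro holomorphic_intros) (use a b in \<open>auto simp: Gamma_eq_zero_iff\<close>)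
qed

text \<open>
  The first term of the inverse factorial expansion and its remainder are both Gamma functions times bounded
  factors, and decay like \<open>\<Gamma>(u) e\<^bsup>-u\<zeta>\<^esup>\<close>.
\<close>

lemma saddle_kernel_decay:
  assumes \<zeta>: "\<bar>Im \<zeta>\<bar> < pi/2" and x1: "x1 > 0"
  obtains C Y where "\<And>s. x1 \<le> Re s \<Longrightarrow> Re s \<le> x2 \<Longrightarrow> \<bar>Im s\<bar> \<ge> Y \<Longrightarrow> norm (saddle_kernel \<zeta> s) \<le> C / (Im s)\<^sup>2"
proof -
  have one: "(1::nat) \<ge> 1" by simp
  obtain B S where BS: "\<And>s. Re s > 0 \<Longrightarrow> norm s \<ge> S \<Longrightarrow>
     \<exists>q. norm q \<le> B \<and> gamma_ratio s = normaliser s * ((\<Sum>j<1. (-1) ^ j * of_real (c_coeff w p j) * Gamma (gamma_arg s - of_nat j)) + q * Gamma (gamma_arg s - of_nat 1))"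
    using inverse_factorial_expansion_half_plane[OF c_coeff_expansion[OF one]] by blast
  obtain C where C: "\<And>u. kappa p * x1 + vtheta w - 1 \<le> Re u \<Longrightarrow> Re u \<le> kappa p * x2 + vtheta w \<Longrightarrow> \<bar>Im u\<bar> \<ge> 1 \<Longrightarrow> norm (Gamma u * exp (- (u * \<zeta>))) \<le> C / (Im u)\<^sup>2"
    using Gamma_exp_decay[OF \<zeta>] by blast
  define A0 where "A0 = A_par w p / (2 * pi)"
  have A0: "A0 > 0" using A_par_pos by (simp add: A0_def)
  define e0 e1 where "e0 = norm (exp (of_real (vtheta w) * \<zeta>))" and "e1 = norm (exp (of_real (vtheta w - 1) * \<zeta>))"
  have ee: "e0 \<ge> 0" "e1 \<ge> 0" by (auto simp: e0_def e1_def)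
  define D where "D = A0 * (\<bar>c_coeff w p 0\<bar> * \<bar>C\<bar> * e0 + \<bar>B\<bar> * \<bar>C\<bar> * e1)"
  have main: "norm (saddle_kernel \<zeta> s) \<le> D / (Im s)\<^sup>2" if s: "x1 \<le> Re s" "Re s \<le> x2" "\<bar>Im s\<bar> \<ge> max 1 S" for s
  proof -
    have s0: "Re s > 0" using s x1 by linarith
    have "\<bar>Im s\<bar> \<le> norm s" by (rule abs_Im_le_cmod)
    then obtain q where q: "norm q \<le> B" "gamma_ratio s = normaliser s * (of_real (c_coeff w p 0) * Gamma (gamma_arg s) + q * Gamma (gamma_arg s - 1))"
      using BS[OF s0] s(3) by auto
    have g: "norm (Gamma u * exp (- (u * \<zeta>))) \<le> \<bar>C\<bar> / (Im s)\<^sup>2" if u: "u = gamma_arg s \<or> u = gamma_arg s - 1" for u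
    proof -
      have im: "Im u = kappa p * Im s" and re: "kappa p * Re s + vtheta w - 1 \<le> Re u" "Re u \<le> kappa p * Re s + vtheta w"
        using u by (auto simp: gamma_arg_def)
      have k1: "kappa p * x1 \<le> kappa p * Re s" "kappa p * Re s \<le> kappa p * x2" using s kappa_ge by (auto intro: mult_left_mono)
      have "1 * \<bar>Im s\<bar> \<le> kappa p * \<bar>Im s\<bar>" using kappa_ge by (intro mult_right_mono) auto
      then have im2: "\<bar>Im s\<bar> \<le> \<bar>Im u\<bar>" using kappa_ge by (simp add: im abs_mult)
      have "norm (Gamma u * exp (- (u * \<zeta>))) \<le> C / (Im u)\<^sup>2" by (rule C) (use re k1 im2 s in linarith)+
      also have "\<dots> \<le> \<bar>C\<bar> / (Im u)\<^sup>2" by (intro divide_right_mono) auto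
      also have "\<dots> \<le> \<bar>C\<bar> / (Im s)\<^sup>2"
        using im2 s(3) by (intro divide_left_mono mult_pos_pos) (auto simp: abs_le_square_iff[symmetric])
      finally show ?thesis .
    qed
    have x0: "exp (- (of_real (kappa p) * s * \<zeta>)) = exp (- (gamma_arg s * \<zeta>)) * exp (of_real (vtheta w) * \<zeta>)"
      by (simp add: gamma_arg_def exp_add[symmetric] algebra_simps)
    have x1: "exp (- (of_real (kappa p) * s * \<zeta>)) = exp (- ((gamma_arg s - 1) * \<zeta>)) * exp (of_real (vtheta w - 1) * \<zeta>)"
      by (simp add: gamma_arg_def exp_add[symmetric] algebra_simps)
    have "saddle_kernel \<zeta> s = (of_real (c_coeff w p 0) * Gamma (gamma_arg s) + q * Gamma (gamma_arg s - 1)) * (normaliser s * exp (s * (of_real (ln growth_base) - of_real (kappa p) * \<zeta>)))"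
      by (simp add: saddle_kernel_def q(2) mult_ac)
    also have "\<dots> = of_real A0 * (of_real (c_coeff w p 0) * Gamma (gamma_arg s) * exp (- (of_real (kappa p) * s * \<zeta>)) + q * Gamma (gamma_arg s - 1) * exp (- (of_real (kappa p) * s * \<zeta>)))"
      unfolding normaliser_times_exp A0_def by (simp only: ring_distribs mult_ac)
    also have "\<dots> = of_real A0 * (of_real (c_coeff w p 0) * (Gamma (gamma_arg s) * exp (- (gamma_arg s * \<zeta>))) * exp (of_real (vtheta w) * \<zeta>)
       + q * (Gamma (gamma_arg s - 1) * exp (- ((gamma_arg s - 1) * \<zeta>))) * exp (of_real (vtheta w - 1) * \<zeta>))"
      by (subst x0, subst x1) (simp only: mult.assoc)
    finally have "norm (saddle_kernel \<zeta> s) = A0 * norm (of_real (c_coeff w p 0) * (Gamma (gamma_arg s) * exp (- (gamma_arg s * \<zeta>))) * exp (of_real (vtheta w) * \<zeta>)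
       + q * (Gamma (gamma_arg s - 1) * exp (- ((gamma_arg s - 1) * \<zeta>))) * exp (of_real (vtheta w - 1) * \<zeta>))"
      using A0 by (simp only: norm_mult norm_of_real abs_of_pos)
    also have "\<dots> \<le> A0 * (\<bar>c_coeff w p 0\<bar> * (\<bar>C\<bar> / (Im s)\<^sup>2) * e0 + \<bar>B\<bar> * (\<bar>C\<bar> / (Im s)\<^sup>2) * e1)"
    proof (intro mult_left_mono order_trans[OF norm_triangle_ineq] add_mono)
      show "norm (of_real (c_coeff w p 0) * (Gamma (gamma_arg s) * exp (- (gamma_arg s * \<zeta>))) * exp (of_real (vtheta w) * \<zeta>)) \<le> \<bar>c_coeff w p 0\<bar> * (\<bar>C\<bar> / (Im s)\<^sup>2) * e0"
        unfolding e0_def norm_mult[of _ "exp (of_real (vtheta w) * \<zeta>)"] norm_mult[of "of_real (c_coeff w p 0)"] norm_of_real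
        by (intro mult_right_mono mult_left_mono g) auto
      show "norm (q * (Gamma (gamma_arg s - 1) * exp (- ((gamma_arg s - 1) * \<zeta>))) * exp (of_real (vtheta w - 1) * \<zeta>)) \<le> \<bar>B\<bar> * (\<bar>C\<bar> / (Im s)\<^sup>2) * e1"
        unfolding e1_def norm_mult[of _ "exp (of_real (vtheta w - 1) * \<zeta>)"] norm_mult[of q]
        by (intro mult_right_mono mult_mono g) (use q(1) in auto)
    qed (use A0 in auto)
    also have "\<dots> = D / (Im s)\<^sup>2" by (simp add: D_def field_simps add_divide_distrib)
    finally show ?thesis .
  qed
  show ?thesis by (rule that[OF main])
qed

lemma saddle_kernel_continuous_line: "x > real w / real p \<Longrightarrow> continuous_on UNIV (\<lambda>y. saddle_kernel \<zeta> (Complex x y))"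
  by (rule continuous_on_vertical_line[OF saddle_kernel_holomorphic[of _ "x + 1"]]) auto

lemma quotient_abscissa_pos: "real w / real p > 0" using w1 p2 by simp

lemma saddle_kernel_integrable:
  assumes "\<bar>Im \<zeta>\<bar> < pi/2" "x > real w / real p"
  shows "integrable lborel (\<lambda>y. saddle_kernel \<zeta> (Complex x y))"
proof -
  have x0: "x > 0" using assms(2) quotient_abscissa_pos by linarith
  obtain C Y where C: "\<And>s. x \<le> Re s \<Longrightarrow> Re s \<le> x \<Longrightarrow> \<bar>Im s\<bar> \<ge> Y \<Longrightarrow> norm (saddle_kernel \<zeta> s) \<le> C / (Im s)\<^sup>2"
    using saddle_kernel_decay[OF assms(1) x0] by blast
  show ?thesis
  proof (rule integrable_if_inverse_square[where Y = Y and C = C])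
    show "continuous_on UNIV (\<lambda>y. saddle_kernel \<zeta> (Complex x y))" by (rule saddle_kernel_continuous_line[OF assms(2)])
    show "norm (saddle_kernel \<zeta> (Complex x y)) \<le> C / y\<^sup>2" if "Y \<le> \<bar>y\<bar>" for y
      using C[of "Complex x y"] that by simp
  qed
qed

lemma saddle_kernel_shift:
  assumes "\<bar>Im \<zeta>\<bar> < pi/2" "x1 > real w / real p" "x1 < x2"
  shows "line_integral x2 (saddle_kernel \<zeta>) = line_integral x1 (saddle_kernel \<zeta>)"
proof -
  have x0: "x1 > 0" using assms(2) quotient_abscissa_pos by linarith
  obtain C Y where C: "\<And>s. x1 \<le> Re s \<Longrightarrow> Re s \<le> x2 \<Longrightarrow> \<bar>Im s\<bar> \<ge> Y \<Longrightarrow> norm (saddle_kernel \<zeta> s) \<le> C / (Im s)\<^sup>2"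
    using saddle_kernel_decay[OF assms(1) x0] by blast
  show ?thesis
    by (rule line_integral_shift[OF saddle_kernel_holomorphic[of _ "x2 + 1"] assms(2,3) _ C]) auto
qed

definition "saddle_exponent X \<theta> = Complex (ln X) (- \<theta>)"

text \<open>
  With \<open>z = e\<^sup>\<zeta>\<close> this is \<open>z\<^bsup>\<vartheta>-j\<^esup> e\<^bsup>-z\<^esup>\<close>, the value of the Mellin integral of
  \<open>\<Gamma>(\<kappa>s + \<vartheta> - j)\<close> up to the factor \<open>2\<pi>/\<kappa>\<close>.
\<close>

definition "saddle_term \<zeta> j = exp (of_real (vtheta w - real j) * \<zeta>) * exp (- exp \<zeta>)" for \<zeta> :: complex and j :: nat

lemma exp_saddle_exponent: "X > 0 \<Longrightarrow> exp (saddle_exponent X \<theta>) = Complex (X * cos \<theta>) (- (X * sin \<theta>))"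
  by (simp add: saddle_exponent_def exp_eq_polar complex_eq_iff Re_exp Im_exp)

lemma norm_exp_mult_saddle_exponent:
  assumes "X > 0" shows "norm (exp (of_real t * saddle_exponent X \<theta>)) = X powr t"
  using assms by (simp add: norm_exp_eq_Re saddle_exponent_def powr_def)

lemma norm_saddle_term:
  assumes "X > 0"
  shows "norm (saddle_term (saddle_exponent X \<theta>) j) = X powr (vtheta w - real j) * exp (- (X * cos \<theta>))"
  unfolding saddle_term_def norm_mult norm_exp_mult_saddle_exponent[OF assms] exp_saddle_exponent[OF assms]
  by (simp add: norm_exp_eq_Re)

lemma Re_saddle_term:
  assumes "X > 0"
  shows "Re (saddle_term (saddle_exponent X \<theta>) j) = X powr (vtheta w - real j) * exp (- (X * cos \<theta>)) * cos (X * sin \<theta> + \<theta> * (real j - vtheta w))"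
proof -
  have "saddle_term (saddle_exponent X \<theta>) j = exp (of_real (vtheta w - real j) * saddle_exponent X \<theta> - exp (saddle_exponent X \<theta>))"
    by (simp add: saddle_term_def exp_diff exp_minus divide_inverse)
  also have "Re \<dots> = exp ((vtheta w - real j) * ln X - X * cos \<theta>) * cos (- ((vtheta w - real j) * \<theta>) + X * sin \<theta>)"
    unfolding exp_saddle_exponent[OF assms] by (simp add: Re_exp saddle_exponent_def)
  also have "exp ((vtheta w - real j) * ln X - X * cos \<theta>) = X powr (vtheta w - real j) * exp (- (X * cos \<theta>))"
    using assms by (simp add: powr_def exp_diff exp_minus divide_inverse)
  also have "- ((vtheta w - real j) * \<theta>) + X * sin \<theta> = X * sin \<theta> + \<theta> * (real j - vtheta w)"
    by (simp add: algebra_simps)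
  finally show ?thesis .
qed

lemma exp_kappa_split:
  "exp (- (of_real (kappa p) * s * \<zeta>)) = exp (- ((gamma_arg s - of_nat M + 2) * \<zeta>)) * exp (of_real (vtheta w - real M + 2) * \<zeta>)"
  by (simp add: gamma_arg_def exp_add[symmetric] algebra_simps)

abbreviation saddle_sum :: "complex \<Rightarrow> nat \<Rightarrow> complex" where
  "saddle_sum \<zeta> M \<equiv> of_real (A_par w p / kappa p) * (\<Sum>j<M. (-1) ^ j * of_real (c_coeff w p j) * saddle_term \<zeta> j)"

text \<open>
  The line is moved to the abscissa where \<open>Re(\<kappa>s + \<vartheta> - M + 2)\<close> is \<open>X cos \<theta>\<close> rounded up. On it the terms of
  the expansion are integrated exactly. The remainder contains \<open>\<Gamma>(u) = \<Gamma>(u+2) / (u (u+1))\<close> with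
  \<open>u = \<kappa>s + \<vartheta> - M\<close>: the numerator is bounded by \<open>Gamma_saddle_line\<close>, and the denominator makes the
  integral converge. The shift by 2 costs the factor \<open>X\<^sup>2\<close>.
\<close>

theorem saddle_kernel_integral_expansion_lossy:
  assumes th: "\<bar>\<theta>\<bar> < pi/2" and \<sigma>: "\<sigma> > real w / real p" and M1: "M \<ge> 1"
  obtains X0 C where "X0 \<ge> 1" "\<forall>X\<ge>X0.
    norm (line_integral \<sigma> (saddle_kernel (saddle_exponent X \<theta>)) - saddle_sum (saddle_exponent X \<theta>) M)
      \<le> C * (X powr (vtheta w - real M + 2) * exp (- (X * cos \<theta>)))"
proof -
  obtain B S where BS: "\<And>s. Re s > 0 \<Longrightarrow> norm s \<ge> S \<Longrightarrow>
     \<exists>q. norm q \<le> B \<and> gamma_ratio s = normaliser s * (gamma_sum (c_coeff w p) M s + q * Gamma (gamma_arg s - of_nat M))"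
    using inverse_factorial_expansion_half_plane[OF c_coeff_expansion[OF M1]] by blast
  have ct: "cos \<theta> > 0" using th by (intro cos_gt_zero_pi) auto
  define A0 where "A0 = A_par w p / (2 * pi)"
  have A0: "A0 > 0" using A_par_pos by (simp add: A0_def)
  define I where "I = (LINT y|lborel. 1 / (1 + y\<^sup>2 :: real))"
  define C where "C = A0 * \<bar>B\<bar> * exp 3 * I"
  \<comment> \<open>large enough for the saddle line to lie to the right of \<open>\<sigma>\<close> and in the range of the expansion\<close>
  define X0 where "X0 = max 1 ((3 + \<bar>vtheta w\<bar> + kappa p * (\<bar>\<sigma>\<bar> + \<bar>S\<bar> + 1)) / cos \<theta>)"
  have main: "norm (line_integral \<sigma> (saddle_kernel \<zeta>) - saddle_sum \<zeta> M)
      \<le> C * (X powr (vtheta w - real M + 2) * exp (- (X * cos \<theta>)))" if X: "X \<ge> X0" and z: "\<zeta> = saddle_exponent X \<theta>" for X \<zeta>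
  proof -
    have X1: "X \<ge> 1" using X by (simp add: X0_def)
    have k1: "kappa p \<ge> 1" by (rule kappa_ge)
    have "(3 + \<bar>vtheta w\<bar> + kappa p * (\<bar>\<sigma>\<bar> + \<bar>S\<bar> + 1)) / cos \<theta> \<le> X" using X by (simp add: X0_def)
    then have Xc: "3 + \<bar>vtheta w\<bar> + kappa p * (\<bar>\<sigma>\<bar> + \<bar>S\<bar> + 1) \<le> X * cos \<theta>" using ct by (simp add: field_simps)
    have im: "\<bar>Im \<zeta>\<bar> < pi/2" using th by (simp add: z saddle_exponent_def)
    define m where "m = nat \<lceil>X * cos \<theta>\<rceil>"
    have "kappa p * (\<bar>\<sigma>\<bar> + \<bar>S\<bar> + 1) \<ge> 0" using k1 by (intro mult_nonneg_nonneg) auto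
    then have Xc1: "X * cos \<theta> \<ge> 3" using Xc by linarith
    have m: "real m \<ge> X * cos \<theta>" unfolding m_def by linarith
    \<comment> \<open>the abscissa with \<open>\<kappa>x + \<vartheta> - M + 2 = m\<close>\<close>
    define x where "x = (real m + real M - 2 - vtheta w) / kappa p"
    have kx: "kappa p * x + vtheta w = real m + real M - 2" using k1 by (simp add: x_def)
    have "kappa p * (\<bar>\<sigma>\<bar> + \<bar>S\<bar> + 1) \<le> kappa p * x" using kx Xc m M1 by linarith
    then have xl: "\<bar>\<sigma>\<bar> + \<bar>S\<bar> + 1 \<le> x" using k1 by simp
    have xs: "x > \<sigma>" "x > real w / real p" "x > 0" "x \<ge> S" using xl \<sigma> by linarith+
    have shift: "line_integral \<sigma> (saddle_kernel \<zeta>) = line_integral x (saddle_kernel \<zeta>)" using saddle_kernel_shift[OF im \<sigma> xs(1)] by simp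
    define T where "T j s = Gamma (of_real (kappa p) * s + of_real (vtheta w - real j)) * exp (- (of_real (kappa p) * s * \<zeta>))" for j and s :: complex
    have pos: "kappa p * x + (vtheta w - real j) > 0" if "j < M" for j
      using kx m Xc1 that by simp
    have Tint: "integrable lborel (\<lambda>y. T j (Complex x y))" if "j < M" for j
      unfolding T_def by (rule Mellin_inversion_affine(1)[OF im _ pos[OF that]]) (use k1 in auto)
    have Tval: "line_integral x (T j) = 2 * pi / kappa p * saddle_term \<zeta> j" if "j < M" for j
      unfolding T_def [abs_def] saddle_term_def by (rule Mellin_inversion_affine(2)[OF im _ pos[OF that]]) (use k1 in auto)
    define Q where "Q s = of_real A0 * (\<Sum>j<M. (-1) ^ j * of_real (c_coeff w p j) * T j s)" for s
    have Qint: "integrable lborel (\<lambda>y. Q (Complex x y))"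
      unfolding Q_def by (intro integrable_mult_right Bochner_Integration.integrable_sum Tint) auto
    have Qval: "line_integral x Q = saddle_sum \<zeta> M"
    proof -
      have "line_integral x Q = of_real A0 * (\<Sum>j<M. (-1) ^ j * of_real (c_coeff w p j) * line_integral x (T j))"
        unfolding line_integral_def Q_def using Tint
        by (subst integral_mult_right_zero, subst Bochner_Integration.integral_sum) (auto intro!: integrable_mult_right)
      also have "\<dots> = of_real A0 * (\<Sum>j<M. (-1) ^ j * of_real (c_coeff w p j) * (2 * pi / kappa p * saddle_term \<zeta> j))"
        by (intro arg_cong2[of _ _ _ _ "(*)"] sum.cong refl) (simp add: Tval)
      also have "\<dots> = of_real (A0 * (2 * pi / kappa p)) * (\<Sum>j<M. (-1) ^ j * of_real (c_coeff w p j) * saddle_term \<zeta> j)"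
        by (simp add: sum_distrib_left mult_ac)
      also have "A0 * (2 * pi / kappa p) = A_par w p / kappa p" by (simp add: A0_def)
      finally show ?thesis .
    qed
    have diff: "line_integral \<sigma> (saddle_kernel \<zeta>) - saddle_sum \<zeta> M
        = (LINT y|lborel. saddle_kernel \<zeta> (Complex x y) - Q (Complex x y))"
      unfolding shift Qval[symmetric] unfolding line_integral_def
      using saddle_kernel_integrable[OF im xs(2)] Qint by simp
    define E where "E = A0 * \<bar>B\<bar> * (exp 3 * exp (- (X * cos \<theta>))) * X powr (vtheta w - real M + 2)"
    have pt: "norm (saddle_kernel \<zeta> (Complex x y) - Q (Complex x y)) \<le> E * (1 / (1 + y\<^sup>2))" for y
    proof -
      define s where "s = Complex x y"
      have "x \<le> norm s" using complex_Re_le_cmod[of s] by (simp add: s_def)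
      then have "norm s \<ge> S" "Re s > 0" using xs by (auto simp: s_def)
      then obtain q where q: "norm q \<le> B" "gamma_ratio s = normaliser s * (gamma_sum (c_coeff w p) M s + q * Gamma (gamma_arg s - of_nat M))"
        using BS[of s] by blast
      define u where "u = gamma_arg s - of_nat M"
      have Gj: "gamma_arg s - of_nat j = of_real (kappa p) * s + of_real (vtheta w - real j)" for j by (simp add: gamma_arg_def)
      have "saddle_kernel \<zeta> s = (gamma_sum (c_coeff w p) M s + q * Gamma u) *
          (normaliser s * exp (s * (of_real (ln growth_base) - of_real (kappa p) * \<zeta>)))"
        unfolding saddle_kernel_def q(2) u_def by (simp only: mult_ac)
      also have "\<dots> = Q s + of_real A0 * (q * (Gamma u * exp (- (of_real (kappa p) * s * \<zeta>))))"
        unfolding normaliser_times_exp Q_def T_def A0_def Gj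
        by (simp only: sum_distrib_left sum_distrib_right ring_distribs mult_ac)
      finally have d: "saddle_kernel \<zeta> s - Q s = of_real A0 * (q * (Gamma u * exp (- (of_real (kappa p) * s * \<zeta>))))" by simp
      have Reu: "Re u = real m - 2" using kx by (simp add: u_def gamma_arg_def s_def)
      have Imu: "Im u = kappa p * y" by (simp add: u_def gamma_arg_def s_def)
      have u1: "Re u \<ge> 1" using Reu m Xc1 by simp
      have nz: "u \<noteq> 0" "u + 1 \<noteq> 0" using u1 by (auto simp: complex_eq_iff)
      have nu: "u \<notin> \<int>\<^sub>\<le>\<^sub>0" using u1 by (auto elim!: nonpos_Ints_cases)
      have GG: "Gamma u = Gamma (u + 2) / (u * (u + 1))"
        using Gamma_eq_Gamma_shift[OF nu, of 2] by (simp add: numeral_2_eq_2 pochhammer_Suc)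
      have den: "1 + y\<^sup>2 \<le> norm (u * (u + 1))"
      proof -
        have "1 * \<bar>y\<bar> \<le> kappa p * \<bar>y\<bar>" using k1 by (intro mult_right_mono) auto
        then have "y\<^sup>2 \<le> (Im u)\<^sup>2" using k1 by (simp add: Imu abs_le_square_iff[symmetric] abs_mult)
        moreover have "1 \<le> (Re u)\<^sup>2" using u1 by (simp add: one_le_power)
        ultimately have "1 + y\<^sup>2 \<le> (norm u)\<^sup>2" unfolding cmod_power2 by linarith
        also have "\<dots> = norm u * norm u" by (simp add: power2_eq_square)
        also have "\<dots> \<le> norm u * norm (u + 1)"
        proof (rule mult_left_mono)
          have "(norm u)\<^sup>2 \<le> (norm (u + 1))\<^sup>2" using u1 unfolding cmod_power2 by (simp add: power2_eq_square algebra_simps)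
          then show "norm u \<le> norm (u + 1)" by (rule power2_le_imp_le) simp
        qed simp
        finally show ?thesis by (simp add: norm_mult)
      qed
      have "norm (Gamma (u + 2) * exp (- ((u + 2) * \<zeta>))) \<le> exp 3 * exp (- (X * cos \<theta>))"
        unfolding z saddle_exponent_def by (rule Gamma_saddle_line[OF th]) (use X1 Xc1 Reu in \<open>auto simp: m_def\<close>)
      moreover have "norm (exp (of_real (vtheta w - real M + 2) * \<zeta>)) = X powr (vtheta w - real M + 2)"
        unfolding z by (rule norm_exp_mult_saddle_exponent) (use X1 in auto)
      moreover have "norm (Gamma u * exp (- (of_real (kappa p) * s * \<zeta>))) = norm (Gamma (u + 2) * exp (- ((u + 2) * \<zeta>))) * norm (exp (of_real (vtheta w - real M + 2) * \<zeta>)) / norm (u * (u + 1))"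
        unfolding exp_kappa_split[of s \<zeta> M] u_def[symmetric] GG by (simp add: norm_mult norm_divide)
      ultimately have "norm (Gamma u * exp (- (of_real (kappa p) * s * \<zeta>))) \<le> (exp 3 * exp (- (X * cos \<theta>))) * X powr (vtheta w - real M + 2) / (1 + y\<^sup>2)"
        using den by (auto intro!: frac_le mult_right_mono simp: add_pos_nonneg)
      then have "norm q * norm (Gamma u * exp (- (of_real (kappa p) * s * \<zeta>))) \<le> \<bar>B\<bar> * ((exp 3 * exp (- (X * cos \<theta>))) * X powr (vtheta w - real M + 2) / (1 + y\<^sup>2))"
        using q(1) by (intro mult_mono) auto
      then have "A0 * (norm q * norm (Gamma u * exp (- (of_real (kappa p) * s * \<zeta>)))) \<le> A0 * (\<bar>B\<bar> * ((exp 3 * exp (- (X * cos \<theta>))) * X powr (vtheta w - real M + 2) / (1 + y\<^sup>2)))"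
        using A0 by (intro mult_left_mono) auto
      also have "\<dots> = E * (1 / (1 + y\<^sup>2))" by (simp add: E_def mult_ac)
      finally show ?thesis using A0 unfolding s_def[symmetric] d by (simp only: norm_mult norm_of_real abs_of_pos)
    qed
    have E0: "E \<ge> 0" unfolding E_def using A0 by (intro mult_nonneg_nonneg) auto
    have "norm (LINT y|lborel. saddle_kernel \<zeta> (Complex x y) - Q (Complex x y)) \<le> (LINT y|lborel. E * (1 / (1 + y\<^sup>2)))"
    proof (rule order_trans[OF integral_norm_bound])
      have i2: "integrable lborel (\<lambda>y :: real. E * (1 / (1 + y\<^sup>2)))" by (intro integrable_mult_right integrable_inverse_square_bound)
      have n2: "0 \<le> E * (1 / (1 + y\<^sup>2))" for y :: real using E0 by (intro mult_nonneg_nonneg) auto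
      show "(LINT y|lborel. norm (saddle_kernel \<zeta> (Complex x y) - Q (Complex x y))) \<le> (LINT y|lborel. E * (1 / (1 + y\<^sup>2)))"
        by (rule integral_mono'[OF i2 pt n2])
    qed
    also have "\<dots> = E * I" by (simp only: I_def integral_mult_right_zero)
    also have "\<dots> = C * (X powr (vtheta w - real M + 2) * exp (- (X * cos \<theta>)))" by (simp add: E_def C_def mult_ac)
    finally show ?thesis unfolding diff .
  qed
  show ?thesis by (rule that[of X0 C]) (use main in \<open>auto simp: X0_def\<close>)
qed

text \<open>
  The two extra terms have the size of the error allowed here, and with them the lossy bound suffices.
\<close>

theorem saddle_kernel_integral_expansion:
  assumes th: "\<bar>\<theta>\<bar> < pi/2" and \<sigma>: "\<sigma> > real w / real p"
  obtains X0 C where "X0 \<ge> 1" "\<forall>X\<ge>X0.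
    norm (line_integral \<sigma> (saddle_kernel (saddle_exponent X \<theta>)) - saddle_sum (saddle_exponent X \<theta>) M)
      \<le> C * (X powr (vtheta w - real M) * exp (- (X * cos \<theta>)))"
proof -
  have M1: "M + 2 \<ge> 1" by simp
  obtain X0 C where X0: "X0 \<ge> 1" and C: "\<forall>X\<ge>X0.
    norm (line_integral \<sigma> (saddle_kernel (saddle_exponent X \<theta>)) - saddle_sum (saddle_exponent X \<theta>) (M + 2))
      \<le> C * (X powr (vtheta w - real (M + 2) + 2) * exp (- (X * cos \<theta>)))"
    by (rule saddle_kernel_integral_expansion_lossy[OF th \<sigma> M1]) (rule that)
  define D where "D = A_par w p / kappa p * (\<bar>c_coeff w p M\<bar> + \<bar>c_coeff w p (Suc M)\<bar>)"
  have "norm (line_integral \<sigma> (saddle_kernel (saddle_exponent X \<theta>)) - saddle_sum (saddle_exponent X \<theta>) M)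
      \<le> (C + D) * (X powr (vtheta w - real M) * exp (- (X * cos \<theta>)))" if X: "X \<ge> X0" for X
  proof -
    have X1: "X \<ge> 1" using X X0 by simp
    let ?t = "saddle_term (saddle_exponent X \<theta>)" and ?W = "X powr (vtheta w - real M) * exp (- (X * cos \<theta>))"
    have Ak: "A_par w p / kappa p > 0" using A_par_pos kappa_ge by simp
    have t: "norm (?t j) \<le> ?W" if "j \<ge> M" for j
      using X1 that by (subst norm_saddle_term) (auto intro!: mult_right_mono powr_mono)
    define Z where "Z = (-1) ^ M * of_real (c_coeff w p M) * ?t M + (-1) ^ Suc M * of_real (c_coeff w p (Suc M)) * ?t (Suc M)"
    have "norm Z \<le> norm ((-1) ^ M * of_real (c_coeff w p M) * ?t M) + norm ((-1) ^ Suc M * of_real (c_coeff w p (Suc M)) * ?t (Suc M))"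
      unfolding Z_def by (rule norm_triangle_ineq)
    also have "\<dots> = \<bar>c_coeff w p M\<bar> * norm (?t M) + \<bar>c_coeff w p (Suc M)\<bar> * norm (?t (Suc M))"
      by (simp add: norm_mult norm_power)
    also have "\<dots> \<le> \<bar>c_coeff w p M\<bar> * ?W + \<bar>c_coeff w p (Suc M)\<bar> * ?W"
      by (intro add_mono mult_left_mono t) auto
    finally have "norm Z \<le> (\<bar>c_coeff w p M\<bar> + \<bar>c_coeff w p (Suc M)\<bar>) * ?W" by (simp add: distrib_right)
    then have "A_par w p / kappa p * norm Z \<le> A_par w p / kappa p * ((\<bar>c_coeff w p M\<bar> + \<bar>c_coeff w p (Suc M)\<bar>) * ?W)"
      using Ak by (intro mult_left_mono) auto
    then have Z: "norm (of_real (A_par w p / kappa p) * Z) \<le> D * ?W"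
      using Ak by (simp only: norm_mult norm_of_real abs_of_pos D_def mult.assoc)
    have s: "(\<Sum>j<M+2. (-1) ^ j * of_real (c_coeff w p j) * ?t j) = (\<Sum>j<M. (-1) ^ j * of_real (c_coeff w p j) * ?t j) + Z"
      by (simp add: Z_def numeral_2_eq_2 add.assoc)
    have e: "vtheta w - real (M + 2) + 2 = vtheta w - real M" by simp
    have "norm (line_integral \<sigma> (saddle_kernel (saddle_exponent X \<theta>)) - of_real (A_par w p / kappa p) * (\<Sum>j<M. (-1) ^ j * of_real (c_coeff w p j) * ?t j))
      = norm ((line_integral \<sigma> (saddle_kernel (saddle_exponent X \<theta>)) - of_real (A_par w p / kappa p) * (\<Sum>j<M+2. (-1) ^ j * of_real (c_coeff w p j) * ?t j)) + of_real (A_par w p / kappa p) * Z)"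
      unfolding s by (simp add: algebra_simps)
    also have "\<dots> \<le> C * ?W + D * ?W"
      using C[rule_format, OF X] Z unfolding e by (intro order_trans[OF norm_triangle_ineq] add_mono) auto
    finally show ?thesis by (simp add: distrib_right)
  qed
  then show ?thesis by (intro that[OF X0] allI impI)
qed

lemma saddle_kernel_integral_cnj: "line_integral \<sigma> (saddle_kernel (cnj \<zeta>)) = cnj (line_integral \<sigma> (saddle_kernel \<zeta>))"
proof -
  have k: "saddle_kernel (cnj \<zeta>) (cnj s) = cnj (saddle_kernel \<zeta> s)" for s
    by (simp add: saddle_kernel_def gamma_ratio_def cnj_Gamma exp_cnj)
  have "line_integral \<sigma> (saddle_kernel (cnj \<zeta>)) = \<bar>-1\<bar> *\<^sub>R (LINT y|lborel. saddle_kernel (cnj \<zeta>) (Complex \<sigma> (0 + (-1) * y)))"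
    unfolding line_integral_def by (rule lborel_integral_real_affine) auto
  also have "\<dots> = (LINT y|lborel. cnj (saddle_kernel \<zeta> (Complex \<sigma> y)))"
    using k[of "Complex \<sigma> _"] by (simp add: complex_cnj)
  also have "\<dots> = cnj (line_integral \<sigma> (saddle_kernel \<zeta>))" unfolding line_integral_def
    by (rule Bochner_Integration.integral_cnj)
  finally show ?thesis .
qed

lemma X_seq_pos: "a > 0 \<Longrightarrow> n \<ge> 1 \<Longrightarrow> X_seq p a n > 0"
  using kappa_ge p2 by (simp add: X_seq_def X_par_def chi_def h_par_def)

text \<open>
  The identity \<open>X\<^sub>n\<^sup>\<kappa> = h \<kappa>\<^sup>\<kappa> \<chi> n\<^sup>p\<close>, in logarithmic form.
\<close>

lemma ln_X_seq:
  assumes "a > 0" "n \<ge> 1"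
  shows "kappa p * ln (X_seq p a n) = ln growth_base + ln (chi p a) + real p * ln (real n)"
proof -
  have pos: "h_par p > 0" "chi p a > 0" "kappa p > 0" "real n > 0"
    using assms p2 kappa_ge by (auto simp: h_par_def chi_def)
  have "ln (X_seq p a n) = ln (kappa p) + (ln (h_par p) + ln (chi p a)) / kappa p + real p / kappa p * ln (real n)"
    using pos by (simp add: X_seq_def X_par_def ln_mult ln_powr)
  then show ?thesis using pos kappa_ge by (simp add: growth_base_def ln_mult ln_powr field_simps)
qed

lemma saddle_kernel_X_seq:
  assumes "a > 0" "n \<ge> 1"
  shows "saddle_kernel (saddle_exponent (X_seq p a n) \<theta>) s =
     gamma_ratio s * of_real (chi p a) powr (- s) * exp (\<i> * of_real (kappa p * \<theta>) * s) * of_nat n powr (- (of_nat p * s))"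
proof -
  have c: "chi p a > 0" using assms by (simp add: chi_def)
  have n: "real n > 0" using assms by simp
  have "of_real (kappa p) * saddle_exponent (X_seq p a n) \<theta> = of_real (kappa p * ln (X_seq p a n)) - \<i> * of_real (kappa p * \<theta>)"
    by (simp add: saddle_exponent_def complex_eq_iff)
  then have 1: "of_real (ln growth_base) - of_real (kappa p) * saddle_exponent (X_seq p a n) \<theta>
      = \<i> * of_real (kappa p * \<theta>) - of_real (ln (chi p a)) - of_nat p * of_real (ln (real n))"
    unfolding ln_X_seq[OF assms] by simp
  have 2: "complex_of_real (chi p a) powr (- s) = exp (- (s * of_real (ln (chi p a))))"
    using c by (simp add: powr_def Ln_of_real)
  have 3: "of_nat n powr (- (of_nat p * s)) = exp (- (of_nat p * s * of_real (ln (real n))))"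
    using n Ln_of_real[OF n] by (simp add: powr_def)
  show ?thesis unfolding saddle_kernel_def 1 2 3 by (simp add: exp_add[symmetric] mult.assoc right_diff_distrib exp_diff exp_minus field_simps)
qed

text \<open>
  On the line of integration \<open>Re(1 - w + ps) > 1\<close>, so the Dirichlet series of \<open>\<zeta>\<close> converges absolutely and
  uniformly. As the rest of the integrand is absolutely integrable, sum and integral may be exchanged.
\<close>

lemma J_rot_sums:
  assumes a: "a > 0" and th: "\<bar>\<theta>\<bar> < pi/2" and \<sigma>: "\<sigma> > real w / real p" and \<tau>: "pi * \<tau> = kappa p * \<theta>"
  shows "(\<lambda>m. of_real (real (Suc m) ^ (w - 1) / (2 * pi)) * line_integral \<sigma> (saddle_kernel (saddle_exponent (X_seq p a (Suc m)) \<theta>))) sums J_rot w p \<sigma> \<tau> a"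
proof -
  define g where "g y = gamma_ratio (Complex \<sigma> y) * of_real (chi p a) powr (- Complex \<sigma> y) * exp (\<i> * of_real (kappa p * \<theta>) * Complex \<sigma> y)" for y
  define f where "f m y = of_nat (Suc m) powr (- (1 - of_nat w + of_nat p * Complex \<sigma> y)) * g y" for m y
  have fk: "f m y = of_real (real (Suc m) ^ (w - 1)) * saddle_kernel (saddle_exponent (X_seq p a (Suc m)) \<theta>) (Complex \<sigma> y)" for m y
  proof -
    have n: "(of_nat (Suc m) :: complex) \<noteq> 0" by (simp del: of_nat_Suc)
    have "of_nat (Suc m) powr (- (1 - of_nat w + of_nat p * Complex \<sigma> y)) = of_nat (Suc m) powr (of_nat (w - 1) + (- (of_nat p * Complex \<sigma> y)))"
      using w1 by (simp add: of_nat_diff)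
    also have "\<dots> = of_nat (Suc m) ^ (w - 1) * of_nat (Suc m) powr (- (of_nat p * Complex \<sigma> y))"
      using n by (simp only: powr_add powr_nat') (simp del: of_nat_Suc)
    finally show ?thesis unfolding f_def g_def by (subst saddle_kernel_X_seq[OF a]) (simp_all add: mult_ac del: of_nat_Suc)
  qed
  have im: "\<bar>Im (saddle_exponent X \<theta>)\<bar> < pi/2" for X using th by (simp add: saddle_exponent_def)
  have fint: "integrable lborel (f m)" for m
    unfolding fk [abs_def] by (intro integrable_mult_right saddle_kernel_integrable im \<sigma>)
  define r where "r = 1 - real w + real p * \<sigma>"
  have r1: "r > 1" using \<sigma> p2 by (simp add: r_def field_simps)
  define g0 where "g0 y = norm (f 0 y)" for y
  have nf: "norm (f m y) = real (Suc m) powr (- r) * g0 y" for m y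
  proof -
    have "norm (of_nat (Suc m) powr (- (1 - of_nat w + of_nat p * Complex \<sigma> y))) = real (Suc m) powr (- r)" for m
      using norm_powr_real_powr[of "of_nat (Suc m)" "- (1 - of_nat w + of_nat p * Complex \<sigma> y)"] by (simp add: r_def del: of_nat_Suc)
    moreover have "real (Suc 0) powr - r = 1" by simp
    ultimately show ?thesis unfolding g0_def f_def norm_mult by (simp only: mult_1_left)
  qed
  have sr: "summable (\<lambda>m. real (Suc m) powr (- r))"
    using summable_real_powr_iff[of "- r"] r1 by (subst summable_Suc_iff) simp
  have "(\<lambda>m. LINT y|lborel. f m y) sums (LINT y|lborel. (\<Sum>m. f m y))"
  proof (rule sums_integral)
    show "integrable lborel (f m)" for m by (rule fint)
    show "AE y in lborel. summable (\<lambda>m. norm (f m y))"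
      unfolding nf by (intro AE_I2 summable_mult2 sr)
    show "summable (\<lambda>m. LINT y|lborel. norm (f m y))"
      unfolding nf integral_mult_right_zero by (intro summable_mult2 sr)
  qed
  moreover have "(\<Sum>m. f m y) = zeta (1 - of_nat w + of_nat p * Complex \<sigma> y) * g y" for y
  proof -
    define z where "z = 1 - of_nat w + of_nat p * Complex \<sigma> y"
    have "summable (\<lambda>m. norm (of_nat (Suc m) powr (- z)))"
    proof -
      have "norm (of_nat (Suc m) powr (- z)) = real (Suc m) powr (- r)" for m
        using norm_powr_real_powr[of "of_nat (Suc m)" "- z"] by (simp add: r_def z_def del: of_nat_Suc)
      then show ?thesis using sr by simp
    qed
    then have "summable (\<lambda>m. of_nat (Suc m) powr (- z) :: complex)" by (rule summable_norm_cancel)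
    then show ?thesis unfolding f_def zeta_def z_def[symmetric] by (rule suminf_mult2[symmetric])
  qed
  ultimately have "(\<lambda>m. LINT y|lborel. f m y) sums (LINT y|lborel. zeta (1 - of_nat w + of_nat p * Complex \<sigma> y) * g y)" by simp
  then have "(\<lambda>m. 1 / (2 * of_real pi) * (LINT y|lborel. f m y)) sums (1 / (2 * of_real pi) * (LINT y|lborel. zeta (1 - of_nat w + of_nat p * Complex \<sigma> y) * g y))"
    by (rule sums_mult)
  moreover have "1 / (2 * of_real pi) * (LINT y|lborel. f m y) = of_real (real (Suc m) ^ (w - 1) / (2 * pi)) * line_integral \<sigma> (saddle_kernel (saddle_exponent (X_seq p a (Suc m)) \<theta>))" for m
    unfolding fk line_integral_def integral_mult_right_zero by (simp del: of_nat_Suc)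
  moreover have "1 / (2 * of_real pi) * (LINT y|lborel. zeta (1 - of_nat w + of_nat p * Complex \<sigma> y) * g y) = J_rot w p \<sigma> \<tau> a"
  proof -
    have arg: "of_real pi * \<i> * of_real \<tau> * s = \<i> * of_real (kappa p * \<theta>) * s" for s
      unfolding \<tau>[symmetric] by simp
    show ?thesis unfolding J_rot_def vertical_integral_def g_def gamma_ratio_def arg by (simp add: mult.assoc)
  qed
  ultimately show ?thesis by simp
qed

section \<open>The exponentially small sums\<close>

lemma eventually_X_seq_ge: "\<forall>\<^sub>F a in at_right 0. \<forall>n\<ge>1. X_seq p a n \<ge> b"
proof -
  define B where "B = max 1 b"
  \<comment> \<open>the value of \<open>a\<close> at which \<open>h \<chi> = B\<^sup>\<kappa>\<close>\<close>
  define a0 where "a0 = h_par p * (2 * pi) ^ p / B powr kappa p"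
  have h: "h_par p > 0" using p2 by (simp add: h_par_def)
  have B: "B \<ge> 1" "B \<ge> b" by (auto simp: B_def)
  have k: "kappa p \<ge> 1" by (rule kappa_ge)
  have "a0 > 0" using h B by (simp add: a0_def)
  then have "\<forall>\<^sub>F a in at_right 0. a \<in> {0<..<a0}" by (rule eventually_at_right_real)
  then show ?thesis
  proof eventually_elim
    case (elim a)
    then have a: "a > 0" "a < a0" by auto
    have "B powr kappa p \<le> h_par p * chi p a"
      using a B by (simp add: a0_def chi_def field_simps)
    then have "(B powr kappa p) powr (1 / kappa p) \<le> (h_par p * chi p a) powr (1 / kappa p)"
      using k by (intro powr_mono2) auto
    then have "1 * B \<le> kappa p * (h_par p * chi p a) powr (1 / kappa p)"
      using k B by (intro mult_mono) (auto simp: powr_powr)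
    then have XB: "B \<le> X_par p a" by (simp add: X_par_def)
    show ?case
    proof (intro allI impI)
      fix n :: nat assume "n \<ge> 1"
      then have "1 \<le> real n powr (real p / kappa p)" using k by (intro ge_one_powr_ge_zero) auto
      then have "B * 1 \<le> X_par p a * real n powr (real p / kappa p)" using XB B by (intro mult_mono) auto
      then show "b \<le> X_seq p a n" using B by (simp add: X_seq_def)
    qed
  qed
qed

text \<open>
  The real part of the saddle integral, divided by the factor that the theorem puts in front of \<open>\<Upsilon>\<close>.
\<close>

definition "Upsilon \<sigma> n r a = Re (line_integral \<sigma> (saddle_kernel (saddle_exponent (X_seq p a n) (pi * psi p r)))) * (kappa p / A_par w p)
    * X_seq p a n powr (- vtheta w) * exp (X_seq p a n * cos (pi * psi p r))"

lemma Upsilon_term: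
  assumes "a > 0" "n \<ge> 1"
  shows "A_par w p / kappa p * (X_seq p a n powr vtheta w * exp (- X_seq p a n * cos (pi * psi p r)) * Upsilon \<sigma> n r a)
    = Re (line_integral \<sigma> (saddle_kernel (saddle_exponent (X_seq p a n) (pi * psi p r))))"
  using X_seq_pos[OF assms] A_par_pos kappa_ge
  by (simp add: Upsilon_def powr_minus exp_minus field_simps)

lemma Upsilon_expansion:
  assumes \<sigma>: "\<sigma> > real w / real p" and th: "\<bar>pi * psi p r\<bar> < pi / 2"
  shows "\<exists>C. \<forall>\<^sub>F a in at_right 0. \<forall>n\<ge>1.
       \<bar>Upsilon \<sigma> n r a -
          (\<Sum>j<M. (-1) ^ j * c_coeff w p j * X_seq p a n powr (- real j) *
             cos (X_seq p a n * sin (pi * psi p r) + pi * (real j - vtheta w) * psi p r))\<bar>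
       \<le> C * X_seq p a n powr (- real M)"
proof -
  define \<theta> where "\<theta> = pi * psi p r"
  obtain X0 C where X0: "X0 \<ge> 1" and C: "\<forall>X\<ge>X0.
    norm (line_integral \<sigma> (saddle_kernel (saddle_exponent X \<theta>)) - saddle_sum (saddle_exponent X \<theta>) M)
      \<le> C * (X powr (vtheta w - real M) * exp (- (X * cos \<theta>)))"
    by (rule saddle_kernel_integral_expansion[OF th[folded \<theta>_def] \<sigma>]) (rule that)
  have "\<forall>\<^sub>F a in at_right 0. \<forall>n\<ge>1. X_seq p a n \<ge> X0" by (rule eventually_X_seq_ge)
  then have "\<forall>\<^sub>F a in at_right 0. \<forall>n\<ge>1.
       \<bar>Upsilon \<sigma> n r a - (\<Sum>j<M. (-1) ^ j * c_coeff w p j * X_seq p a n powr (- real j) *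
             cos (X_seq p a n * sin (pi * psi p r) + pi * (real j - vtheta w) * psi p r))\<bar>
       \<le> (kappa p / A_par w p * C) * X_seq p a n powr (- real M)"
  proof (eventually_elim, intro allI impI)
    fix a and n :: nat assume "\<forall>n\<ge>1. X_seq p a n \<ge> X0" "n \<ge> 1"
    then have X: "X_seq p a n \<ge> X0" by blast
    define X where "X = X_seq p a n"
    have Xp: "X > 0" "X \<ge> X0" using X X0 by (auto simp: X_def)
    define L where "L = line_integral \<sigma> (saddle_kernel (saddle_exponent X \<theta>))"
    define V where "V = X powr (- vtheta w) * exp (X * cos \<theta>)"
    define K where "K = A_par w p / kappa p"
    define S where "S = (\<Sum>j<M. (-1) ^ j * c_coeff w p j * X powr (- real j) * cos (X * sin \<theta> + \<theta> * (real j - vtheta w)))"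
    have K: "K > 0" using A_par_pos kappa_ge by (simp add: K_def)
    have V: "V > 0" using Xp by (simp add: V_def)
    have VX: "V * (X powr (vtheta w - t) * exp (- (X * cos \<theta>))) = X powr (- t)" for t
    proof -
      have "V * (X powr (vtheta w - t) * exp (- (X * cos \<theta>))) = (X powr (- vtheta w) * X powr (vtheta w - t)) * (exp (X * cos \<theta>) * exp (- (X * cos \<theta>)))"
        by (simp add: V_def)
      also have "\<dots> = X powr (- t)" unfolding powr_add[symmetric] exp_add[symmetric] by simp
      finally show ?thesis .
    qed
    have ReS: "Re (of_real K * (\<Sum>j<M. (-1) ^ j * of_real (c_coeff w p j) * saddle_term (saddle_exponent X \<theta>) j)) * V = K * S"
    proof -
      have r: "Re ((-1) ^ j * of_real (c_coeff w p j) * saddle_term (saddle_exponent X \<theta>) j) = (-1) ^ j * c_coeff w p j * Re (saddle_term (saddle_exponent X \<theta>) j)" for j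
      proof -
        have "(-1) ^ j * complex_of_real (c_coeff w p j) = complex_of_real ((-1) ^ j * c_coeff w p j)" by simp
        then show ?thesis by (simp only: Re_complex_of_real) (simp only: times_complex.sel Re_complex_of_real Im_complex_of_real mult_zero_left diff_0_right)
      qed
      have "Re (\<Sum>j<M. (-1) ^ j * of_real (c_coeff w p j) * saddle_term (saddle_exponent X \<theta>) j) * V = S"
        unfolding Re_sum r Re_saddle_term[OF Xp(1)] sum_distrib_right S_def
        by (intro sum.cong refl) (simp add: VX[symmetric] mult_ac)
      then show ?thesis by (simp add: mult.assoc)
    qed
    have "\<bar>Re L * V - K * S\<bar> = \<bar>Re (L - of_real K * (\<Sum>j<M. (-1) ^ j * of_real (c_coeff w p j) * saddle_term (saddle_exponent X \<theta>) j))\<bar> * V"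
      unfolding ReS[symmetric] using V by (simp add: left_diff_distrib[symmetric] abs_mult)
    also have "\<dots> \<le> (C * (X powr (vtheta w - real M) * exp (- (X * cos \<theta>)))) * V"
      using C[rule_format, OF Xp(2)] V unfolding L_def K_def
      by (intro mult_right_mono order_trans[OF abs_Re_le_cmod]) auto
    also have "\<dots> = C * X powr (- real M)" unfolding VX[symmetric] by (simp add: mult_ac)
    finally have main: "\<bar>Re L * V - K * S\<bar> \<le> C * X powr (- real M)" .
    have U: "Upsilon \<sigma> n r a = Re L * V / K"
      by (simp add: Upsilon_def L_def V_def K_def X_def \<theta>_def)
    have S': "(\<Sum>j<M. (-1) ^ j * c_coeff w p j * X_seq p a n powr (- real j) *
             cos (X_seq p a n * sin (pi * psi p r) + pi * (real j - vtheta w) * psi p r)) = S"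
      unfolding S_def X_def \<theta>_def by (simp add: mult_ac)
    have "Re L * V / K - S = (Re L * V - K * S) / K" using K by (simp add: field_simps)
    then have "\<bar>Re L * V / K - S\<bar> = \<bar>Re L * V - K * S\<bar> / K" using K by (simp only: abs_divide abs_of_pos)
    also have "\<dots> \<le> (C * X powr (- real M)) / K" using main K by (intro divide_right_mono) auto
    finally show "\<bar>Upsilon \<sigma> n r a - (\<Sum>j<M. (-1) ^ j * c_coeff w p j * X_seq p a n powr (- real j) *
             cos (X_seq p a n * sin (pi * psi p r) + pi * (real j - vtheta w) * psi p r))\<bar>
       \<le> (kappa p / A_par w p * C) * X_seq p a n powr (- real M)"
      unfolding U S' unfolding X_def[symmetric] using K by (simp add: K_def mult_ac)
  qed
  then show ?thesis by blast
qed

text \<open>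
  Opposite rotations give conjugate integrals, so the terms of the two series add up to twice a real part.
\<close>

lemma E_fun_sums:
  assumes a: "a > 0" and \<sigma>: "\<sigma> > real w / real p" and th: "\<bar>pi * psi p r\<bar> < pi / 2"
    and \<tau>: "kappa p * psi p r = real p / 2 - 2 * real r - 1"
  shows "(\<lambda>m. complex_of_real (A_par w p / (pi * kappa p) *
               (real (Suc m) ^ (w - 1) * X_seq p a (Suc m) powr vtheta w *
                exp (- X_seq p a (Suc m) * cos (pi * psi p r)) * Upsilon \<sigma> (Suc m) r a))) sums E_fun w p \<sigma> r a"
proof -
  define \<theta> where "\<theta> = pi * psi p r"
  let ?L = "\<lambda>m. line_integral \<sigma> (saddle_kernel (saddle_exponent (X_seq p a (Suc m)) \<theta>))"
  have t1: "pi * (real p / 2 - 2 * real r - 1) = kappa p * \<theta>" "pi * (- (real p / 2 - 2 * real r - 1)) = kappa p * (- \<theta>)"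
    unfolding \<tau>[symmetric] by (simp_all add: \<theta>_def)
  have th2: "\<bar>\<theta>\<bar> < pi / 2" "\<bar>- \<theta>\<bar> < pi / 2" using th by (auto simp: \<theta>_def)
  have cj: "line_integral \<sigma> (saddle_kernel (saddle_exponent X (- \<theta>))) = cnj (line_integral \<sigma> (saddle_kernel (saddle_exponent X \<theta>)))" for X
  proof -
    have "saddle_exponent X (- \<theta>) = cnj (saddle_exponent X \<theta>)" by (simp add: saddle_exponent_def complex_eq_iff)
    then show ?thesis by (simp only: saddle_kernel_integral_cnj)
  qed
  have "(\<lambda>m. of_real (real (Suc m) ^ (w - 1) / (2 * pi)) * ?L m + of_real (real (Suc m) ^ (w - 1) / (2 * pi)) * cnj (?L m)) sums E_fun w p \<sigma> r a"
    unfolding E_fun_def cj[symmetric] by (intro sums_add J_rot_sums a th2 \<sigma> t1)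
  moreover have "of_real (real (Suc m) ^ (w - 1) / (2 * pi)) * ?L m + of_real (real (Suc m) ^ (w - 1) / (2 * pi)) * cnj (?L m)
     = complex_of_real (A_par w p / (pi * kappa p) *
               (real (Suc m) ^ (w - 1) * X_seq p a (Suc m) powr vtheta w *
                exp (- X_seq p a (Suc m) * cos (pi * psi p r)) * Upsilon \<sigma> (Suc m) r a))" for m
  proof -
    have "of_real (real (Suc m) ^ (w - 1) / (2 * pi)) * ?L m + of_real (real (Suc m) ^ (w - 1) / (2 * pi)) * cnj (?L m) = of_real (real (Suc m) ^ (w - 1) / (2 * pi) * (2 * Re (?L m)))"
      by (simp only: distrib_left[symmetric] complex_add_cnj of_real_mult)
    also have "real (Suc m) ^ (w - 1) / (2 * pi) * (2 * Re (?L m)) = real (Suc m) ^ (w - 1) / pi * Re (?L m)" by simp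
    also have "Re (?L m) = A_par w p / kappa p * (X_seq p a (Suc m) powr vtheta w * exp (- X_seq p a (Suc m) * cos (pi * psi p r)) * Upsilon \<sigma> (Suc m) r a)"
      unfolding \<theta>_def by (rule Upsilon_term[OF a, symmetric]) simp
    finally show ?thesis by (simp add: mult_ac)
  qed
  ultimately show ?thesis by (simp only:)
qed

text \<open>
  Without rotation the integral equals its own conjugate.
\<close>

lemma E_hat_sums:
  assumes a: "a > 0" and \<sigma>: "\<sigma> > real w / real p" and psi0: "psi p r = 0"
  shows "(\<lambda>m. complex_of_real (A_par w p / (2 * pi * kappa p) *
               (real (Suc m) ^ (w - 1) * X_seq p a (Suc m) powr vtheta w *
                exp (- X_seq p a (Suc m)) * Upsilon \<sigma> (Suc m) r a))) sums E_hat w p \<sigma> a"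
proof -
  let ?L = "\<lambda>m. line_integral \<sigma> (saddle_kernel (saddle_exponent (X_seq p a (Suc m)) 0))"
  have cj: "cnj (?L m) = ?L m" for m
  proof -
    have "saddle_exponent X 0 = cnj (saddle_exponent X 0)" for X by (simp add: saddle_exponent_def complex_eq_iff)
    then show ?thesis by (metis saddle_kernel_integral_cnj)
  qed
  have "(\<lambda>m. of_real (real (Suc m) ^ (w - 1) / (2 * pi)) * ?L m) sums E_hat w p \<sigma> a"
    unfolding E_hat_def by (rule J_rot_sums[OF a _ \<sigma>]) auto
  moreover have "of_real (real (Suc m) ^ (w - 1) / (2 * pi)) * ?L m
     = complex_of_real (A_par w p / (2 * pi * kappa p) *
               (real (Suc m) ^ (w - 1) * X_seq p a (Suc m) powr vtheta w *
                exp (- X_seq p a (Suc m)) * Upsilon \<sigma> (Suc m) r a))" for m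
  proof -
    have "?L m = of_real (Re (?L m))" using cj[of m] by (simp add: complex_eq_iff)
    moreover have "Re (?L m) = A_par w p / kappa p * (X_seq p a (Suc m) powr vtheta w * exp (- X_seq p a (Suc m)) * Upsilon \<sigma> (Suc m) r a)"
      using Upsilon_term[OF a, of "Suc m" r \<sigma>] unfolding psi0 by simp
    ultimately have "of_real (real (Suc m) ^ (w - 1) / (2 * pi)) * ?L m = of_real (real (Suc m) ^ (w - 1) / (2 * pi) * (A_par w p / kappa p * (X_seq p a (Suc m) powr vtheta w * exp (- X_seq p a (Suc m)) * Upsilon \<sigma> (Suc m) r a)))"
      by (simp only: of_real_mult)
    then show ?thesis by (simp add: mult_ac)
  qed
  ultimately show ?thesis by (simp only:)
qed

end

text \<open>
  The choice of \<open>N\<close> as nearest integer to \<open>p/4\<close> makes \<open>p/2 - 2r - 1\<close> positive for \<open>r < N\<close>, and it is smaller than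
  \<open>\<kappa>/2\<close>; hence all the rotations stay inside the half-plane of convergence.
\<close>

lemma psi_bound:
  assumes "even p" "p > 0" "r \<le> N_par p"
  shows "\<bar>pi * psi p r\<bar> < pi / 2" and "r < N_par p \<Longrightarrow> kappa p * psi p r = real p / 2 - 2 * real r - 1"
proof -
  have p2: "p \<ge> 2" using assms(1,2) by (auto elim!: evenE)
  have k: "kappa p > 0" "real p = kappa p + 1" using p2 by (auto simp: kappa_def)
  show "kappa p * psi p r = real p / 2 - 2 * real r - 1" if "r < N_par p" using that k by (simp add: psi_def)
  show "\<bar>pi * psi p r\<bar> < pi / 2"
  proof (cases "r < N_par p")
    case True
    have "nearest_int (real p / 4) = int (N_par p)" using True by (simp add: N_par_def)
    then have "real_of_int (int (N_par p)) - 1/2 < real p / 4" by (simp add: nearest_int_eq_iff)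
    moreover have "real (N_par p) \<ge> real r + 1" using True by simp
    ultimately have "real p / 2 - 2 * real r - 1 > - 1 + 1" by simp
    then have "0 < psi p r" using True k by (simp add: psi_def)
    moreover have "psi p r < 1 / 2" using True k by (simp add: psi_def field_simps)
    ultimately have "\<bar>psi p r\<bar> < 1/2" by simp
    then have "pi * \<bar>psi p r\<bar> < pi * (1/2)" by (intro mult_strict_left_mono) auto
    then show ?thesis by (simp add: abs_mult)
  qed (simp add: psi_def)
qed

theorem theorem2:
  fixes w p :: nat and \<sigma> :: real
  assumes "even w" and "w > 0" and "even p" and "p > 0"
    and "\<sigma> > real w / real p"
  shows "\<exists>\<Upsilon> :: nat \<Rightarrow> nat \<Rightarrow> real \<Rightarrow> real.
    (\<forall>a>0.
       (\<forall>r<N_par p.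
          (\<lambda>m. let n = Suc m in
             complex_of_real (A_par w p / (pi * kappa p) *
               (real n ^ (w - 1) * X_seq p a n powr vtheta w *
                exp (- X_seq p a n * cos (pi * psi p r)) * \<Upsilon> n r a)))
          sums E_fun w p \<sigma> r a) \<and>
       (\<lambda>m. let n = Suc m in
          complex_of_real (A_par w p / (2 * pi * kappa p) *
            (real n ^ (w - 1) * X_seq p a n powr vtheta w *
             exp (- X_seq p a n) * \<Upsilon> n (N_par p) a)))
       sums E_hat w p \<sigma> a) \<and>
    (\<forall>M\<ge>1. \<forall>r\<le>N_par p. \<exists>C. \<forall>\<^sub>F a in at_right 0. \<forall>n\<ge>1.
       \<bar>\<Upsilon> n r a -
          (\<Sum>j<M. (-1) ^ j * c_coeff w p j * X_seq p a n powr (- real j) *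
             cos (X_seq p a n * sin (pi * psi p r) + pi * (real j - vtheta w) * psi p r))\<bar>
       \<le> C * X_seq p a n powr (- real M))"
proof -
  have "p \<ge> 2" using assms(3,4) by (auto elim!: evenE)
  then interpret gamma_quotient w p using assms(2) by unfold_locales auto
  note psi = psi_bound[OF assms(3,4)]
  show ?thesis
  proof (intro exI[of _ "Upsilon \<sigma>"] conjI allI impI)
    fix a :: real and r assume "a > 0" "r < N_par p"
    then show "(\<lambda>m. let n = Suc m in
             complex_of_real (A_par w p / (pi * kappa p) *
               (real n ^ (w - 1) * X_seq p a n powr vtheta w *
                exp (- X_seq p a n * cos (pi * psi p r)) * Upsilon \<sigma> n r a)))
          sums E_fun w p \<sigma> r a"
      unfolding Let_def by (intro E_fun_sums assms psi) auto
  next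
    fix a :: real assume "a > 0"
    then show "(\<lambda>m. let n = Suc m in
          complex_of_real (A_par w p / (2 * pi * kappa p) *
            (real n ^ (w - 1) * X_seq p a n powr vtheta w *
             exp (- X_seq p a n) * Upsilon \<sigma> n (N_par p) a)))
       sums E_hat w p \<sigma> a"
      unfolding Let_def by (intro E_hat_sums assms) (auto simp: psi_def)
  next
    fix M r :: nat assume "r \<le> N_par p"
    then show "\<exists>C. \<forall>\<^sub>F a in at_right 0. \<forall>n\<ge>1.
       \<bar>Upsilon \<sigma> n r a -
          (\<Sum>j<M. (-1) ^ j * c_coeff w p j * X_seq p a n powr (- real j) *
             cos (X_seq p a n * sin (pi * psi p r) + pi * (real j - vtheta w) * psi p r))\<bar>
       \<le> C * X_seq p a n powr (- real M)"
      by (intro Upsilon_expansion assms psi)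
  qed
qed

end
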